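(* Let $T:\mathcal{M}_d(\mathbb{C})\to\mathcal{M}_d(\mathbb{C})$ be a trace-preserving Schwarz map. Then there exist finitely many indices $c$, positive integers $n_c,d_c$ with $\sum_cn_cd_c\le d$, and vectors $\mu^{(c)}\in\mathbb{C}^{d_c}$ with $|\mu^{(c)}_k|=1$ for all $k$, such that the peripheral spectrum of $T$, counted with algebraic multiplicity, is the multiset of the $\sum_cn_cd_c^2$ numbers $$\mu^{(c)}_k\,\overline{\mu^{(c)}_l}\,e^{2\pi i m/n_c},\qquad k,l\in\{1,\dots,d_c\},\ m\in\{0,\dots,n_c-1\},\ c \text{ ranging over the indices}.$$ Conversely, given any such data $(n_c,d_c,\mu^{(c)})$, there is a completely positive, trace-preserving, unital linear map $T$ on $\mathcal{M}_d(\mathbb{C})$ with $d=\sum_cn_cd_c$ whose peripheral spectrum (with multiplicity) is exactly this multiset and which has no other non-zero eigenvalue.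
   Context: The peripheral spectrum of a trace-preserving positive map $T$ is the multiset of its eigenvalues of modulus one (counted with algebraic multiplicity). A positive trace-preserving linear map $T$ on $\mathcal{M}_d(\mathbb{C})$ is a Schwarz map if its adjoint $T^*$ (defined by $\mathrm{tr}[AT^*(B)]=\mathrm{tr}[T(A)B]$) satisfies $T^*(A^\dagger A)\ge T^*(A^\dagger)T^*(A)$ for all $A$; every completely positive trace-preserving map is a Schwarz map. Unital: $T(\mathbbm{1})=\mathbbm{1}$. *)

theory Defs
  imports "Jordan_Normal_Form.Char_Poly" "HOL-Computational_Algebra.Polynomial"
begin

text \<open>Matrices in M_d(C) are complex matrices in carrier_mat d d; a map on M_d(C)
is a function T :: complex mat => complex mat, only its values on carrier_mat d d matter.\<close>

definition mtrace :: "complex mat \<Rightarrow> complex" where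
  "mtrace A = (\<Sum>i<dim_row A. A $$ (i, i))"

definition cadj :: "complex mat \<Rightarrow> complex mat" where
  "cadj A = mat (dim_col A) (dim_row A) (\<lambda>(i, j). cnj (A $$ (j, i)))"

definition psd :: "nat \<Rightarrow> complex mat \<Rightarrow> bool" where
  "psd n A \<longleftrightarrow> A \<in> carrier_mat n n \<and> cadj A = A \<and>
     (\<forall>v \<in> carrier_vec n. 0 \<le> Re (\<Sum>i<n. cnj (v $ i) * (A *\<^sub>v v) $ i))"

definition lin_map :: "nat \<Rightarrow> (complex mat \<Rightarrow> complex mat) \<Rightarrow> bool" where
  "lin_map d T \<longleftrightarrow>
     (\<forall>A \<in> carrier_mat d d. T A \<in> carrier_mat d d) \<and>
     (\<forall>A \<in> carrier_mat d d. \<forall>B \<in> carrier_mat d d. T (A + B) = T A + T B) \<and>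
     (\<forall>A \<in> carrier_mat d d. \<forall>c. T (c \<cdot>\<^sub>m A) = c \<cdot>\<^sub>m T A)"

definition positive_map :: "nat \<Rightarrow> (complex mat \<Rightarrow> complex mat) \<Rightarrow> bool" where
  "positive_map d T \<longleftrightarrow> (\<forall>A. psd d A \<longrightarrow> psd d (T A))"

definition trace_preserving :: "nat \<Rightarrow> (complex mat \<Rightarrow> complex mat) \<Rightarrow> bool" where
  "trace_preserving d T \<longleftrightarrow> (\<forall>A \<in> carrier_mat d d. mtrace (T A) = mtrace A)"

definition unital :: "nat \<Rightarrow> (complex mat \<Rightarrow> complex mat) \<Rightarrow> bool" where
  "unital d T \<longleftrightarrow> T (1\<^sub>m d) = 1\<^sub>m d"

definition is_adjoint_map :: "nat \<Rightarrow> (complex mat \<Rightarrow> complex mat) \<Rightarrow> (complex mat \<Rightarrow> complex mat) \<Rightarrow> bool" where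
  "is_adjoint_map d T S \<longleftrightarrow> (\<forall>B \<in> carrier_mat d d. S B \<in> carrier_mat d d) \<and>
     (\<forall>A \<in> carrier_mat d d. \<forall>B \<in> carrier_mat d d. mtrace (A * S B) = mtrace (T A * B))"

definition schwarz_map :: "nat \<Rightarrow> (complex mat \<Rightarrow> complex mat) \<Rightarrow> bool" where
  "schwarz_map d T \<longleftrightarrow> lin_map d T \<and> positive_map d T \<and> trace_preserving d T \<and>
     (\<exists>S. is_adjoint_map d T S \<and>
        (\<forall>A \<in> carrier_mat d d. psd d (S (cadj A * A) - S (cadj A) * S A)))"

text \<open>id_n tensor T acting on M_n(M_d) = M_{nd}: apply T to each d x d block.\<close>
definition ampliate :: "nat \<Rightarrow> nat \<Rightarrow> (complex mat \<Rightarrow> complex mat) \<Rightarrow> complex mat \<Rightarrow> complex mat" where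
  "ampliate n d T X = mat (n * d) (n * d) (\<lambda>(i, j).
     T (mat d d (\<lambda>(p, q). X $$ ((i div d) * d + p, (j div d) * d + q))) $$ (i mod d, j mod d))"

definition completely_positive :: "nat \<Rightarrow> (complex mat \<Rightarrow> complex mat) \<Rightarrow> bool" where
  "completely_positive d T \<longleftrightarrow>
     (\<forall>n. \<forall>X. psd (n * d) X \<longrightarrow> psd (n * d) (ampliate n d T X))"

definition unit_mat :: "nat \<Rightarrow> nat \<Rightarrow> nat \<Rightarrow> complex mat" where
  "unit_mat d k l = mat d d (\<lambda>(p, q). if p = k \<and> q = l then 1 else 0)"

text \<open>Matrix of T (d^2 x d^2) w.r.t. the basis of matrix units E_kl, index k*d+l.\<close>
definition map_matrix :: "nat \<Rightarrow> (complex mat \<Rightarrow> complex mat) \<Rightarrow> complex mat" where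
  "map_matrix d T = mat (d * d) (d * d) (\<lambda>(a, b).
     T (unit_mat d (b div d) (b mod d)) $$ (a div d, a mod d))"

definition eigenvalues_map :: "nat \<Rightarrow> (complex mat \<Rightarrow> complex mat) \<Rightarrow> complex multiset" where
  "eigenvalues_map d T = proots (char_poly (map_matrix d T))"

definition peripheral_spectrum :: "nat \<Rightarrow> (complex mat \<Rightarrow> complex mat) \<Rightarrow> complex multiset" where
  "peripheral_spectrum d T = filter_mset (\<lambda>z. cmod z = 1) (eigenvalues_map d T)"

text \<open>Data (n_c, mu^(c)) with d_c = length mu^(c).\<close>
definition valid_data :: "(nat \<times> complex list) list \<Rightarrow> bool" where
  "valid_data cs \<longleftrightarrow> (\<forall>(n, mu) \<in> set cs. n > 0 \<and> mu \<noteq> [] \<and> (\<forall>z \<in> set mu. cmod z = 1))"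

definition data_dim :: "(nat \<times> complex list) list \<Rightarrow> nat" where
  "data_dim cs = (\<Sum>(n, mu) \<leftarrow> cs. n * length mu)"

definition data_spectrum :: "(nat \<times> complex list) list \<Rightarrow> complex multiset" where
  "data_spectrum cs = (\<Sum>(n, mu) \<leftarrow> cs.
     mset [mu ! k * cnj (mu ! l) * exp (2 * of_real pi * \<i> * of_nat m / of_nat n).
             k \<leftarrow> [0..<length mu], l \<leftarrow> [0..<length mu], m \<leftarrow> [0..<n]])"

end

(* Work with the unital Schwarz map S = T^*, which has the same eigenvalues as T. Its powers are bounded,
   so peripheral Jordan blocks are trivial and a sequence of powers of S converges to the projection P
   onto the span X of the peripheral eigenvectors. P is again a unital Schwarz map, hence X is a
   finite-dimensional C*-algebra for the Choi-Effros product P (x y), and S acts on it as an automorphism.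
   Decompose the unit into minimal projections p of the fixed algebra. For a unimodular number l and two
   such projections p, r the space p X_l r, X_l being the l-eigenspace, has dimension at most one; the set
   G p r of all l for which it is nonzero satisfies G p r * G r s <= G p s, so each G p p is a group of
   roots of unity. The connected components of this groupoid are the summands c, with n_c = card (G p p),
   d_c the number of objects of the component, and mu_k an arbitrary element of G p_k p_1. The dimension
   bound holds because the spaces p X_l p generate a commutative algebra, and orthogonal projections
   p of X that sum to 1 satisfy p^2 <= tr(p) p, hence p = P (p^2) <= tr(p) p and tr(p) >= 1.
   Conversely, a pinching followed by a unitary conjugation that shifts the n_c blocks of size d_c
   cyclically has the required spectrum. *)

theory Submission
  imports Defs "HOL-Computational_Algebra.Fundamental_Theorem_Algebra"
    "HOL-Library.Function_Algebras" "Jordan_Normal_Form.Jordan_Normal_Form_Existence"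
begin

section \<open>Minimal projections in proper star-algebras\<close>

text \<open>Neither a C*-norm nor the classification of finite-dimensional C*-algebras enters: the
  first two sections rest on properness (\<open>star x \<diamondop> x = 0\<close> implies
  \<open>x = 0\<close>), finite dimension and the bound \<open>N\<close> on orthogonal projections.
  The condition |l| = 1 matters because \<open>star x \<diamondop> x\<close> then lies in the fixed
  algebra for x in X_l, where minimality turns compressions into scalars. One vector from each
  nonzero p X_l r gives a basis of X_l, so the multiplicity of l is the number of pairs (p, r) with
  l in \<open>G p r\<close>. The obstacle on the analytic side is that S satisfies only an
  inequality, while an automorphism is wanted. Recurrence supplies the reverse inequality: for an
  eigenvector a and h = P(a* a) one has S h >= h, yet the powers of S return to h. Equality then
  passes from a* a to all products y a, since the defect of the Schwarz inequality is itself a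
  positive form and obeys Cauchy-Schwarz. Passing to T^* turns trace preservation into unitality,
  and a unital Schwarz map satisfies S(f)* S(f) <= tr(f* f) 1, a bound shared by all its
  powers.\<close>

locale proper_star_algebra = vector_space scale
  for scale :: "complex \<Rightarrow> 'v::ab_group_add \<Rightarrow> 'v" (infixr "*s" 75) +
  fixes X :: "'v set" and mul :: "'v \<Rightarrow> 'v \<Rightarrow> 'v" (infixl "\<diamondop>" 70)
    and star :: "'v \<Rightarrow> 'v" and e :: 'v and N :: nat
  assumes subspace_X: "subspace X"
    and finite_dim: "\<exists>B. finite B \<and> X \<subseteq> span B"
    and mul_closed: "x \<in> X \<Longrightarrow> y \<in> X \<Longrightarrow> x \<diamondop> y \<in> X"
    and mul_add_left: "(x + y) \<diamondop> z = x \<diamondop> z + y \<diamondop> z"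
    and mul_add_right: "x \<diamondop> (y + z) = x \<diamondop> y + x \<diamondop> z"
    and mul_scale_left: "(c *s x) \<diamondop> y = c *s (x \<diamondop> y)"
    and mul_scale_right: "x \<diamondop> (c *s y) = c *s (x \<diamondop> y)"
    and mul_assoc: "(x \<diamondop> y) \<diamondop> z = x \<diamondop> (y \<diamondop> z)"
    and star_closed: "x \<in> X \<Longrightarrow> star x \<in> X"
    and star_add: "star (x + y) = star x + star y"
    and star_scale: "star (c *s x) = cnj c *s star x"
    and star_star: "star (star x) = x"
    and star_mul: "star (x \<diamondop> y) = star y \<diamondop> star x"
    and unit_closed: "e \<in> X"
    and unit_left: "x \<in> X \<Longrightarrow> e \<diamondop> x = x"
    and unit_right: "x \<in> X \<Longrightarrow> x \<diamondop> e = x"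
    and proper: "x \<in> X \<Longrightarrow> star x \<diamondop> x = 0 \<Longrightarrow> x = 0"
    and card_projections_le: "finite Q \<Longrightarrow> Q \<subseteq> X \<Longrightarrow>
          (\<And>p. p \<in> Q \<Longrightarrow> p \<noteq> 0 \<and> p \<diamondop> p = p \<and> star p = p) \<Longrightarrow>
          (\<And>p q. p \<in> Q \<Longrightarrow> q \<in> Q \<Longrightarrow> p \<noteq> q \<Longrightarrow> p \<diamondop> q = 0) \<Longrightarrow> \<Sum>Q = e \<Longrightarrow> card Q \<le> N"
begin

lemma mul_zero_left [simp]: "0 \<diamondop> x = 0"
  using mul_add_left[of 0 0 x] by simp

lemma mul_zero_right [simp]: "x \<diamondop> 0 = 0"
  using mul_add_right[of x 0 0] by simp

lemma mul_minus_left: "(- x) \<diamondop> y = - (x \<diamondop> y)"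
  using mul_add_left[of x "- x" y] by (simp add: eq_neg_iff_add_eq_0 add.commute)

lemma mul_minus_right: "x \<diamondop> (- y) = - (x \<diamondop> y)"
  using mul_add_right[of x y "- y"] by (simp add: eq_neg_iff_add_eq_0 add.commute)

lemma mul_diff_left: "(x - y) \<diamondop> z = x \<diamondop> z - y \<diamondop> z"
  using mul_add_left[of x "- y" z] by (simp add: mul_minus_left)

lemma mul_diff_right: "x \<diamondop> (y - z) = x \<diamondop> y - x \<diamondop> z"
  using mul_add_right[of x y "- z"] by (simp add: mul_minus_right)

lemma mul_sum_left: "sum f I \<diamondop> y = (\<Sum>i\<in>I. f i \<diamondop> y)"
  by (induction I rule: infinite_finite_induct) (auto simp: mul_add_left)

lemma mul_sum_right: "y \<diamondop> sum f I = (\<Sum>i\<in>I. y \<diamondop> f i)"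
  by (induction I rule: infinite_finite_induct) (auto simp: mul_add_right)

lemma star_zero [simp]: "star 0 = 0"
  using star_add[of 0 0] by simp

lemma star_minus: "star (- x) = - star x"
  using star_add[of x "- x"] by (simp add: eq_neg_iff_add_eq_0 add.commute)

lemma star_diff: "star (x - y) = star x - star y"
  using star_add[of x "- y"] by (simp add: star_minus)

lemma star_unit: "star e = e"
proof -
  have "star e = star e \<diamondop> e" by (simp add: star_closed unit_closed unit_right)
  then have "star (star e) = star (star e \<diamondop> e)" by simp
  also have "\<dots> = star e \<diamondop> e" by (simp add: star_mul star_star)
  also have "\<dots> = star e" by (simp add: star_closed unit_closed unit_right)
  finally show ?thesis by (simp add: star_star)
qed

lemma star_nonzero: "x \<noteq> 0 \<Longrightarrow> star x \<noteq> 0"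
  by (metis star_star star_zero)

definition projection :: "'v \<Rightarrow> bool" where
  "projection p \<longleftrightarrow> p \<in> X \<and> p \<diamondop> p = p \<and> star p = p"

definition star_subalgebra :: "'v set \<Rightarrow> bool" where
  "star_subalgebra B \<longleftrightarrow> subspace B \<and> B \<subseteq> X \<and> (\<forall>x\<in>B. \<forall>y\<in>B. x \<diamondop> y \<in> B) \<and> (\<forall>x\<in>B. star x \<in> B)"

text \<open>Here \<open>p\<close> plays the role of the unit.\<close>

definition peval :: "'v \<Rightarrow> 'v \<Rightarrow> complex poly \<Rightarrow> 'v" where
  "peval p y f = fold_coeffs (\<lambda>a v. a *s p + y \<diamondop> v) f 0"

lemma peval_0 [simp]: "peval p y 0 = 0"
  by (simp add: peval_def)

lemma peval_pCons [simp]: "peval p y (pCons a f) = a *s p + y \<diamondop> peval p y f"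
  by (cases "f = 0 \<and> a = 0") (auto simp: peval_def)

lemma peval_add: "peval p y (f + g) = peval p y f + peval p y g"
  by (induction f g rule: poly_induct2) (auto simp: scale_left_distrib mul_add_right)

lemma peval_smult: "peval p y (Polynomial.smult c f) = c *s peval p y f"
  by (induction f) (auto simp: scale_right_distrib mul_scale_right)

lemma peval_diff: "peval p y (f - g) = peval p y f - peval p y g"
  using peval_add[of p y f "Polynomial.smult (-1) g"] by (simp only: peval_smult) simp

lemma peval_sum: "peval p y (sum f I) = (\<Sum>i\<in>I. peval p y (f i))"
  by (induction I rule: infinite_finite_induct) (auto simp: peval_add)

lemma peval_monom: "peval p y (monom c n) = c *s (((\<diamondop>) y ^^ n) p)"
  by (induction n) (auto simp: monom_Suc mul_scale_right monom_0)

lemma peval_linear_factor: "peval p y ([:- r, 1:] * f) = y \<diamondop> peval p y f - r *s peval p y f"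
proof -
  have "[:- r, 1:] * f = pCons 0 f - Polynomial.smult r f" by simp
  then show ?thesis by (simp only: peval_diff peval_smult peval_pCons) simp
qed

text \<open>The vectors \<open>y^i p\<close> with i up to the size n of a finite spanning set are n
  + 1 elements of X, hence linearly dependent; the coefficients of a dependence form f.\<close>

lemma annihilating_poly_exists:
  assumes "y \<in> X" "p \<in> X"
  shows "\<exists>f. f \<noteq> 0 \<and> peval p y f = 0"
proof -
  define w where "w i = ((\<diamondop>) y ^^ i) p" for i :: nat
  have wX: "w i \<in> X" for i
    by (induction i) (auto simp: w_def assms intro: mul_closed)
  obtain B where B: "finite B" "X \<subseteq> span B" using finite_dim by blast
  define n where "n = card B"
  show ?thesis
  proof (cases "inj_on w {..n}")
    \<comment> \<open>Dependence is a notion for sets, so coinciding powers are treated apart: a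
      difference of monomials annihilates them.\<close>
    case False
    then obtain i j where ij: "i \<noteq> j" "w i = w j" by (auto simp: inj_on_def)
    have "monom 1 i - monom 1 j \<noteq> (0 :: complex poly)"
      using ij(1) by (metis coeff_diff coeff_monom diff_zero zero_neq_one coeff_0)
    moreover have "peval p y (monom 1 i - monom 1 j) = 0"
      using ij(2) by (simp add: peval_diff peval_monom w_def)
    ultimately show ?thesis by blast
  next
    case True
    have "\<not> independent (w ` {..n})"
    proof
      assume "independent (w ` {..n})"
      moreover have "w ` {..n} \<subseteq> span B" using wX B(2) by blast
      ultimately have "card (w ` {..n}) \<le> card B" using independent_span_bound[OF B(1)] by blast
      then show False using True by (simp add: card_image n_def)
    qed
    then obtain u where u: "\<exists>v\<in>w ` {..n}. u v \<noteq> 0" "(\<Sum>v\<in>w ` {..n}. u v *s v) = 0"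
      using dependent_finite[of "w ` {..n}"] by auto
    define f where "f = (\<Sum>i\<le>n. monom (u (w i)) i)"
    have cf: "coeff f j = u (w j)" if "j \<le> n" for j
      using that by (simp add: f_def coeff_sum if_distrib cong: if_cong)
    have "f \<noteq> 0" using u(1) cf by force
    moreover have "peval p y f = 0"
      using u(2) sum.reindex[OF True, of "\<lambda>v. u v *s v"]
      by (simp add: f_def peval_sum peval_monom w_def[symmetric])
    ultimately show ?thesis by blast
  qed
qed

text \<open>The spectral projection is \<open>z\<^sup>* z\<close> up to a scalar, where \<open>z\<close> is the value at \<open>y\<close> of the
  minimal polynomial of \<open>y\<close> divided by one of its linear factors.\<close>

lemma proper_subprojection_exists:
  assumes B: "star_subalgebra B" and p: "p \<in> B" "projection p" "p \<noteq> 0"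
    and y: "y \<in> B" "p \<diamondop> y = y" "y \<diamondop> p = y" "star y = y" "\<nexists>c. y = c *s p"
  obtains q where "q \<in> B" "projection q" "q \<noteq> 0" "q \<noteq> p" "p \<diamondop> q = q" "q \<diamondop> p = q"
proof -
  have BX: "B \<subseteq> X" and sB: "subspace B" and mB: "\<And>x y. x \<in> B \<Longrightarrow> y \<in> B \<Longrightarrow> x \<diamondop> y \<in> B"
    and stB: "\<And>x. x \<in> B \<Longrightarrow> star x \<in> B"
    using B by (auto simp: star_subalgebra_def)
  note subB = subspace_add[OF sB] subspace_scale[OF sB] subspace_0[OF sB]
  have pp: "p \<diamondop> p = p" "star p = p" using p by (auto simp: projection_def)
  \<comment> \<open>Least degree: up to a scalar, f is the minimal polynomial of y in the algebra
    with unit p.\<close>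
  obtain f where f: "f \<noteq> 0" "peval p y f = 0"
    and fmin: "\<And>g. g \<noteq> 0 \<Longrightarrow> peval p y g = 0 \<Longrightarrow> degree f \<le> degree g"
    using ex_has_least_nat[of "\<lambda>f. f \<noteq> 0 \<and> peval p y f = 0" _ degree]
      annihilating_poly_exists[of y p] y(1) p(1) BX by (metis subset_eq)
  have "degree f \<noteq> 0"
  proof
    assume "degree f = 0"
    then obtain a where "f = [:a:]" by (meson degree_eq_zeroE)
    then show False using f p(3) by simp
  qed
  then obtain r where "poly f r = 0"
    using fundamental_theorem_of_algebra[of f] by (auto simp: constant_degree)
  then obtain g where g: "f = [:- r, 1:] * g" by (metis dvdE poly_eq_0_iff_dvd)
  have g0: "g \<noteq> 0" using f(1) g by auto
  then have "degree f = degree [:- r, 1:] + degree g" unfolding g by (intro degree_mult_eq) auto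
  then have "degree f = Suc (degree g)" by simp
  then have z0: "peval p y g \<noteq> 0" using fmin[OF g0] by fastforce
  define z where "z = peval p y g"
  have yz: "y \<diamondop> z = r *s z"
    using f(2) by (simp add: g peval_linear_factor z_def del: mult_pCons_left)
  \<comment> \<open>Since y z = r z, every polynomial h in y acts on z as the number h(r); as y is
    self-adjoint, the star of h(y) acts through the polynomial with conjugated coefficients. For h =
    g this makes \<open>star z \<diamondop> z\<close> a multiple of z.\<close>
  have ev: "peval p y h \<in> B \<and> p \<diamondop> peval p y h = peval p y h \<and> peval p y h \<diamondop> p = peval p y h \<and>
      y \<diamondop> peval p y h = peval p y h \<diamondop> y \<and> peval p y h \<diamondop> z = poly h r *s z
      \<and> star (peval p y h) \<diamondop> z = poly (map_poly cnj h) r *s z" for h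
  proof (induction h)
    case 0
    then show ?case using subB by auto
  next
    case (pCons a h)
    have 1: "y \<diamondop> (peval p y h \<diamondop> y) = peval p y h \<diamondop> (y \<diamondop> y)" using pCons(2) by (metis mul_assoc)
    have 2: "p \<diamondop> (y \<diamondop> peval p y h) = y \<diamondop> peval p y h"
      by (metis mul_assoc y(2))
    have 3: "p \<diamondop> z = z" unfolding z_def
    proof (induction g)
      case (pCons a g)
      then show ?case by (simp add: mul_add_right mul_scale_right pp mul_assoc[symmetric] y)
    qed simp
    have 4: "y \<diamondop> peval p y h \<diamondop> z = (poly h r * r) *s z"
      using pCons(2) by (simp add: mul_assoc mul_scale_right yz)
    have 5: "star (peval p y h) \<diamondop> (y \<diamondop> z) = (poly (map_poly cnj h) r * r) *s z"
      using pCons(2) by (simp add: yz mul_scale_right mult.commute)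
    show ?case
      using pCons(2) 1 2 3 4 5 subB p(1) y mB
      by (simp add: yz mul_add_right mul_add_left mul_scale_right mul_scale_left pp mul_assoc
        star_add star_scale star_mul scale_left_distrib map_poly_pCons algebra_simps)
  qed
  define c where "c = poly (map_poly cnj g) r"
  define t where "t = c * poly g r"
  have zB: "z \<in> B" using ev[of g] by (simp add: z_def)
  have sz: "star z \<diamondop> z = c *s z" using ev[of g] by (simp add: z_def c_def)
  have zz: "z \<diamondop> z = poly g r *s z" using ev[of g] by (simp add: z_def)
  \<comment> \<open>h equals \<open>star z \<diamondop> z\<close>, so it is self-adjoint and
    nonzero; h h = t h with t nonzero by properness and real by self-adjointness, so h / t is a
    projection.\<close>
  define h where "h = c *s z"
  have hB: "h \<in> B" using zB subB by (simp add: h_def)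
  have sh: "star h = h" using sz by (metis h_def star_mul star_star)
  have h0: "h \<noteq> 0" using proper[of z] z0 zB BX sz by (auto simp: h_def z_def)
  have hh: "h \<diamondop> h = t *s h"
    by (simp add: h_def t_def mul_scale_left mul_scale_right zz algebra_simps)
  have t0: "t \<noteq> 0"
    using proper[of h] h0 hh sh hB BX by auto
  have "cnj t *s h = t *s h" by (metis hh sh star_mul star_scale)
  then have tr: "cnj t = t" using h0 by simp
  define q where "q = inverse t *s h"
  have q0: "q \<noteq> 0" using h0 t0 by (simp add: q_def)
  have qB: "q \<in> B" using hB subB by (simp add: q_def)
  have "star q = q" by (simp add: q_def star_scale sh tr)
  moreover have "q \<diamondop> q = q"
    using t0 by (simp add: q_def mul_scale_left mul_scale_right hh)
  moreover have yq: "y \<diamondop> q = r *s q"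
    by (simp add: q_def h_def mul_scale_right yz mult_ac)
  \<comment> \<open>q = p would give y = y p = r p, which is excluded.\<close>
  moreover have "q \<noteq> p" using yq y(3,5) by metis
  moreover have "p \<diamondop> q = q" "q \<diamondop> p = q"
    using ev[of g] by (simp_all add: q_def h_def mul_scale_right mul_scale_left z_def)
  ultimately show ?thesis using that q0 qB BX by (auto simp: projection_def)
qed

definition orthogonal_projections :: "'v set \<Rightarrow> bool" where
  "orthogonal_projections R \<longleftrightarrow> finite R \<and> (\<forall>p\<in>R. projection p \<and> p \<noteq> 0) \<and>
     (\<forall>p\<in>R. \<forall>q\<in>R. p \<noteq> q \<longrightarrow> p \<diamondop> q = 0) \<and> \<Sum>R = e"

lemma card_orthogonal_projections_le: "orthogonal_projections R \<Longrightarrow> card R \<le> N"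
  by (rule card_projections_le) (auto simp: orthogonal_projections_def projection_def)

text \<open>Resolutions of e inside B have at most N members, so one of maximal cardinality exists.
  If some p x p were not a multiple of p, a self-adjoint part of it would yield a projection q
  strictly below p, and replacing p by q and p - q would enlarge the resolution.\<close>

lemma minimal_projections_exist:
  assumes B: "star_subalgebra B" "e \<in> B"
  obtains R where "orthogonal_projections R" "R \<subseteq> B"
    "\<And>p x. p \<in> R \<Longrightarrow> x \<in> B \<Longrightarrow> \<exists>c. p \<diamondop> x \<diamondop> p = c *s p"
proof -
  have BX: "B \<subseteq> X" and sB: "subspace B" and mB: "\<And>x y. x \<in> B \<Longrightarrow> y \<in> B \<Longrightarrow> x \<diamondop> y \<in> B"
    and stB: "\<And>x. x \<in> B \<Longrightarrow> star x \<in> B"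
    using B by (auto simp: star_subalgebra_def)
  let ?P = "\<lambda>R. orthogonal_projections R \<and> R \<subseteq> B"
  have "\<exists>R. ?P R"
  proof (cases "e = 0")
    \<comment> \<open>Members of a resolution are nonzero, so the zero algebra starts from the empty
      set.\<close>
    case True
    then show ?thesis unfolding orthogonal_projections_def by (intro exI[of _ "{}"]) auto
  next
    case False
    then show ?thesis using B(2) BX
      by (intro exI[of _ "{e}"])
         (auto simp: orthogonal_projections_def projection_def star_unit unit_left)
  qed
  then obtain R where R: "orthogonal_projections R" "R \<subseteq> B"
    and Rmax: "\<And>R'. ?P R' \<Longrightarrow> card R' \<le> card R"
    \<comment> \<open>The maximum principle asks for a strict bound, hence
      \<open>Suc N\<close>.\<close>
    using ex_has_greatest_nat[of ?P _ card "Suc N"] card_orthogonal_projections_le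
    by (metis le_imp_less_Suc)
  have fR: "finite R" using R by (simp add: orthogonal_projections_def)
  have herm: "\<exists>c. y = c *s p" if p: "p \<in> R" and y: "y \<in> B" "p \<diamondop> y = y" "y \<diamondop> p = y" "star y = y" for p y
  proof (rule ccontr)
    assume nc: "\<nexists>c. y = c *s p"
    have pj: "projection p" "p \<noteq> 0" using p R by (auto simp: orthogonal_projections_def)
    obtain q where q: "q \<in> B" "projection q" "q \<noteq> 0" "q \<noteq> p" "p \<diamondop> q = q" "q \<diamondop> p = q"
      using proper_subprojection_exists[OF B(1) _ pj y nc] p R(2) by blast
    have orth: "x \<diamondop> q = 0" "q \<diamondop> x = 0" "x \<diamondop> p = 0" "p \<diamondop> x = 0" if "x \<in> R - {p}" for x
    proof -
      have *: "x \<diamondop> p = 0" "p \<diamondop> x = 0" using that p R by (auto simp: orthogonal_projections_def)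
      then show "x \<diamondop> p = 0" "p \<diamondop> x = 0" .
      show "x \<diamondop> q = 0" by (metis * mul_assoc mul_zero_left q(5))
      show "q \<diamondop> x = 0" by (metis * mul_assoc mul_zero_right q(6))
    qed
    have pp: "p \<diamondop> p = p" "star p = p" "q \<diamondop> q = q" "star q = q"
      using pj q by (auto simp: projection_def)
    have x_ne0: "x \<noteq> 0" "x \<diamondop> x = x" if "x \<in> R" for x using that R by (auto simp: orthogonal_projections_def projection_def)
    define R' where "R' = insert q (insert (p - q) (R - {p}))"
    have n1: "q \<notin> R - {p}" using orth[of q] q(3) pp by metis
    have n2: "p - q \<notin> R - {p}"
    proof
      assume a: "p - q \<in> R - {p}"
      have "(p - q) \<diamondop> p = 0" by (rule orth(3)[OF a])
      then show False using pp q by (simp add: mul_diff_left)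
    qed
    have n3: "q \<noteq> p - q"
    proof
      assume "q = p - q"
      then have "q \<diamondop> q = q \<diamondop> (p - q)" by simp
      then show False using q pp by (simp add: mul_diff_right)
    qed
    have "\<Sum>R' = q + ((p - q) + \<Sum>(R - {p}))"
      unfolding R'_def using n1 n2 n3 fR by simp
    also have "\<dots> = \<Sum>R" using sum.remove[OF fR p, of "\<lambda>x. x"] by simp
    finally have sum': "\<Sum>R' = e" using R by (simp add: orthogonal_projections_def)
    have R'B: "R' \<subseteq> B" using R(2) q(1) p subspace_diff[OF sB, of p q] by (auto simp: R'_def)
    have pq: "(p - q) \<diamondop> (p - q) = p - q" "star (p - q) = p - q" "p - q \<noteq> 0"
      "q \<diamondop> (p - q) = 0" "(p - q) \<diamondop> q = 0"
      using q pp by (auto simp: mul_diff_left mul_diff_right star_diff)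
    have "orthogonal_projections R'"
      unfolding orthogonal_projections_def
    proof (intro conjI ballI impI)
      show "finite R'" using fR by (simp add: R'_def)
      show "\<Sum>R' = e" by (rule sum')
    next
      fix x assume x: "x \<in> R'"
      show "projection x"
        using x R q pq R'B BX by (auto simp: R'_def projection_def orthogonal_projections_def)
      show "x \<noteq> 0" using x q(3) pq(3) x_ne0 by (auto simp: R'_def)
    next
      fix x y assume x: "x \<in> R'" and y: "y \<in> R'" and xy: "x \<noteq> y"
      have old: "x \<diamondop> y = 0" if "x \<in> R - {p}" "y \<in> R - {p}"
        using that R xy by (auto simp: orthogonal_projections_def)
      show "x \<diamondop> y = 0"
        using x y xy old pq(4,5) orth unfolding R'_def insert_iff
        by (metis mul_diff_left mul_diff_right diff_zero)
    qed
    then have "card R' \<le> card R" using Rmax R'B by blast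
    moreover have "card R' = Suc (card R)"
      unfolding R'_def using n1 n2 n3 fR p
      by (simp add: card_Diff_singleton_if) (metis Suc_pred card_gt_0_iff empty_iff)
    ultimately show False by simp
  qed
  show ?thesis
  proof (rule that[OF R])
    fix p x assume p: "p \<in> R" and x: "x \<in> B"
    have pp: "p \<diamondop> p = p" "star p = p" and pB: "p \<in> B"
      using p R by (auto simp: orthogonal_projections_def projection_def)
    define y where "y = p \<diamondop> x \<diamondop> p"
    have yB: "y \<in> B" using pB x mB by (simp add: y_def)
    have py: "p \<diamondop> y = y" "y \<diamondop> p = y" by (simp_all add: y_def mul_assoc[symmetric] pp) (simp add: mul_assoc pp)
    have psy: "p \<diamondop> star y = star y" "star y \<diamondop> p = star y"
      using py by (metis pp(2) star_mul)+
    note S = subspace_add[OF sB] subspace_diff[OF sB] subspace_scale[OF sB]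
    \<comment> \<open>y is recovered from the self-adjoint elements \<open>y + star y\<close> and
      \<open>\<i> *s (y - star y)\<close>, which \<open>herm\<close> shows to be multiples of
      p.\<close>
    obtain a where a: "y + star y = a *s p"
      using herm[OF p, of "y + star y"] yB S stB py psy
      by (auto simp: mul_add_left mul_add_right star_add star_star add.commute)
    obtain b where b: "\<i> *s (y - star y) = b *s p"
      using herm[OF p, of "\<i> *s (y - star y)"] yB S stB py psy
      by (auto simp: mul_diff_left mul_diff_right star_diff star_star mul_scale_left mul_scale_right star_scale
            scale_right_diff_distrib)
    have "- \<i> *s (\<i> *s (y - star y)) = (- \<i> * b) *s p" unfolding b by simp
    then have "y - star y = (- \<i> * b) *s p" by simp
    then have "2 *s y = (a - \<i> * b) *s p"
      using a by (simp add: scale_left_diff_distrib scale_left_distrib[of 1 1, simplified])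
         (metis add.commute add_diff_cancel_left' add_uminus_conv_diff diff_add_cancel diff_diff_eq2 minus_diff_eq)
    then have "(1/2) *s (2 *s y) = ((a - \<i> * b) / 2) *s p" by simp
    then show "\<exists>c. p \<diamondop> x \<diamondop> p = c *s p" by (intro exI[of _ "(a - \<i> * b) / 2"]) (simp add: y_def)
  qed
qed

end

section \<open>Automorphisms\<close>

text \<open>Multiplication by z permutes G, so the product over G equals z^n times itself and z^n =
  1 for n = card G; by cardinality G is the full set of n-th roots of unity. Inverses and
  unimodularity come for free, G being finite, closed under products and without 0.\<close>

lemma finite_circle_group_eq_roots_of_unity:
  fixes G :: "complex set"
  assumes G: "finite G" "1 \<in> G" "0 \<notin> G" "\<And>z w. z \<in> G \<Longrightarrow> w \<in> G \<Longrightarrow> z * w \<in> G"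
  shows "bij_betw (\<lambda>k. cis (2 * pi * real k / real (card G))) {..<card G} G"
proof -
  have n: "card G > 0" using G by (auto simp: card_gt_0_iff)
  have "z ^ card G = 1" if z: "z \<in> G" for z
  proof -
    have inj: "inj_on ((*) z) G" using z G(3) by (auto simp: inj_on_def)
    then have "(*) z ` G = G"
      using G(1,4) z by (intro card_subset_eq) (auto simp: card_image)
    then have "\<Prod>G = prod ((*) z) G"
      using prod.reindex[OF inj, of "\<lambda>x. x"] by simp
    also have "\<dots> = z ^ card G * \<Prod>G" by (simp add: prod.distrib)
    finally show ?thesis using G(1,3) by simp
  qed
  then have "G = {z. z ^ card G = 1}"
    using n card_roots_unity_eq[of "card G"] finite_roots_unity[of "card G"]
    by (intro card_subset_eq) auto
  then show ?thesis using bij_betw_roots_unity[OF n] by metis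
qed

text \<open>Bridge from indexed families to the set-based notion of independence; a repetition
  \<open>x s = x t\<close> would give a relation with coefficients 1 and -1.\<close>

lemma (in vector_space) independent_family:
  assumes "finite S" and zero: "\<And>u s. (\<Sum>s\<in>S. scale (u s) (x s)) = 0 \<Longrightarrow> s \<in> S \<Longrightarrow> u s = 0"
  shows "inj_on x S" "independent (x ` S)"
proof -
  show inj: "inj_on x S"
  proof (rule inj_onI, rule ccontr)
    fix s t assume st: "s \<in> S" "t \<in> S" "x s = x t" "s \<noteq> t"
    define u :: "'c \<Rightarrow> 'a" where "u r = (if r = s then 1 else if r = t then -1 else 0)" for r
    have "(\<Sum>r\<in>S. scale (u r) (x r)) = (\<Sum>r\<in>{s,t}. scale (u r) (x r))"
      by (rule sum.mono_neutral_right) (use st assms(1) in \<open>auto simp: u_def\<close>)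
    also have "\<dots> = 0" using st by (simp add: u_def)
    finally have "u s = 0" using zero st(1) by blast
    then show False by (simp add: u_def)
  qed
  show "independent (x ` S)"
  proof (rule independent_if_scalars_zero)
    fix f v assume "(\<Sum>v\<in>x ` S. scale (f v) v) = 0" "v \<in> x ` S"
    then show "f v = 0" using zero[of "\<lambda>s. f (x s)"] by (auto simp: sum.reindex[OF inj])
  qed (use assms in simp)
qed

locale star_automorphism = proper_star_algebra scale X mul star e N
  for scale :: "complex \<Rightarrow> 'v::ab_group_add \<Rightarrow> 'v" (infixr "*s" 75)
    and X :: "'v set" and mul :: "'v \<Rightarrow> 'v \<Rightarrow> 'v" (infixl "\<diamondop>" 70)
    and star :: "'v \<Rightarrow> 'v" and e :: 'v and N :: nat +
  fixes \<sigma> :: "'v \<Rightarrow> 'v"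
  assumes \<sigma>_add: "\<sigma> (x + y) = \<sigma> x + \<sigma> y"
    and \<sigma>_scale: "\<sigma> (c *s x) = c *s \<sigma> x"
    and \<sigma>_mul: "x \<in> X \<Longrightarrow> y \<in> X \<Longrightarrow> \<sigma> (x \<diamondop> y) = \<sigma> x \<diamondop> \<sigma> y"
    and \<sigma>_star: "\<sigma> (star x) = star (\<sigma> x)"
    and \<sigma>_unit: "\<sigma> e = e"
begin

definition E :: "complex \<Rightarrow> 'v set" where
  "E l = {x \<in> X. \<sigma> x = l *s x}"

text \<open>For fixed projections p and r this is the Peirce corner p X_l r; its nonzero elements
  realize the arrow l between p and r in the groupoid.\<close>

definition H :: "'v \<Rightarrow> 'v \<Rightarrow> complex \<Rightarrow> 'v set" where
  "H p r l = {x \<in> E l. p \<diamondop> x = x \<and> x \<diamondop> r = x}"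

definition G :: "'v \<Rightarrow> 'v \<Rightarrow> complex set" where
  "G p r = {l. cmod l = 1 \<and> (\<exists>x\<in>H p r l. x \<noteq> 0)}"

lemma \<sigma>_zero [simp]: "\<sigma> 0 = 0"
  using \<sigma>_add[of 0 0] by simp

lemma \<sigma>_sum: "\<sigma> (sum f I) = (\<Sum>i\<in>I. \<sigma> (f i))"
  by (induction I rule: infinite_finite_induct) (auto simp: \<sigma>_add)

lemma subspace_E: "subspace (E l)"
  unfolding E_def using subspace_X
  by (auto simp: subspace_def \<sigma>_add \<sigma>_scale scale_right_distrib mult.commute)

lemma E_mul: "x \<in> E l \<Longrightarrow> y \<in> E m \<Longrightarrow> x \<diamondop> y \<in> E (l * m)"
  by (auto simp: E_def mul_closed \<sigma>_mul mul_scale_left mul_scale_right mult.commute)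

lemma E_star: "x \<in> E l \<Longrightarrow> star x \<in> E (cnj l)"
  by (auto simp: E_def star_closed \<sigma>_star star_scale)

lemma fixed_star_subalgebra: "star_subalgebra (E 1)"
proof -
  have "E 1 \<subseteq> X" by (auto simp: E_def)
  then show ?thesis
    unfolding star_subalgebra_def using subspace_E[of 1] E_mul[of _ 1 _ 1] E_star[of _ 1] by auto
qed

lemma unit_fixed: "e \<in> E 1"
  by (simp add: E_def unit_closed \<sigma>_unit)

text \<open>\<open>\<sigma>\<close> - m annihilates the summand of m and multiplies every other one
  by l - m, which is nonzero, so induction on L applies.\<close>

lemma eigenvectors_sum_zero:
  assumes "finite L" "\<And>l. l \<in> L \<Longrightarrow> f l \<in> E l" "sum f L = 0" "l \<in> L"
  shows "f l = 0"
  using assms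
proof (induction L arbitrary: f l rule: finite_induct)
  case (insert m L)
  have s0: "f m + sum f L = 0" using insert by simp
  have "\<sigma> (f m + sum f L) - m *s (f m + sum f L) = 0" by (simp add: s0)
  moreover have "\<sigma> (sum f L) = (\<Sum>l\<in>L. l *s f l)"
    unfolding \<sigma>_sum by (intro sum.cong) (use insert(4) in \<open>auto simp: E_def\<close>)
  moreover have "\<sigma> (f m) = m *s f m" using insert(4)[of m] by (simp add: E_def)
  ultimately have "(\<Sum>l\<in>L. l *s f l) - (\<Sum>l\<in>L. m *s f l) = 0"
    by (simp add: \<sigma>_add scale_right_distrib scale_sum_right)
  then have s1: "(\<Sum>l\<in>L. (l - m) *s f l) = 0"
    by (simp add: sum_subtractf scale_left_diff_distrib)
  have z: "f l = 0" if "l \<in> L" for l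
  proof -
    have "(l - m) *s f l = 0"
      using insert.IH[of "\<lambda>l. (l - m) *s f l", OF _ s1 that] insert(4) subspace_E
      by (auto simp: subspace_scale)
    then show ?thesis using insert(2) that by auto
  qed
  then have "sum f L = 0" by simp
  then show ?case using s0 z insert.prems(3) by auto
qed auto

lemma finite_eigenvalues: "finite {l. \<exists>x\<in>E l. x \<noteq> 0}"
proof (rule ccontr)
  assume inf: "infinite {l. \<exists>x\<in>E l. x \<noteq> 0}"
  obtain B where B: "finite B" "X \<subseteq> span B" using finite_dim by blast
  obtain L where L: "finite L" "card L = Suc (card B)" "L \<subseteq> {l. \<exists>x\<in>E l. x \<noteq> 0}"
    using infinite_arbitrarily_large[OF inf] by blast
  then have "\<forall>l\<in>L. \<exists>x. x \<in> E l \<and> x \<noteq> 0" by blast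
  then obtain f where f: "\<And>l. l \<in> L \<Longrightarrow> f l \<in> E l \<and> f l \<noteq> 0" by metis
  have "u l = 0" if "(\<Sum>l\<in>L. u l *s f l) = 0" "l \<in> L" for u l
    using eigenvectors_sum_zero[OF L(1) _ that(1) that(2)] f subspace_E that(2)
    by (auto simp: subspace_scale)
  then have fam: "inj_on f L" "independent (f ` L)"
    using independent_family[OF L(1), of f] by auto
  have "f ` L \<subseteq> span B" using f B(2) by (auto simp: E_def)
  then have "card (f ` L) \<le> card B" using independent_span_bound[OF B(1) fam(2)] by blast
  then show False using fam(1) L(2) by (simp add: card_image)
qed

lemma finite_G: "finite (G p r)"
  by (rule finite_subset[OF _ finite_eigenvalues]) (auto simp: G_def H_def)

lemma H_mul: "x \<in> H p r l \<Longrightarrow> y \<in> H r s m \<Longrightarrow> x \<diamondop> y \<in> H p s (l * m)"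
  by (auto simp: H_def E_mul mul_assoc) (metis mul_assoc)

lemma H_star: "x \<in> H p r l \<Longrightarrow> star p = p \<Longrightarrow> star r = r \<Longrightarrow> star x \<in> H r p (cnj l)"
  unfolding H_def by (auto simp: E_star) (metis star_mul)+

text \<open>The double commutant of a star-closed set is a star-subalgebra containing it, and is
  commutative if the set is; it takes the place of the generated algebra.\<close>

definition commutant :: "'v set \<Rightarrow> 'v set" where
  "commutant S = {x \<in> X. \<forall>w\<in>S. x \<diamondop> w = w \<diamondop> x}"

lemma commutant_star_subalgebra:
  assumes "S \<subseteq> X" "\<And>x. x \<in> S \<Longrightarrow> star x \<in> S"
  shows "star_subalgebra (commutant S)" "e \<in> commutant S"
proof -
  have "star x \<diamondop> w = w \<diamondop> star x" if "x \<in> commutant S" "w \<in> S" for x w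
  proof -
    have "x \<diamondop> star w = star w \<diamondop> x" using that assms by (auto simp: commutant_def)
    then show ?thesis by (metis star_mul star_star)
  qed
  moreover have "x \<diamondop> y \<diamondop> w = w \<diamondop> (x \<diamondop> y)" if "x \<in> commutant S" "y \<in> commutant S" "w \<in> S" for x y w
  proof -
    have "x \<diamondop> y \<diamondop> w = x \<diamondop> (w \<diamondop> y)" using that by (simp add: commutant_def mul_assoc)
    also have "\<dots> = x \<diamondop> w \<diamondop> y" by (simp add: mul_assoc)
    also have "\<dots> = w \<diamondop> (x \<diamondop> y)" using that by (simp add: commutant_def mul_assoc)
    finally show ?thesis .
  qed
  moreover have "subspace (commutant S)"
    using subspace_X by (auto simp: commutant_def subspace_def mul_add_left mul_add_right
        mul_scale_left mul_scale_right)
  ultimately show "star_subalgebra (commutant S)"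
    unfolding star_subalgebra_def by (auto simp: commutant_def mul_closed star_closed)
  show "e \<in> commutant S"
    using assms by (auto simp: commutant_def unit_closed unit_left unit_right subset_eq)
qed

section \<open>Corners of the eigenspaces between minimal fixed projections\<close>

context
  fixes R assumes R: "orthogonal_projections R" "R \<subseteq> E 1"
    and minimal: "\<And>p x. p \<in> R \<Longrightarrow> x \<in> E 1 \<Longrightarrow> \<exists>c. p \<diamondop> x \<diamondop> p = c *s p"
begin

lemma fin_R: "finite R" and sum_R: "\<Sum>R = e"
  using R by (auto simp: orthogonal_projections_def)

lemma proj_R: assumes "p \<in> R" shows "p \<in> X" "p \<diamondop> p = p" "star p = p" "p \<noteq> 0"
  using R assms by (auto simp: orthogonal_projections_def projection_def)

lemma orth_R: "p \<in> R \<Longrightarrow> r \<in> R \<Longrightarrow> p \<noteq> r \<Longrightarrow> p \<diamondop> r = 0"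
  using R by (auto simp: orthogonal_projections_def)

lemma p_in_H: "p \<in> R \<Longrightarrow> p \<in> H p p 1"
  using R proj_R by (auto simp: H_def)

lemma H_one_scalar: "p \<in> R \<Longrightarrow> x \<in> H p p 1 \<Longrightarrow> \<exists>c. x = c *s p"
  using minimal[of p x] by (auto simp: H_def)

text \<open>The product lies in the corner at r of weight \<open>cnj l * l = 1\<close>, where
  minimality leaves only multiples of r; properness excludes zero.\<close>

lemma star_mul_self:
  assumes "p \<in> R" "r \<in> R" "x \<in> H p r l" "x \<noteq> 0" "cmod l = 1"
  obtains c where "c \<noteq> 0" "star x \<diamondop> x = c *s r"
proof -
  have "star x \<diamondop> x \<in> H r r (cnj l * l)" using assms proj_R by (intro H_mul H_star) auto
  moreover have "cnj l * l = 1" using assms(5) complex_norm_square[of l] by (simp add: mult.commute)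
  ultimately obtain c where "star x \<diamondop> x = c *s r" using H_one_scalar[OF assms(2)] by metis
  moreover have "star x \<diamondop> x \<noteq> 0" using assms proper by (auto simp: H_def E_def)
  ultimately show ?thesis using that by auto
qed

text \<open>Up to a nonzero scalar, \<open>star x\<close> is a left inverse of x on the corners
  starting at r, so y can be recovered from the product.\<close>

lemma H_mul_nonzero:
  assumes "p \<in> R" "r \<in> R" "x \<in> H p r l" "x \<noteq> 0" "cmod l = 1" "y \<in> H r s m" "y \<noteq> 0"
  shows "x \<diamondop> y \<noteq> 0"
proof
  assume "x \<diamondop> y = 0"
  obtain c where c: "c \<noteq> 0" "star x \<diamondop> x = c *s r" using star_mul_self[OF assms(1-5)] .
  have "c *s y = star x \<diamondop> (x \<diamondop> y)"
    using c assms(6) by (simp add: mul_assoc[symmetric] mul_scale_left H_def)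
  then show False using \<open>x \<diamondop> y = 0\<close> c assms by simp
qed

text \<open>\<open>star x \<diamondop> y\<close> is a multiple of r and
  \<open>x \<diamondop> star x\<close> a nonzero multiple of p; evaluating
  \<open>x \<diamondop> star x \<diamondop> y\<close> in both ways expresses y through x.\<close>

lemma H_one_dim:
  assumes pr: "p \<in> R" "r \<in> R" and x: "x \<in> H p r l" "x \<noteq> 0" and l: "cmod l = 1" and y: "y \<in> H p r l"
  shows "\<exists>c. y = c *s x"
proof -
  have ll: "cnj l * l = 1" using l complex_norm_square[of l] by (simp add: mult.commute)
  have sx: "star x \<in> H r p (cnj l)" using assms proj_R by (intro H_star) auto
  obtain c where c: "c \<noteq> 0" "star (star x) \<diamondop> star x = c *s p"
    using star_mul_self[OF pr(2,1) sx star_nonzero] x l by auto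
  have "star x \<diamondop> y \<in> H r r 1" using H_mul[OF sx y] ll by simp
  then obtain k where k: "star x \<diamondop> y = k *s r" using H_one_scalar pr by blast
  have "c *s y = x \<diamondop> (star x \<diamondop> y)"
    using c y by (simp add: mul_assoc[symmetric] mul_scale_left H_def star_star)
  also have "\<dots> = k *s x" using x by (simp add: k mul_scale_right H_def)
  finally have "inverse c *s (c *s y) = (inverse c * k) *s x" by simp
  then show ?thesis using c by auto
qed

lemma one_in_G: "p \<in> R \<Longrightarrow> 1 \<in> G p p"
  using p_in_H[of p] proj_R(4)[of p] by (auto simp: G_def)

lemma G_mul: "p \<in> R \<Longrightarrow> r \<in> R \<Longrightarrow> l \<in> G p r \<Longrightarrow> m \<in> G r s \<Longrightarrow> l * m \<in> G p s"
  unfolding G_def using H_mul H_mul_nonzero by (simp add: norm_mult) meson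

lemma G_cnj: "p \<in> R \<Longrightarrow> r \<in> R \<Longrightarrow> l \<in> G p r \<Longrightarrow> cnj l \<in> G r p"
  unfolding G_def using H_star proj_R(3) star_nonzero by simp meson

lemma compress_H: "p \<in> R \<Longrightarrow> r \<in> R \<Longrightarrow> x \<in> E l \<Longrightarrow> p \<diamondop> x \<diamondop> r \<in> H p r l"
  using E_mul[OF E_mul, of p 1 x l r 1] R proj_R
  by (auto simp: H_def mul_assoc) (metis mul_assoc)

text \<open>Take one nonzero vector from each nonzero corner: compression by p and r isolates the
  vector of (p, r), which gives independence, and y = e y e expands into such compressions, which
  gives spanning.\<close>

lemma dim_E:
  assumes l: "cmod l = 1"
  shows "dim (E l) = card {(p, r). p \<in> R \<and> r \<in> R \<and> l \<in> G p r}" (is "_ = card ?S")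
proof -
  have finS: "finite ?S" by (rule finite_subset[of _ "R \<times> R"]) (auto simp: fin_R)
  have "\<forall>s\<in>?S. \<exists>x. x \<in> H (fst s) (snd s) l \<and> x \<noteq> 0" by (auto simp: G_def)
  from bchoice[OF this]
  obtain x where x: "\<And>s. s \<in> ?S \<Longrightarrow> x s \<in> H (fst s) (snd s) l \<and> x s \<noteq> 0" by blast
  have comp: "fst t \<diamondop> x s \<diamondop> snd t = (if s = t then x s else 0)" if st: "s \<in> ?S" "t \<in> ?S" for s t
  proof -
    have xs: "fst s \<diamondop> x s = x s" "x s \<diamondop> snd s = x s" using x[OF st(1)] by (auto simp: H_def)
    show ?thesis
    proof (cases "s = t")
      case False
      have "fst t \<diamondop> x s \<diamondop> snd t = (fst t \<diamondop> fst s) \<diamondop> x s \<diamondop> (snd s \<diamondop> snd t)"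
        by (metis xs mul_assoc)
      moreover have "fst t \<diamondop> fst s = 0 \<or> snd s \<diamondop> snd t = 0"
        using False st orth_R by (metis (mono_tags, lifting) case_prodE fst_conv mem_Collect_eq snd_conv)
      ultimately show ?thesis using False by auto
    qed (use xs in auto)
  qed
  have "u t = 0" if u: "(\<Sum>s\<in>?S. u s *s x s) = 0" "t \<in> ?S" for u t
  proof -
    have "0 = fst t \<diamondop> (\<Sum>s\<in>?S. u s *s x s) \<diamondop> snd t" by (simp add: u)
    also have "\<dots> = (\<Sum>s\<in>?S. u s *s (fst t \<diamondop> x s \<diamondop> snd t))"
      by (simp add: mul_sum_left mul_sum_right mul_scale_left mul_scale_right)
    also have "\<dots> = (\<Sum>s\<in>?S. if s = t then u s *s x s else 0)"
      by (intro sum.cong refl) (simp add: comp[OF _ u(2)])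
    also have "\<dots> = u t *s x t" using finS u(2) by simp
    finally show ?thesis using x[OF u(2)] by simp
  qed
  then have fam: "inj_on x ?S" "independent (x ` ?S)"
    using independent_family[OF finS, of x] by blast+
  have "E l \<subseteq> span (x ` ?S)"
  proof
    fix y assume y: "y \<in> E l"
    have "p \<diamondop> y \<diamondop> r \<in> span (x ` ?S)" if pr: "p \<in> R" "r \<in> R" for p r
    proof (cases "l \<in> G p r")
      case True
      then have s: "(p, r) \<in> ?S" using that by simp
      obtain c where "p \<diamondop> y \<diamondop> r = c *s x (p, r)"
        using H_one_dim[OF pr _ _ l compress_H[OF pr y]] x[OF s] by auto
      then show ?thesis using span_scale[OF span_base[OF imageI[OF s, of x]]] by simp
    next
      case False
      then have "p \<diamondop> y \<diamondop> r = 0" using compress_H[OF that y] l by (auto simp: G_def)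
      then show ?thesis by (simp add: span_zero)
    qed
    then have "(\<Sum>r\<in>R. \<Sum>p\<in>R. p \<diamondop> y \<diamondop> r) \<in> span (x ` ?S)" by (intro span_sum) auto
    also have "(\<Sum>r\<in>R. \<Sum>p\<in>R. p \<diamondop> y \<diamondop> r) = e \<diamondop> y \<diamondop> e"
      by (simp add: mul_sum_left[symmetric] mul_sum_right[symmetric] sum_R)
    also have "\<dots> = y" using y by (auto simp: E_def unit_left unit_right)
    finally show "y \<in> span (x ` ?S)" .
  qed
  moreover have "x ` ?S \<subseteq> E l" using x by (force simp: H_def)
  ultimately have "card (x ` ?S) = dim (E l)" using fam(2) by (intro basis_card_eq_dim) auto
  then show ?thesis using fam(1) by (simp add: card_image)
qed

text \<open>\<open>G p p\<close> is cyclic with generator w = cis(2 pi / n). The powers of a nonzero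
  u of weight w are nonzero, so by \<open>H_one_dim\<close> each unimodular corner at p is spanned
  by such a power, and powers of one element commute.\<close>

lemma diagonal_H_commute:
  assumes p: "p \<in> R" and x: "x \<in> H p p l" "cmod l = 1" and y: "y \<in> H p p m" "cmod m = 1"
  shows "x \<diamondop> y = y \<diamondop> x"
proof (cases "x = 0 \<or> y = 0")
  case False
  define n where "n = card (G p p)"
  have bij: "bij_betw (\<lambda>k. cis (2 * pi * real k / real n)) {..<n} (G p p)"
    unfolding n_def
  proof (rule finite_circle_group_eq_roots_of_unity[OF finite_G one_in_G[OF p]])
    show "0 \<notin> G p p" by (simp add: G_def)
  qed (rule G_mul[OF p p])
  have n: "n > 0" using one_in_G[OF p] finite_G[of p p] by (auto simp: n_def card_gt_0_iff)
  define w where "w = cis (2 * pi / real n)"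
  have pw: "\<exists>k. z = w ^ k" if z: "z \<in> G p p" for z
  proof -
    obtain k where "z = cis (2 * pi * real k / real n)" using bij z by (auto simp: bij_betw_def)
    also have "\<dots> = w ^ k" by (simp add: w_def DeMoivre algebra_simps)
    finally show ?thesis by blast
  qed
  \<comment> \<open>The range \<open>{..<n}\<close> contains the exponent 1 only if n > 1; for n = 1
    the generator is 1 itself.\<close>
  have "w \<in> G p p"
  proof (cases "n = 1")
    case True
    then show ?thesis using one_in_G[OF p] by (simp add: w_def)
  next
    case False
    then have "1 \<in> {..<n}" using n by auto
    then have "cis (2 * pi * real 1 / real n) \<in> G p p" using bij_betwE[OF bij] by blast
    then show ?thesis by (simp add: w_def)
  qed
  then obtain u where u: "u \<in> H p p w" "u \<noteq> 0" by (auto simp: G_def)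
  define v where "v k = ((\<diamondop>) u ^^ k) p" for k :: nat
  have v: "v k \<in> H p p (w ^ k) \<and> v k \<noteq> 0" for k
  proof (induction k)
    case (Suc k)
    have "u \<diamondop> v k \<in> H p p (w * w ^ k)" using H_mul[OF u(1)] Suc by blast
    moreover have "u \<diamondop> v k \<noteq> 0" using H_mul_nonzero[OF p p u] Suc by (auto simp: w_def)
    ultimately show ?case by (simp add: v_def)
  qed (use p proj_R p_in_H in \<open>auto simp: v_def\<close>)
  have vadd: "v (i + j) = v i \<diamondop> v j" for i j
  proof (induction i)
    case 0
    then show ?case using v[of j] by (simp add: v_def H_def)
  qed (auto simp: v_def mul_assoc)
  have span_v: "\<exists>c k. z = c *s v k" if z: "z \<in> H p p a" "cmod a = 1" "z \<noteq> 0" for z a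
  proof -
    have "a \<in> G p p" using z by (auto simp: G_def)
    then obtain k where "a = w ^ k" using pw by blast
    then show ?thesis using H_one_dim[OF p p _ _ z(2) z(1), of "v k"] v[of k] by auto
  qed
  obtain a i where "x = a *s v i" using span_v[OF x] False by blast
  moreover obtain b j where "y = b *s v j" using span_v[OF y] False by blast
  ultimately show ?thesis
    by (simp add: mul_scale_left mul_scale_right vadd[symmetric] add.commute mult.commute)
qed auto

text \<open>The spaces \<open>H p p l\<close> generate a commutative subalgebra, hence lie in the span of at most
  \<open>N\<close> orthogonal projections.\<close>

lemma sum_card_diagonal_G_le: "(\<Sum>p\<in>R. card (G p p)) \<le> N"
proof -
  define W where "W = {x. \<exists>p\<in>R. \<exists>l. cmod l = 1 \<and> x \<in> H p p l}"
  define A where "A = commutant (commutant W)"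
  have WX: "W \<subseteq> X" by (auto simp: W_def H_def E_def)
  have Wstar: "star x \<in> W" if xW: "x \<in> W" for x
  proof -
    obtain p l where x: "p \<in> R" "cmod l = 1" "x \<in> H p p l" using xW by (auto simp: W_def)
    then have "star x \<in> H p p (cnj l)" using H_star proj_R(3) by blast
    then show ?thesis unfolding W_def using x
      by (intro CollectI bexI[of _ p] exI[of _ "cnj l"]) auto
  qed
  have Wcomm: "x \<diamondop> y = y \<diamondop> x" if xW: "x \<in> W" and yW: "y \<in> W" for x y
  proof -
    obtain p l where x: "p \<in> R" "cmod l = 1" "x \<in> H p p l" using xW by (auto simp: W_def)
    obtain r m where y: "r \<in> R" "cmod m = 1" "y \<in> H r r m" using yW by (auto simp: W_def)
    show ?thesis
    proof (cases "p = r")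
      case True
      then show ?thesis using x y diagonal_H_commute by blast
    next
      case False
      have 1: "p \<diamondop> x = x" "x \<diamondop> p = x" "r \<diamondop> y = y" "y \<diamondop> r = y" using x y by (auto simp: H_def)
      have "x \<diamondop> y = x \<diamondop> (p \<diamondop> r) \<diamondop> y" by (metis 1 mul_assoc)
      moreover have "y \<diamondop> x = y \<diamondop> (r \<diamondop> p) \<diamondop> x" by (metis 1 mul_assoc)
      ultimately show ?thesis using orth_R x(1) y(1) False by simp
    qed
  qed
  have W': "star_subalgebra (commutant W)" by (rule commutant_star_subalgebra[OF WX Wstar])
  have A: "star_subalgebra A" "e \<in> A"
    unfolding A_def using W' commutant_star_subalgebra[of "commutant W"]
    unfolding star_subalgebra_def[of "commutant W"] by blast+
  have WA: "W \<subseteq> A" and AX: "A \<subseteq> X" using WX by (auto simp: A_def commutant_def)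
  have Acomm: "x \<diamondop> y = y \<diamondop> x" if "x \<in> A" "y \<in> A" for x y
  proof -
    have "W \<subseteq> commutant W" using Wcomm WX by (auto simp: commutant_def)
    then have "x \<in> commutant W" using that(1) by (auto simp: A_def commutant_def)
    then show ?thesis using that(2) by (auto simp: A_def commutant_def)
  qed
  obtain Q where Q: "orthogonal_projections Q" "Q \<subseteq> A"
    and Qmin: "\<And>p x. p \<in> Q \<Longrightarrow> x \<in> A \<Longrightarrow> \<exists>c. p \<diamondop> x \<diamondop> p = c *s p"
    using minimal_projections_exist[OF A] by blast
  have finQ: "finite Q" and sumQ: "\<Sum>Q = e" using Q by (auto simp: orthogonal_projections_def)
  \<comment> \<open>In a commutative algebra q x = q x q, a multiple of q by minimality of q in
    A.\<close>
  have AQ: "A \<subseteq> span Q"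
  proof
    fix x assume x: "x \<in> A"
    have "q \<diamondop> x \<in> span Q" if q: "q \<in> Q" for q
    proof -
      have "q \<diamondop> q = q" using q Q by (auto simp: orthogonal_projections_def projection_def)
      then have "q \<diamondop> x = q \<diamondop> x \<diamondop> q" using Acomm x q Q(2) by (metis mul_assoc subsetD)
      then show ?thesis using Qmin[OF q x] q by (metis span_base span_scale)
    qed
    then have "(\<Sum>q\<in>Q. q \<diamondop> x) \<in> span Q" by (intro span_sum) auto
    also have "(\<Sum>q\<in>Q. q \<diamondop> x) = x"
      using x AX by (auto simp: mul_sum_left[symmetric] sumQ unit_left)
    finally show "x \<in> span Q" .
  qed
  let ?S = "SIGMA p:R. G p p"
  have finS: "finite ?S" using fin_R finite_G by auto
  have "\<forall>s\<in>?S. \<exists>x. x \<in> H (fst s) (fst s) (snd s) \<and> x \<noteq> 0" by (auto simp: G_def)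
  from bchoice[OF this]
  obtain x where x: "\<And>s. s \<in> ?S \<Longrightarrow> x s \<in> H (fst s) (fst s) (snd s) \<and> x s \<noteq> 0" by blast
  \<comment> \<open>Multiplication by p singles out the vectors at p; eigenvectors for distinct l
    then separate.\<close>
  have "u t = 0" if u: "(\<Sum>s\<in>?S. u s *s x s) = 0" and t: "t \<in> ?S" for u t
  proof -
    obtain p l where t': "t = (p, l)" by (cases t)
    have p: "p \<in> R" and l: "l \<in> G p p" using t t' by auto
    have comp: "p \<diamondop> x (r, m) = (if r = p then x (r, m) else 0)" if "r \<in> R" "m \<in> G r r" for r m
    proof -
      have "r \<diamondop> x (r, m) = x (r, m)" using x[of "(r, m)"] that by (auto simp: H_def)
      then show ?thesis using orth_R p that by (metis mul_assoc mul_zero_left)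
    qed
    have "0 = p \<diamondop> (\<Sum>s\<in>?S. u s *s x s)" by (simp add: u)
    also have "\<dots> = p \<diamondop> (\<Sum>r\<in>R. \<Sum>m\<in>G r r. u (r, m) *s x (r, m))"
      using fin_R finite_G by (subst sum.Sigma) (auto simp: case_prod_unfold)
    also have "\<dots> = (\<Sum>r\<in>R. if r = p then (\<Sum>m\<in>G r r. u (r, m) *s x (r, m)) else 0)"
      by (auto simp: mul_sum_right mul_scale_right comp intro!: sum.cong)
    also have "\<dots> = (\<Sum>m\<in>G p p. u (p, m) *s x (p, m))" using fin_R p by simp
    finally have z: "(\<Sum>m\<in>G p p. u (p, m) *s x (p, m)) = 0" by simp
    have "u (p, m) *s x (p, m) \<in> E m" if "m \<in> G p p" for m
      using x[of "(p, m)"] that p subspace_E by (auto simp: H_def subspace_scale)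
    then have "u (p, l) *s x (p, l) = 0"
      using eigenvectors_sum_zero[OF finite_G _ z l] by blast
    then show ?thesis using x[OF t] by (simp add: t')
  qed
  then have fam: "inj_on x ?S" "independent (x ` ?S)"
    using independent_family[OF finS, of x] by blast+
  have "x s \<in> W" if "s \<in> ?S" for s
    unfolding W_def using x[OF that] that
    by (intro CollectI bexI[of _ "fst s"] exI[of _ "snd s"]) (auto simp: G_def)
  then have "x ` ?S \<subseteq> span Q" using WA AQ by blast
  then have "card (x ` ?S) \<le> card Q" using independent_span_bound[OF finQ fam(2)] by blast
  then have "card ?S \<le> N" using card_orthogonal_projections_le[OF Q(1)] fam(1) by (simp add: card_image)
  then show ?thesis using fin_R finite_G by simp
qed

end

end

section \<open>From the eigenvalue groupoid to the data\<close>

definition block_spectrum :: "nat \<Rightarrow> complex list \<Rightarrow> complex multiset" where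
  "block_spectrum n mu = (\<Sum>k<length mu. \<Sum>l<length mu.
     image_mset (\<lambda>m. mu ! k * cnj (mu ! l) * cis (2 * pi * real m / real n)) (mset_set {..<n}))"

lemma data_spectrum_eq: "data_spectrum cs = (\<Sum>(n, mu)\<leftarrow>cs. block_spectrum n mu)"
proof -
  have 1: "exp (2 * of_real pi * \<i> * of_nat m / of_nat n) = cis (2 * pi * real m / real n)" for m n :: nat
    by (simp add: cis_conv_exp mult_ac)
  have 2: "mset (concat (map f xs)) = (\<Sum>x\<leftarrow>xs. mset (f x))" for f :: "'a \<Rightarrow> 'b list" and xs
    by (induction xs) auto
  have 3: "(\<Sum>x\<leftarrow>[0..<n]. f x) = (\<Sum>x<n. f x)" for f :: "nat \<Rightarrow> 'b::comm_monoid_add" and n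
    by (simp add: sum_set_upt_conv_sum_list_nat[symmetric] atLeast0LessThan)
  have 4: "(\<Sum>m<n. {#f m#}) = image_mset f (mset_set {..<n})" for f :: "nat \<Rightarrow> complex" and n
    by (induction n) (auto simp: lessThan_Suc)
  show ?thesis
    unfolding data_spectrum_def block_spectrum_def 1 2 3 4 mset.simps by (simp add: 2 3 4 atLeast0LessThan)
qed

lemma data_spectrum_Cons: "data_spectrum ((n, mu) # cs) = block_spectrum n mu + data_spectrum cs"
  by (simp add: data_spectrum_eq)

text \<open>\<open>G\<close> is a groupoid on the object set \<open>R\<close>, with a faithful functor to the circle group; each
  connected component yields one summand of the data.\<close>

lemma data_of_circle_groupoid:
  fixes G :: "'a \<Rightarrow> 'a \<Rightarrow> complex set"
  assumes "finite R"
    and "\<And>p. p \<in> R \<Longrightarrow> 1 \<in> G p p"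
    and "\<And>p r s z w. p \<in> R \<Longrightarrow> r \<in> R \<Longrightarrow> s \<in> R \<Longrightarrow> z \<in> G p r \<Longrightarrow> w \<in> G r s \<Longrightarrow> z * w \<in> G p s"
    and "\<And>p r z. p \<in> R \<Longrightarrow> r \<in> R \<Longrightarrow> z \<in> G p r \<Longrightarrow> cnj z \<in> G r p"
    and "\<And>p r. p \<in> R \<Longrightarrow> r \<in> R \<Longrightarrow> finite (G p r)"
    and "\<And>p r z. p \<in> R \<Longrightarrow> r \<in> R \<Longrightarrow> z \<in> G p r \<Longrightarrow> cmod z = 1"
  shows "\<exists>cs. valid_data cs \<and> data_dim cs = (\<Sum>p\<in>R. card (G p p)) \<and>
    data_spectrum cs = (\<Sum>p\<in>R. \<Sum>r\<in>R. mset_set (G p r))"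
  using assms
proof (induction R rule: finite_psubset_induct)
  case (psubset R)
  note unit = psubset(3) and mul = psubset(4) and inv = psubset(5) and fin = psubset(6) and unim = psubset(7)
  show ?case
  proof (cases "R = {}")
    case True
    then show ?thesis
      by (intro exI[of _ "[]"]) (auto simp: valid_data_def data_dim_def data_spectrum_def)
  next
    case False
    then obtain p0 where p0: "p0 \<in> R" by blast
    \<comment> \<open>The connected component of p0; its complement is left to the induction
      hypothesis.\<close>
    define C where "C = {p \<in> R. G p p0 \<noteq> {}}"
    have C: "C \<subseteq> R" "p0 \<in> C" "finite C" "finite (R - C)" using p0 unit psubset(1) by (auto simp: C_def)
    have "\<forall>p\<in>C. \<exists>z. z \<in> G p p0" by (auto simp: C_def)
    \<comment> \<open>One connecting arrow per object; conjugation with these arrows identifies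
      every \<open>G p r\<close> inside the component with \<open>G p0 p0\<close>.\<close>
    then obtain \<mu> where \<mu>: "\<And>p. p \<in> C \<Longrightarrow> \<mu> p \<in> G p p0" by metis
    have CR: "p \<in> R" if "p \<in> C" for p using that C by auto
    obtain xs where xs: "set xs = C" "distinct xs" using finite_distinct_list[OF C(3)] by blast
    define n where "n = card (G p0 p0)"
    have bij: "bij_betw (\<lambda>k. cis (2 * pi * real k / real n)) {..<n} (G p0 p0)"
      unfolding n_def
    proof (rule finite_circle_group_eq_roots_of_unity)
      show "0 \<notin> G p0 p0" using unim[OF p0 p0] by force
    qed (use unit mul fin p0 in auto)
    have n0: "n > 0" using unit[OF p0] fin[OF p0 p0] by (auto simp: n_def card_gt_0_iff)
    have cancel: "cnj (\<mu> p) * \<mu> p = 1" "\<mu> p * cnj (\<mu> p) = 1" if "p \<in> C" for p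
      using unim[OF CR[OF that] p0 \<mu>[OF that]] complex_norm_square[of "\<mu> p"] by (auto simp: mult.commute)
    have G_eq: "G p r = (\<lambda>z. \<mu> p * cnj (\<mu> r) * z) ` G p0 p0" if pr: "p \<in> C" "r \<in> C" for p r
    proof safe
      fix w assume w: "w \<in> G p r"
      have "cnj (\<mu> p) * w * \<mu> r \<in> G p0 p0"
        using mul inv w pr \<mu> p0 CR by meson
      moreover have "w = \<mu> p * cnj (\<mu> r) * (cnj (\<mu> p) * w * \<mu> r)"
      proof -
        have "\<mu> p * cnj (\<mu> r) * (cnj (\<mu> p) * w * \<mu> r) = (\<mu> p * cnj (\<mu> p)) * (\<mu> r * cnj (\<mu> r)) * w"
          by (simp only: mult_ac)
        then show ?thesis using cancel(2) pr by simp
      qed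
      ultimately show "w \<in> (\<lambda>z. \<mu> p * cnj (\<mu> r) * z) ` G p0 p0" by blast
    next
      fix z assume z: "z \<in> G p0 p0"
      have "\<mu> p * z * cnj (\<mu> r) \<in> G p r"
        using mul inv z pr \<mu> p0 CR by meson
      then show "\<mu> p * cnj (\<mu> r) * z \<in> G p r" by (simp add: mult_ac)
    qed
    have inj: "inj_on (\<lambda>z. \<mu> p * cnj (\<mu> r) * z) A" if "p \<in> C" "r \<in> C" for p r A
      using cancel(1)[OF that(1)] cancel(1)[OF that(2)] by (auto simp: inj_on_def)
    have card_G: "card (G p p) = n" if "p \<in> C" for p
      unfolding G_eq[OF that that] n_def by (rule card_image[OF inj[OF that that]])
    have mset_G: "mset_set (G p r) =
        image_mset (\<lambda>m. \<mu> p * cnj (\<mu> r) * cis (2 * pi * real m / real n)) (mset_set {..<n})"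
      if pr: "p \<in> C" "r \<in> C" for p r
    proof -
      have "mset_set (G p r) = image_mset (\<lambda>z. \<mu> p * cnj (\<mu> r) * z) (mset_set (G p0 p0))"
        unfolding G_eq[OF pr] by (rule image_mset_mset_set[OF inj[OF pr], symmetric])
      also have "mset_set (G p0 p0) = image_mset (\<lambda>k. cis (2 * pi * real k / real n)) (mset_set {..<n})"
        using bij image_mset_mset_set[of "\<lambda>k. cis (2 * pi * real k / real n)" "{..<n}"]
        by (auto simp: bij_betw_def)
      finally show ?thesis by (simp add: multiset.map_comp o_def)
    qed
    \<comment> \<open>An arrow in \<open>G r p\<close>, composed with \<open>\<mu> p\<close>, would
      put r into the component.\<close>
    have cross: "G p r = {}" "G r p = {}" if pr: "p \<in> C" "r \<in> R - C" for p r
    proof -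
      have pR: "p \<in> R" and rR: "r \<in> R" using pr C by auto
      have rC: "G r p0 = {}" using pr by (auto simp: C_def)
      show 1: "G r p = {}" using mul[OF rR pR p0 _ \<mu>[OF pr(1)]] rC by blast
      show "G p r = {}" using inv[OF pR rR] 1 by blast
    qed
    have "\<exists>cs. valid_data cs \<and> data_dim cs = (\<Sum>p\<in>R - C. card (G p p)) \<and>
      data_spectrum cs = (\<Sum>p\<in>R - C. \<Sum>r\<in>R - C. mset_set (G p r))"
    proof (rule psubset(2))
      show "R - C \<subset> R" using C p0 by blast
    qed (use unit mul inv fin unim in auto)
    then obtain cs where cs: "valid_data cs" "data_dim cs = (\<Sum>p\<in>R - C. card (G p p))"
      "data_spectrum cs = (\<Sum>p\<in>R - C. \<Sum>r\<in>R - C. mset_set (G p r))" by blast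
    define mu where "mu = map \<mu> xs"
    have len: "length mu = card C" using xs distinct_card by (force simp: mu_def)
    have "valid_data ((n, mu) # cs)"
      using cs(1) n0 C(2) xs unim[OF CR p0 \<mu>] by (auto simp: valid_data_def mu_def)
    moreover have "data_dim ((n, mu) # cs) = (\<Sum>p\<in>R. card (G p p))"
    proof -
      have "(\<Sum>p\<in>R. card (G p p)) = (\<Sum>p\<in>R - C. card (G p p)) + (\<Sum>p\<in>C. card (G p p))"
        by (rule sum.subset_diff[OF C(1) psubset(1)])
      then show ?thesis using cs(2) card_G by (simp add: data_dim_def len mult.commute)
    qed
    moreover have "data_spectrum ((n, mu) # cs) = (\<Sum>p\<in>R. \<Sum>r\<in>R. mset_set (G p r))"
    proof -
      have nth: "(\<Sum>k<length xs. f (xs ! k)) = sum f C" for f :: "'a \<Rightarrow> complex multiset"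
        using sum.reindex_bij_betw[OF bij_betw_nth[OF xs(2) refl refl], of f] xs(1) by simp
      have "block_spectrum n mu = (\<Sum>k<length xs. \<Sum>l<length xs. mset_set (G (xs ! k) (xs ! l)))"
        unfolding block_spectrum_def mu_def length_map
        by (intro sum.cong refl) (use xs mset_G in auto)
      also have "\<dots> = (\<Sum>k<length xs. \<Sum>r\<in>C. mset_set (G (xs ! k) r))"
        by (intro sum.cong refl nth)
      also have "\<dots> = (\<Sum>p\<in>C. \<Sum>r\<in>C. mset_set (G p r))" by (rule nth)
      finally have 1: "block_spectrum n mu = (\<Sum>p\<in>C. \<Sum>r\<in>C. mset_set (G p r))" .
      have 2: "(\<Sum>r\<in>R. mset_set (G p r)) = (\<Sum>r\<in>C. mset_set (G p r))" if "p \<in> C" for p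
        by (rule sum.mono_neutral_right) (use C psubset(1) cross that in auto)
      have 3: "(\<Sum>r\<in>R. mset_set (G p r)) = (\<Sum>r\<in>R - C. mset_set (G p r))" if "p \<in> R - C" for p
        by (rule sum.mono_neutral_right) (use C psubset(1) cross that in auto)
      have "(\<Sum>p\<in>R. \<Sum>r\<in>R. mset_set (G p r)) =
          (\<Sum>p\<in>R - C. \<Sum>r\<in>R. mset_set (G p r)) + (\<Sum>p\<in>C. \<Sum>r\<in>R. mset_set (G p r))"
        by (rule sum.subset_diff[OF C(1) psubset(1)])
      then show ?thesis by (simp add: data_spectrum_Cons 1 2 3 cs(3))
    qed
    ultimately show ?thesis by blast
  qed
qed

context star_automorphism
begin

text \<open>The multiplicity of l in the sum of all \<open>G p r\<close> is the number of pairs with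
  l in \<open>G p r\<close>, which \<open>dim_E\<close> identifies with the dimension of the
  eigenspace.\<close>

theorem data_of_automorphism:
  "\<exists>cs. valid_data cs \<and> data_dim cs \<le> N \<and>
     (\<forall>l. count (data_spectrum cs) l = (if cmod l = 1 then dim (E l) else 0))"
proof -
  obtain R where R: "orthogonal_projections R" "R \<subseteq> E 1"
    "\<And>p x. p \<in> R \<Longrightarrow> x \<in> E 1 \<Longrightarrow> \<exists>c. p \<diamondop> x \<diamondop> p = c *s p"
    using minimal_projections_exist[OF fixed_star_subalgebra unit_fixed] by blast
  have finR: "finite R" using R(1) by (simp add: orthogonal_projections_def)
  have "\<exists>cs. valid_data cs \<and> data_dim cs = (\<Sum>p\<in>R. card (G p p)) \<and>
      data_spectrum cs = (\<Sum>p\<in>R. \<Sum>r\<in>R. mset_set (G p r))"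
  proof (rule data_of_circle_groupoid[OF finR])
    show "1 \<in> G p p" if "p \<in> R" for p using R that by (rule one_in_G)
    show "z * w \<in> G p s" if "p \<in> R" "r \<in> R" "s \<in> R" "z \<in> G p r" "w \<in> G r s" for p r s z w
      using R that(1,2,4,5) by (rule G_mul)
    show "cnj z \<in> G r p" if "p \<in> R" "r \<in> R" "z \<in> G p r" for p r z
      using R that by (rule G_cnj)
    show "finite (G p r)" for p r by (rule finite_G)
    show "cmod z = 1" if "z \<in> G p r" for p r z using that by (simp add: G_def)
  qed
  then obtain cs where cs: "valid_data cs" "data_dim cs = (\<Sum>p\<in>R. card (G p p))"
    "data_spectrum cs = (\<Sum>p\<in>R. \<Sum>r\<in>R. mset_set (G p r))" by blast
  have "count (data_spectrum cs) l = (if cmod l = 1 then dim (E l) else 0)" for l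
  proof -
    have "count (data_spectrum cs) l = (\<Sum>p\<in>R. \<Sum>r\<in>R. if l \<in> G p r then 1 else 0)"
      by (simp add: cs(3) count_sum count_mset_set' finite_G)
    also have "\<dots> = (\<Sum>s\<in>R \<times> R. if l \<in> G (fst s) (snd s) then 1 else 0)"
      by (simp add: sum.cartesian_product case_prod_unfold)
    also have "\<dots> = card {s \<in> R \<times> R. l \<in> G (fst s) (snd s)}"
      using finR by (simp add: sum.If_cases Int_def)
    also have "{s \<in> R \<times> R. l \<in> G (fst s) (snd s)} = {(p, r). p \<in> R \<and> r \<in> R \<and> l \<in> G p r}"
      by auto
    finally have c: "count (data_spectrum cs) l = card {(p, r). p \<in> R \<and> r \<in> R \<and> l \<in> G p r}" .
    show ?thesis
    proof (cases "cmod l = 1")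
      case True
      then show ?thesis using c dim_E[OF R True] by simp
    next
      case False
      then have "{(p, r). p \<in> R \<and> r \<in> R \<and> l \<in> G p r} = {}" by (auto simp: G_def)
      then show ?thesis unfolding c by (simp only: card.empty False if_False)
    qed
  qed
  then show ?thesis using cs(1,2) sum_card_diagonal_G_le[OF R] by auto
qed

end

section \<open>Positive semidefinite matrices\<close>

text \<open>Cauchy-Schwarz is applied to two kinds of forms: the form of a matrix on vectors, and
  the defect of the Schwarz inequality as a form on matrices. Hence the abstract carrier and the
  bare parameter \<open>sc\<close>.\<close>

locale psd_form =
  fixes b :: "'v::ab_group_add \<Rightarrow> 'v \<Rightarrow> complex" and sc :: "complex \<Rightarrow> 'v \<Rightarrow> 'v"
  assumes add_left: "b (x + y) z = b x z + b y z"
    and add_right: "b x (y + z) = b x y + b x z"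
    and scale_left: "b (sc c x) y = cnj c * b x y"
    and scale_right: "b x (sc c y) = c * b x y"
    and self_real: "Im (b x x) = 0"
    and self_nonneg: "Re (b x x) \<ge> 0"
begin

text \<open>Polarization: the values at x + y and at x + \<i> y are real, which settles the
  imaginary and the real part.\<close>

lemma hermitian: "b y x = cnj (b x y)"
proof -
  have "Im (b (x + y) (x + y)) = 0" "Im (b (x + sc \<i> y) (x + sc \<i> y)) = 0" by (rule self_real)+
  then have "Im (b x y) + Im (b y x) = 0" "Re (b x y) = Re (b y x)"
    using self_real[of x] self_real[of y] by (simp_all add: add_left add_right scale_left scale_right)
  then show ?thesis by (intro complex_eqI) auto
qed

lemma cauchy_schwarz: "(cmod (b x y))\<^sup>2 \<le> Re (b x x) * Re (b y y)"
proof -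
  define \<beta> where "\<beta> = (cmod (b x y))\<^sup>2"
  have \<beta>: "b y x * b x y = of_real \<beta>"
    unfolding hermitian[of y x] \<beta>_def complex_norm_square by (simp add: mult.commute)
  \<comment> \<open>Nonnegativity at x + c y with c = - t b(y, x) is a quadratic inequality in the
    real number t.\<close>
  have ineq: "0 \<le> Re (b x x) - 2 * t * \<beta> + t\<^sup>2 * \<beta> * Re (b y y)" for t :: real
  proof -
    define c where "c = - (of_real t * b y x)"
    have 1: "c * b x y = - of_real (t * \<beta>)" using \<beta> by (simp add: c_def mult.assoc)
    have 2: "cnj c * b y x = - of_real (t * \<beta>)"
      using \<beta> hermitian[of x y] by (simp add: c_def mult.assoc mult.commute)
    have 3: "cnj c * (c * b y y) = of_real (t\<^sup>2 * \<beta> ) * b y y"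
    proof -
      have "cnj c * c = of_real (t\<^sup>2) * (b y x * b x y)"
        using hermitian[of x y] by (simp add: c_def power2_eq_square mult_ac)
      then show ?thesis by (simp add: \<beta> mult.assoc[symmetric])
    qed
    have "b (x + sc c y) (x + sc c y) = b x x + c * b x y + (cnj c * b y x + cnj c * (c * b y y))"
      by (simp add: add_left add_right scale_left scale_right algebra_simps)
    also have "\<dots> = b x x - 2 * of_real (t * \<beta>) + of_real (t\<^sup>2 * \<beta>) * b y y"
      unfolding 1 2 3 by simp
    finally have "Re (b (x + sc c y) (x + sc c y)) = Re (b x x) - 2 * t * \<beta> + t\<^sup>2 * \<beta> * Re (b y y)"
      by simp
    then show ?thesis using self_nonneg[of "x + sc c y"] by simp
  qed
  have \<beta>0: "\<beta> \<ge> 0" by (simp add: \<beta>_def)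
  show ?thesis
  proof (cases "Re (b y y) = 0")
    case True
    have "\<beta> = 0"
    proof (rule ccontr)
      assume "\<beta> \<noteq> 0"
      \<comment> \<open>With b(y, y) = 0 the inequality is affine in t; this t makes its right-hand
        side -1.\<close>
      then show False using ineq[of "(Re (b x x) + 1) / (2 * \<beta>)"] True by (simp add: field_simps)
    qed
    then show ?thesis using True by (simp add: \<beta>_def)
  next
    case False
    then have Y: "Re (b y y) > 0" using self_nonneg[of y] by simp
    \<comment> \<open>t = 1 / b(y, y) minimizes the quadratic.\<close>
    have "0 \<le> Re (b x x) - \<beta> / Re (b y y)"
      using ineq[of "1 / Re (b y y)"] Y by (simp add: field_simps power2_eq_square)
    then show ?thesis using Y by (simp add: \<beta>_def field_simps)
  qed
qed

lemma null_left: "b y y = 0 \<Longrightarrow> b x y = 0"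
  using cauchy_schwarz[of x y] by simp

end

lemma mult_cnj_norm: "z * cnj z = (complex_of_real (cmod z))\<^sup>2" "cnj z * z = (complex_of_real (cmod z))\<^sup>2"
  using complex_norm_square[of z] by (simp_all add: mult.commute)

section \<open>Matrices as functions of two indices\<close>

type_synonym matf = "nat \<Rightarrow> nat \<Rightarrow> complex"

text \<open>Matrices of size \<open>d\<close> are functions on all index pairs of which only the entries with both
  indices below \<open>d\<close> matter; the product vanishes outside this range, which makes it associative
  without side conditions.\<close>

definition msc :: "complex \<Rightarrow> matf \<Rightarrow> matf" where
  "msc c f = (\<lambda>i j. c * f i j)"

definition mmul :: "nat \<Rightarrow> matf \<Rightarrow> matf \<Rightarrow> matf" where
  "mmul d f g = (\<lambda>i j. if i < d \<and> j < d then \<Sum>k<d. f i k * g k j else 0)"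

definition mstar :: "matf \<Rightarrow> matf" where
  "mstar f = (\<lambda>i j. cnj (f j i))"

definition mone :: "nat \<Rightarrow> matf" where
  "mone d = (\<lambda>i j. if i = j \<and> i < d then 1 else 0)"

definition qf :: "nat \<Rightarrow> matf \<Rightarrow> (nat \<Rightarrow> complex) \<Rightarrow> (nat \<Rightarrow> complex) \<Rightarrow> complex" where
  "qf d f u v = (\<Sum>i<d. \<Sum>j<d. cnj (u i) * f i j * v j)"

definition pos :: "nat \<Rightarrow> matf \<Rightarrow> bool" where
  "pos d f \<longleftrightarrow> (\<forall>v. Im (qf d f v v) = 0 \<and> 0 \<le> Re (qf d f v v))"

definition tr :: "nat \<Rightarrow> matf \<Rightarrow> complex" where
  "tr d f = (\<Sum>i<d. f i i)"

definition eqd :: "nat \<Rightarrow> matf \<Rightarrow> matf \<Rightarrow> bool" where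
  "eqd d f g \<longleftrightarrow> (\<forall>i<d. \<forall>j<d. f i j = g i j)"

interpretation mvs: vector_space msc
  by unfold_locales (auto simp: msc_def fun_eq_iff algebra_simps)

lemma sum_fun_apply [simp]: "sum f I x = (\<Sum>i\<in>I. f i x)"
  by (induction I rule: infinite_finite_induct) auto

lemma qf_add: "qf d (f + g) u v = qf d f u v + qf d g u v"
  by (simp add: qf_def sum.distrib algebra_simps)

lemma qf_msc: "qf d (msc c f) u v = c * qf d f u v"
  by (simp add: qf_def msc_def sum_distrib_left mult_ac)

lemma qf_minus: "qf d (- f) u v = - qf d f u v"
  by (simp add: qf_def sum_negf)

lemma qf_diff: "qf d (f - g) u v = qf d f u v - qf d g u v"
  by (simp add: qf_def sum_subtractf algebra_simps)

lemma qf_cong: "eqd d f g \<Longrightarrow> qf d f u v = qf d g u v"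
  unfolding qf_def eqd_def by (intro sum.cong) auto

lemma pos_cong: "eqd d f g \<Longrightarrow> pos d f = pos d g"
  unfolding pos_def by (simp add: qf_cong)

lemma sum_mult_delta [simp]:
  fixes f :: "nat \<Rightarrow> complex"
  shows "(\<Sum>k<d. f k * (if k = j then 1 else 0)) = (if j < d then f j else 0)"
    and "(\<Sum>k<d. f k * (if j = k then 1 else 0)) = (if j < d then f j else 0)"
    and "(\<Sum>k<d. (if k = j then 1 else 0) * f k) = (if j < d then f j else 0)"
    and "(\<Sum>k<d. (if j = k then 1 else 0) * f k) = (if j < d then f j else 0)"
proof -
  have "f k * (if k = j then 1 else 0) = (if k = j then f k else 0)"
    "f k * (if j = k then 1 else 0) = (if j = k then f k else 0)"
    "(if k = j then 1 else 0) * f k = (if k = j then f k else 0)"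
    "(if j = k then 1 else 0) * f k = (if j = k then f k else 0)" for k by auto
  then show "(\<Sum>k<d. f k * (if k = j then 1 else 0)) = (if j < d then f j else 0)"
    "(\<Sum>k<d. f k * (if j = k then 1 else 0)) = (if j < d then f j else 0)"
    "(\<Sum>k<d. (if k = j then 1 else 0) * f k) = (if j < d then f j else 0)"
    "(\<Sum>k<d. (if j = k then 1 else 0) * f k) = (if j < d then f j else 0)"
    by simp_all
qed

lemma qf_unit_right: "j < d \<Longrightarrow> qf d f v (\<lambda>k. if k = j then 1 else 0) = (\<Sum>i<d. cnj (v i) * f i j)"
  by (simp add: qf_def)

lemma qf_unit:
  assumes "i < d" "j < d"
  shows "qf d f (\<lambda>k. if k = i then 1 else 0) (\<lambda>k. if k = j then 1 else 0) = f i j"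
proof -
  have "cnj (if k = i then 1 else 0) = (if k = i then 1 else 0)" for k by simp
  then show ?thesis using assms by (simp only: qf_unit_right) simp
qed

lemma qf_mmul: "qf d (mmul d f g) u v = (\<Sum>k<d. (\<Sum>i<d. cnj (u i) * f i k) * (\<Sum>j<d. g k j * v j))"
proof -
  have "qf d (mmul d f g) u v = (\<Sum>i<d. \<Sum>j<d. \<Sum>k<d. cnj (u i) * f i k * (g k j * v j))"
    unfolding qf_def mmul_def by (intro sum.cong refl) (auto simp: sum_distrib_left sum_distrib_right mult_ac)
  also have "\<dots> = (\<Sum>k<d. \<Sum>i<d. \<Sum>j<d. cnj (u i) * f i k * (g k j * v j))"
  proof -
    have "(\<Sum>j<d. \<Sum>k<d. cnj (u i) * f i k * (g k j * v j)) = (\<Sum>k<d. \<Sum>j<d. cnj (u i) * f i k * (g k j * v j))" for i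
      by (rule sum.swap)
    then show ?thesis by (simp only:) (rule sum.swap)
  qed
  also have "\<dots> = (\<Sum>k<d. (\<Sum>i<d. cnj (u i) * f i k) * (\<Sum>j<d. g k j * v j))"
    by (simp add: sum_product)
  finally show ?thesis .
qed

lemma qf_star_mul: "qf d (mmul d (mstar f) f) v v = of_real (\<Sum>k<d. (cmod (\<Sum>j<d. f k j * v j))\<^sup>2)"
proof -
  have "(\<Sum>i<d. cnj (v i) * mstar f i k) = cnj (\<Sum>j<d. f k j * v j)" for k
    by (simp add: mstar_def mult.commute)
  then show ?thesis by (simp only: qf_mmul mult_cnj_norm of_real_sum of_real_power)
qed

lemma pos_star_mul: "pos d (mmul d (mstar f) f)"
  by (simp add: pos_def qf_star_mul sum_nonneg)

lemma pos_add: "pos d f \<Longrightarrow> pos d g \<Longrightarrow> pos d (f + g)"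
  by (simp add: pos_def qf_add)

lemma psd_form_qf: "pos d f \<Longrightarrow> psd_form (qf d f) (\<lambda>c v i. c * v i)"
  by unfold_locales
    (auto simp: pos_def qf_def sum.distrib sum_distrib_left algebra_simps)

lemma pos_hermitian:
  assumes "pos d f" "i < d" "j < d"
  shows "f j i = cnj (f i j)"
proof -
  interpret psd_form "qf d f" "\<lambda>c v i. c * v i" by (rule psd_form_qf[OF assms(1)])
  show ?thesis using hermitian qf_unit assms(2,3) by metis
qed

text \<open>The quadratic form vanishes at every vector, and by Cauchy-Schwarz so does the
  sesquilinear form, whose values at unit vectors are the entries.\<close>

lemma pos_antisym:
  assumes "pos d f" "pos d (- f)" "i < d" "j < d"
  shows "f i j = 0"
proof -
  interpret psd_form "qf d f" "\<lambda>c v i. c * v i" by (rule psd_form_qf[OF assms(1)])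
  have "qf d f v v = 0" for v
    using assms(1,2) unfolding pos_def qf_minus by (intro complex_eqI) (force simp: order_antisym)+
  then show ?thesis using null_left qf_unit[OF assms(3,4)] by metis
qed

lemma pos_antisym_eqd: "pos d (f - g) \<Longrightarrow> pos d (g - f) \<Longrightarrow> eqd d f g"
  unfolding eqd_def using pos_antisym[of d "f - g"] by auto

lemma qf_mone: "qf d (mone d) u v = (\<Sum>i<d. cnj (u i) * v i)"
proof -
  have "(\<Sum>j<d. cnj (u i) * mone d i j * v j) = cnj (u i) * v i" if "i < d" for i
  proof -
    have "cnj (u i) * mone d i j * v j = (if i = j then cnj (u i) * v i else 0)" for j
      using that by (simp add: mone_def)
    then show ?thesis using that by simp
  qed
  then show ?thesis by (simp add: qf_def)
qed

lemma pos_mone: "pos d (mone d)"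
  unfolding pos_def qf_mone mult_cnj_norm of_real_power[symmetric] of_real_sum[symmetric]
  by (simp add: sum_nonneg)

lemma sum_cauchy_schwarz:
  "(cmod (\<Sum>i<d. u i * v i))\<^sup>2 \<le> (\<Sum>i<d. (cmod (u i))\<^sup>2) * (\<Sum>i<(d::nat). (cmod (v i))\<^sup>2)"
proof -
  interpret psd_form "qf d (mone d)" "\<lambda>c v i. c * v i" by (rule psd_form_qf[OF pos_mone])
  have "Re (qf d (mone d) w w) = (\<Sum>i<d. (cmod (w i))\<^sup>2)" for w
    by (simp add: qf_mone mult_cnj_norm flip: of_real_power)
  then show ?thesis using cauchy_schwarz[of "\<lambda>i. cnj (u i)" v] by (simp add: qf_mone)
qed

text \<open>Cholesky decomposition: each step subtracts a rank one matrix which clears one row and column.\<close>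

lemma pos_factorization:
  assumes "pos d f"
  obtains g where "eqd d f (mmul d (mstar g) g)"
proof -
  \<comment> \<open>After n steps the remainder is still positive and its first n rows and columns
    vanish.\<close>
  have "\<exists>W. pos d (\<lambda>i j. f i j - (\<Sum>k<n. W k i * cnj (W k j))) \<and>
      (\<forall>i<d. \<forall>j<d. i < n \<or> j < n \<longrightarrow> f i j - (\<Sum>k<n. W k i * cnj (W k j)) = 0)"
    if "n \<le> d" for n
    using that
  proof (induction n)
    case 0
    then show ?case using assms by simp
  next
    case (Suc n)
    then obtain W where W: "pos d (\<lambda>i j. f i j - (\<Sum>k<n. W k i * cnj (W k j)))"
      "\<forall>i<d. \<forall>j<d. i < n \<or> j < n \<longrightarrow> f i j - (\<Sum>k<n. W k i * cnj (W k j)) = 0"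
      using Suc.IH[OF Suc_leD[OF Suc.prems]] by blast
    define h where "h = (\<lambda>i j. f i j - (\<Sum>k<n. W k i * cnj (W k j)))"
    have h: "pos d h" "\<And>i j. i < d \<Longrightarrow> j < d \<Longrightarrow> i < n \<or> j < n \<Longrightarrow> h i j = 0"
      using W by (auto simp: h_def)
    have n: "n < d" using Suc by simp
    interpret psd_form "qf d h" "\<lambda>c v i. c * v i" by (rule psd_form_qf[OF h(1)])
    let ?e = "\<lambda>k. if k = n then 1 else 0 :: complex"
    have hnn: "Im (h n n) = 0" "Re (h n n) \<ge> 0"
      using self_real[of ?e] self_nonneg[of ?e] qf_unit[OF n n, of h] by auto
    have "\<exists>w. pos d (\<lambda>i j. h i j - w i * cnj (w j)) \<and>
      (\<forall>i<d. \<forall>j<d. i < Suc n \<or> j < Suc n \<longrightarrow> h i j - w i * cnj (w j) = 0)"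
    proof (cases "Re (h n n) = 0")
      case True
      \<comment> \<open>A vanishing pivot makes the unit vector a null vector, so its whole row and
        column vanish and nothing is subtracted.\<close>
      then have z: "qf d h ?e ?e = 0" using hnn(1) qf_unit[OF n n, of h] by (simp add: complex_eq_iff)
      have "h i n = 0" if "i < d" for i
        using null_left[OF z, of "\<lambda>k. if k = i then 1 else 0"] qf_unit[OF that n, of h] by simp
      moreover have "h n i = 0" if "i < d" for i
        using pos_hermitian[OF h(1) that n] calculation[OF that] by simp
      ultimately show ?thesis using h by (intro exI[of _ "\<lambda>_. 0"]) (auto simp: less_Suc_eq)
    next
      case False
      then have r: "Re (h n n) > 0" using hnn by simp
      define s where "s = sqrt (Re (h n n))"
      have s: "s > 0" "s\<^sup>2 = Re (h n n)" using r by (auto simp: s_def)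
      have hs: "h n n = of_real s * of_real s" using hnn s(2) by (simp add: complex_eq_iff power2_eq_square)
      \<comment> \<open>The pivot column divided by the root of the pivot, so that subtracting w w*
        clears row and column n.\<close>
      define w where "w i = h i n / of_real s" for i
      have "h i j - w i * cnj (w j) = 0" if ij: "i < d" "j < d" "i < Suc n \<or> j < Suc n" for i j
      proof -
        have hj: "cnj (h j n) = h n j" if "j < d" for j using pos_hermitian[OF h(1) that n] by simp
        consider "i < n \<or> j < n" | "i = n" | "j = n" using ij by linarith
        then show ?thesis
        proof cases
          case 1
          then have "h i j = 0" "h i n = 0 \<or> h j n = 0" using h(2) ij n by auto
          then show ?thesis by (auto simp: w_def)
        next
          case 2
          then show ?thesis using s hj[OF ij(2)] by (simp add: w_def hs)
        next
          case 3
          then show ?thesis using s hj[OF n] by (simp add: w_def hs)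
        qed
      qed
      moreover have "pos d (\<lambda>i j. h i j - w i * cnj (w j))"
        unfolding pos_def
      proof (intro allI)
        fix v
        have q: "qf d (\<lambda>i j. w i * cnj (w j)) v v = of_real ((cmod (\<Sum>i<d. cnj (v i) * w i))\<^sup>2)"
        proof -
          have "qf d (\<lambda>i j. w i * cnj (w j)) v v = (\<Sum>i<d. cnj (v i) * w i) * (\<Sum>j<d. cnj (w j) * v j)"
            unfolding qf_def sum_product by (intro sum.cong refl) (simp only: mult_ac)
          also have "(\<Sum>j<d. cnj (w j) * v j) = cnj (\<Sum>i<d. cnj (v i) * w i)"
            by (simp add: mult.commute)
          finally show ?thesis by (simp only: mult_cnj_norm of_real_power)
        qed
        \<comment> \<open>Positivity of the new remainder is Cauchy-Schwarz for the form of h at v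
          and the n-th unit vector.\<close>
        have "(\<Sum>i<d. cnj (v i) * w i) = qf d h v ?e / of_real s"
          by (simp add: qf_unit_right[OF n] w_def sum_divide_distrib)
        then have "(cmod (\<Sum>i<d. cnj (v i) * w i))\<^sup>2 = (cmod (qf d h v ?e))\<^sup>2 / Re (h n n)"
          by (simp add: norm_divide power_divide s)
        also have "\<dots> \<le> Re (qf d h v v)"
          using cauchy_schwarz[of v ?e] qf_unit[OF n n, of h] r by (simp add: field_simps)
        finally have le: "(cmod (\<Sum>i<d. cnj (v i) * w i))\<^sup>2 \<le> Re (qf d h v v)" .
        have "qf d (\<lambda>i j. h i j - w i * cnj (w j)) v v = qf d h v v - qf d (\<lambda>i j. w i * cnj (w j)) v v"
          using qf_diff[of d h "\<lambda>i j. w i * cnj (w j)" v v] by (simp add: fun_diff_def)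
        then show "Im (qf d (\<lambda>i j. h i j - w i * cnj (w j)) v v) = 0 \<and>
            0 \<le> Re (qf d (\<lambda>i j. h i j - w i * cnj (w j)) v v)"
          using le self_real[of v] unfolding q by simp
      qed
      ultimately show ?thesis by blast
    qed
    then obtain w where w: "pos d (\<lambda>i j. h i j - w i * cnj (w j))"
      "\<forall>i<d. \<forall>j<d. i < Suc n \<or> j < Suc n \<longrightarrow> h i j - w i * cnj (w j) = 0" by blast
    have eq: "f i j - (\<Sum>k<Suc n. (W(n := w)) k i * cnj ((W(n := w)) k j)) = h i j - w i * cnj (w j)" for i j
      by (simp add: h_def)
    show ?case by (rule exI[of _ "W(n := w)"]) (unfold eq, rule conjI[OF w])
  qed
  from this[OF order_refl] obtain W where
    W: "\<forall>i<d. \<forall>j<d. f i j - (\<Sum>k<d. W k i * cnj (W k j)) = 0" by auto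
  have "eqd d f (mmul d (mstar (\<lambda>k j. cnj (W k j))) (\<lambda>k j. cnj (W k j)))"
    using W by (auto simp: eqd_def mmul_def mstar_def)
  then show ?thesis using that by blast
qed

lemma mmul_cong: "eqd d f f' \<Longrightarrow> eqd d g g' \<Longrightarrow> mmul d f g = mmul d f' g'"
  unfolding mmul_def eqd_def by (intro ext) simp

lemma tr_star_mul: "tr d (mmul d (mstar g) g) = of_real (\<Sum>k<d. \<Sum>i<d. (cmod (g k i))\<^sup>2)"
proof -
  have "tr d (mmul d (mstar g) g) = (\<Sum>i<d. \<Sum>k<d. of_real ((cmod (g k i))\<^sup>2))"
    unfolding tr_def mmul_def mstar_def
    by (intro sum.cong) (auto simp: mult_cnj_norm intro!: sum.cong)
  also have "\<dots> = of_real (\<Sum>k<d. \<Sum>i<d. (cmod (g k i))\<^sup>2)" by (subst sum.swap) simp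
  finally show ?thesis .
qed

lemma tr_cong: "eqd d f g \<Longrightarrow> tr d f = tr d g"
  by (auto simp: eqd_def tr_def)

lemma tr_pos: assumes "pos d f" shows "Im (tr d f) = 0" "Re (tr d f) \<ge> 0"
proof -
  obtain g where g: "eqd d f (mmul d (mstar g) g)" using pos_factorization[OF assms] .
  show "Im (tr d f) = 0" "Re (tr d f) \<ge> 0"
    unfolding tr_cong[OF g] tr_star_mul by (auto intro!: sum_nonneg)
qed

text \<open>With f = g* g the left side is |g v|^2, bounded through the Hilbert-Schmidt norm of g,
  whose square is tr f.\<close>

lemma qf_le_tr:
  assumes "pos d f"
  shows "Re (qf d f v v) \<le> Re (tr d f) * (\<Sum>i<d. (cmod (v i))\<^sup>2)"
proof -
  obtain g where g: "eqd d f (mmul d (mstar g) g)" using pos_factorization[OF assms] .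
  have "Re (qf d f v v) = (\<Sum>k<d. (cmod (\<Sum>j<d. g k j * v j))\<^sup>2)"
    by (simp add: qf_cong[OF g] qf_star_mul)
  also have "\<dots> \<le> (\<Sum>k<d. (\<Sum>j<d. (cmod (g k j))\<^sup>2) * (\<Sum>i<d. (cmod (v i))\<^sup>2))"
    by (intro sum_mono sum_cauchy_schwarz)
  also have "\<dots> = Re (tr d f) * (\<Sum>i<d. (cmod (v i))\<^sup>2)"
    by (simp add: tr_cong[OF g] tr_star_mul sum_distrib_right)
  finally show ?thesis .
qed

lemma pos_tr_bound:
  assumes "pos d f"
  shows "pos d (msc (tr d f) (mone d) - f)"
proof -
  have "Re (qf d (mone d) v v) = (\<Sum>i<d. (cmod (v i))\<^sup>2)" for v
    by (simp add: qf_mone mult_cnj_norm flip: of_real_power)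
  then show ?thesis
    using qf_le_tr[OF assms] tr_pos(1)[OF assms] assms pos_mone[of d]
    by (simp add: pos_def qf_diff qf_msc)
qed

text \<open>For u = f v the form of f at (u, v) equals |u|^2; Cauchy-Schwarz and
  \<open>qf_le_tr\<close> bound |u|^4 by tr(f) |u|^2 times the form at (v, v), and one factor |u|^2
  cancels.\<close>

lemma pos_square_bound:
  assumes "pos d f"
  shows "pos d (msc (tr d f) f - mmul d f f)"
proof -
  interpret psd_form "qf d f" "\<lambda>c v i. c * v i" by (rule psd_form_qf[OF assms])
  have herm: "eqd d f (mstar f)"
    unfolding eqd_def mstar_def
  proof (intro allI impI)
    fix i j assume "i < d" "j < d"
    then show "f i j = cnj (f j i)" using pos_hermitian[OF assms, of j i] by simp
  qed
  then have sq: "mmul d f f = mmul d (mstar f) f" by (rule mmul_cong) (simp add: eqd_def)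
  show ?thesis unfolding pos_def
  proof (intro allI)
    fix v
    define u where "u k = (\<Sum>j<d. f k j * v j)" for k
    define Y where "Y = (\<Sum>k<d. (cmod (u k))\<^sup>2)"
    have q: "qf d (mmul d f f) v v = of_real Y"
      unfolding sq qf_star_mul by (simp add: Y_def u_def)
    have "qf d f u v = (\<Sum>i<d. cnj (u i) * u i)"
      by (simp add: qf_def u_def[of _] sum_distrib_left mult.assoc)
    also have "\<dots> = of_real Y" by (simp add: Y_def mult_cnj_norm)
    finally have "Y\<^sup>2 \<le> Re (qf d f u u) * Re (qf d f v v)" using cauchy_schwarz[of u v] by simp
    also have "\<dots> \<le> (Re (tr d f) * Y) * Re (qf d f v v)"
      using qf_le_tr[OF assms, of u] self_nonneg[of v] unfolding Y_def by (intro mult_right_mono) auto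
    finally have "Y * Y \<le> Y * (Re (tr d f) * Re (qf d f v v))" by (simp add: power2_eq_square mult_ac)
    moreover have "Y \<ge> 0" by (simp add: Y_def sum_nonneg)
    moreover have "0 \<le> Re (tr d f) * Re (qf d f v v)" using tr_pos[OF assms] self_nonneg[of v] by simp
    ultimately have "Y \<le> Re (tr d f) * Re (qf d f v v)" by (cases "Y = 0") auto
    then show "Im (qf d (msc (tr d f) f - mmul d f f) v v) = 0 \<and>
        0 \<le> Re (qf d (msc (tr d f) f - mmul d f f) v v)"
      using tr_pos[OF assms] self_real[of v] by (simp add: qf_diff qf_msc q)
  qed
qed

section \<open>Star-algebra laws of the truncated product\<close>

lemma mmul_assoc: "mmul d (mmul d f g) h = mmul d f (mmul d g h)"
proof (intro ext)
  fix i j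
  show "mmul d (mmul d f g) h i j = mmul d f (mmul d g h) i j"
  proof (cases "i < d \<and> j < d")
    case True
    then have "mmul d (mmul d f g) h i j = (\<Sum>k<d. \<Sum>l<d. f i l * g l k * h k j)"
      by (auto simp: mmul_def sum_distrib_right intro!: sum.cong)
    also have "\<dots> = (\<Sum>l<d. \<Sum>k<d. f i l * g l k * h k j)" by (rule sum.swap)
    also have "\<dots> = mmul d f (mmul d g h) i j"
      using True by (auto simp: mmul_def sum_distrib_left mult.assoc intro!: sum.cong)
    finally show ?thesis .
  qed (auto simp: mmul_def)
qed

lemma mmul_add_left: "mmul d (f + g) h = mmul d f h + mmul d g h"
  by (auto simp: mmul_def fun_eq_iff sum.distrib algebra_simps)

lemma mmul_add_right: "mmul d h (f + g) = mmul d h f + mmul d h g"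
  by (auto simp: mmul_def fun_eq_iff sum.distrib algebra_simps)

lemma mmul_msc_left: "mmul d (msc c f) g = msc c (mmul d f g)"
  by (auto simp: mmul_def msc_def fun_eq_iff sum_distrib_left mult_ac)

lemma mmul_msc_right: "mmul d f (msc c g) = msc c (mmul d f g)"
  by (auto simp: mmul_def msc_def fun_eq_iff sum_distrib_left mult_ac)

lemma mstar_mmul: "mstar (mmul d f g) = mmul d (mstar g) (mstar f)"
  by (auto simp: mmul_def mstar_def fun_eq_iff mult.commute)

lemma mstar_mstar [simp]: "mstar (mstar f) = f"
  by (simp add: mstar_def)

lemma mstar_add: "mstar (f + g) = mstar f + mstar g"
  by (auto simp: mstar_def fun_eq_iff)

lemma mstar_msc: "mstar (msc c f) = msc (cnj c) (mstar f)"
  by (auto simp: mstar_def msc_def fun_eq_iff)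

lemma mmul_mone_left:
  assumes "\<And>i j. i \<ge> d \<or> j \<ge> d \<Longrightarrow> f i j = 0"
  shows "mmul d (mone d) f = f"
proof (intro ext)
  fix i j
  have "(\<Sum>k<d. mone d i k * f k j) = (\<Sum>k<d. (if i = k then 1 else 0) * f k j)" if "i < d"
    using that by (intro sum.cong) (auto simp: mone_def)
  then have "(\<Sum>k<d. mone d i k * f k j) = f i j" if "i < d" using that by simp
  then show "mmul d (mone d) f i j = f i j" using assms[of i j] by (simp add: mmul_def not_less)
qed

lemma mmul_mone_right:
  assumes "\<And>i j. i \<ge> d \<or> j \<ge> d \<Longrightarrow> f i j = 0"
  shows "mmul d f (mone d) = f"
proof (intro ext)
  fix i j
  have "(\<Sum>k<d. f i k * mone d k j) = (\<Sum>k<d. f i k * (if k = j then 1 else 0))" if "j < d"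
    using that by (intro sum.cong) (auto simp: mone_def)
  then have "(\<Sum>k<d. f i k * mone d k j) = f i j" if "j < d" using that by simp
  then show "mmul d f (mone d) i j = f i j" using assms[of i j] by (simp add: mmul_def not_less)
qed

section \<open>Unital Schwarz maps\<close>

text \<open>\<open>S_cong\<close> and \<open>S_supp\<close> let a map on functions stand for one on
  d x d matrices: it reads and writes that block only. The class is closed under composition and
  entrywise limits, so it contains both the powers of S and the projection P.\<close>

locale unital_schwarz =
  fixes d :: nat and S :: "matf \<Rightarrow> matf"
  assumes S_add: "S (f + g) = S f + S g"
    and S_msc: "S (msc c f) = msc c (S f)"
    and S_supp: "i \<ge> d \<or> j \<ge> d \<Longrightarrow> S f i j = 0"
    and S_cong: "eqd d f g \<Longrightarrow> S f = S g"
    and S_star: "S (mstar f) = mstar (S f)"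
    and S_one: "S (mone d) = mone d"
    and S_schwarz: "pos d (S (mmul d (mstar f) f) - mmul d (mstar (S f)) (S f))"
begin

lemma S_minus: "S (- f) = - S f"
  using S_msc[of "-1" f] by (simp add: msc_def fun_Compl_def)

lemma S_diff: "S (f - g) = S f - S g"
  using S_add[of f "- g"] by (simp add: S_minus)

text \<open>A positive matrix has the form g* g, and S(g* g) dominates S(g)* S(g).\<close>

lemma S_pos: assumes "pos d f" shows "pos d (S f)"
proof -
  obtain g where g: "eqd d f (mmul d (mstar g) g)" using pos_factorization[OF assms] .
  have "pos d (S (mmul d (mstar g) g))"
    using pos_add[OF S_schwarz[of g] pos_star_mul[of d "S g"]] by simp
  then show ?thesis using S_cong[OF g] by simp
qed

text \<open>S(f)* S(f) <= S(f* f) <= tr(f* f) S(1) = tr(f* f) 1, read off at a diagonal entry. The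
  bound does not involve S, so it is common to all powers.\<close>

lemma S_bounded:
  assumes "i < d" "j < d"
  shows "(cmod (S f i j))\<^sup>2 \<le> (\<Sum>k<d. \<Sum>l<d. (cmod (f k l))\<^sup>2)"
proof -
  let ?t = "tr d (mmul d (mstar f) f)"
  have "pos d (msc ?t (mone d) - S (mmul d (mstar f) f))"
    using S_pos[OF pos_tr_bound[OF pos_star_mul[of d f]]] by (simp add: S_diff S_msc S_one)
  then have "pos d (msc ?t (mone d) - S (mmul d (mstar f) f) + (S (mmul d (mstar f) f) - mmul d (mstar (S f)) (S f)))"
    using S_schwarz by (rule pos_add)
  then have "pos d (msc ?t (mone d) - mmul d (mstar (S f)) (S f))" by simp
  then have "0 \<le> Re ((msc ?t (mone d) - mmul d (mstar (S f)) (S f)) j j)"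
    unfolding pos_def using qf_unit[OF assms(2,2)] by metis
  moreover have "mmul d (mstar (S f)) (S f) j j = (\<Sum>k<d. of_real ((cmod (S f k j))\<^sup>2))"
    using assms by (simp add: mmul_def mstar_def mult_cnj_norm)
  ultimately have "(\<Sum>k<d. (cmod (S f k j))\<^sup>2) \<le> (\<Sum>k<d. \<Sum>l<d. (cmod (f k l))\<^sup>2)"
    using assms by (simp add: msc_def mone_def tr_star_mul flip: of_real_power of_real_sum)
  moreover have "(cmod (S f i j))\<^sup>2 \<le> (\<Sum>k<d. (cmod (S f k j))\<^sup>2)"
    by (rule member_le_sum) (use assms in auto)
  ultimately show ?thesis by linarith
qed

lemma S_zero: "S 0 = 0"
  using S_add[of 0 0] by simp

lemma S_sum: "S (sum f I) = (\<Sum>i\<in>I. S (f i))"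
  by (induction I rule: infinite_finite_induct)
    (simp_all only: sum.infinite sum.empty sum.insert S_zero S_add not_False_eq_True)

text \<open>The Schwarz defect of the composite is R of the defect of S plus the defect of R at S
  f.\<close>

lemma compose:
  assumes "unital_schwarz d R"
  shows "unital_schwarz d (\<lambda>f. R (S f))"
proof -
  interpret R: unital_schwarz d R by fact
  show ?thesis
  proof unfold_locales
    fix f
    have "pos d (R (S (mmul d (mstar f) f) - mmul d (mstar (S f)) (S f)) +
        (R (mmul d (mstar (S f)) (S f)) - mmul d (mstar (R (S f))) (R (S f))))"
      by (intro pos_add R.S_pos S_schwarz R.S_schwarz)
    then show "pos d (R (S (mmul d (mstar f) f)) - mmul d (mstar (R (S f))) (R (S f)))"
      by (simp add: R.S_diff)
  qed (auto simp: S_add S_msc R.S_add R.S_msc R.S_supp S_star R.S_star S_one R.S_one intro: arg_cong[OF S_cong])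
qed

text \<open>Counting starts at \<open>Suc n\<close>: the zeroth power, the identity, keeps entries
  outside the d x d block and violates \<open>S_supp\<close>.\<close>

lemma power: "unital_schwarz d (S ^^ Suc n)"
proof (induction n)
  case 0
  then show ?case using unital_schwarz_axioms by simp
next
  case (Suc n)
  then show ?case using unital_schwarz.compose[OF Suc unital_schwarz_axioms] by (simp add: o_def)
qed

end

lemma tendsto_qf:
  assumes "\<And>i j. (\<lambda>k. F k i j) \<longlonglongrightarrow> f i j"
  shows "(\<lambda>k. qf d (F k) u v) \<longlonglongrightarrow> qf d f u v"
  unfolding qf_def by (intro tendsto_intros assms)

lemma pos_limit:
  assumes "\<And>i j. (\<lambda>k. F k i j) \<longlonglongrightarrow> f i j" "\<And>k. pos d (F k)"
  shows "pos d f"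
  unfolding pos_def
proof (intro allI conjI)
  fix v
  note lim = tendsto_qf[of F f, OF assms(1), of d v v]
  show "Im (qf d f v v) = 0"
    using tendsto_Im[OF lim] assms(2) by (simp add: pos_def LIMSEQ_const_iff)
  show "0 \<le> Re (qf d f v v)"
    using LIMSEQ_le_const[OF tendsto_Re[OF lim], of 0] assms(2) by (auto simp: pos_def)
qed

lemma unital_schwarz_limit:
  assumes S: "\<And>k. unital_schwarz d (S k)" and lim: "\<And>f i j. (\<lambda>k. S k f i j) \<longlonglongrightarrow> P f i j"
  shows "unital_schwarz d P"
proof unfold_locales
  fix f g :: matf and c :: complex and i j :: nat
  show "P (f + g) = P f + P g"
  proof (intro ext)
    fix i j
    show "P (f + g) i j = (P f + P g) i j"
      using LIMSEQ_unique[OF lim[of "f + g" i j]] tendsto_add[OF lim[of f i j] lim[of g i j]]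
      by (simp add: unital_schwarz.S_add[OF S])
  qed
  show "P (msc c f) = msc c (P f)"
  proof (intro ext)
    fix i j
    show "P (msc c f) i j = msc c (P f) i j"
    proof (rule LIMSEQ_unique[OF lim[of "msc c f" i j]])
      show "(\<lambda>k. S k (msc c f) i j) \<longlonglongrightarrow> msc c (P f) i j"
        unfolding unital_schwarz.S_msc[OF S] unfolding msc_def by (intro tendsto_intros lim)
    qed
  qed
  show "P f i j = 0" if "i \<ge> d \<or> j \<ge> d"
    using lim[of f i j] unital_schwarz.S_supp[OF S that] by (simp add: LIMSEQ_const_iff)
  show "P f = P g" if "eqd d f g"
  proof (intro ext)
    fix i j
    show "P f i j = P g i j"
      using LIMSEQ_unique[OF lim[of f i j]] lim[of g i j] by (simp add: unital_schwarz.S_cong[OF S that])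
  qed
  show "P (mstar f) = mstar (P f)"
  proof (intro ext)
    fix i j
    show "P (mstar f) i j = mstar (P f) i j"
      using LIMSEQ_unique[OF lim[of "mstar f" i j]] tendsto_cnj[OF lim[of f j i]]
      by (simp add: unital_schwarz.S_star[OF S] mstar_def[of "S _ _"] mstar_def[of "P _"])
  qed
  show "P (mone d) = mone d"
  proof (intro ext)
    fix i j
    show "P (mone d) i j = mone d i j"
      using lim[of "mone d" i j] by (simp add: unital_schwarz.S_one[OF S] LIMSEQ_const_iff)
  qed
  show "pos d (P (mmul d (mstar f) f) - mmul d (mstar (P f)) (P f))"
  proof (rule pos_limit)
    show "pos d (S k (mmul d (mstar f) f) - mmul d (mstar (S k f)) (S k f))" for k
      by (rule unital_schwarz.S_schwarz[OF S])
    show "(\<lambda>k. (S k (mmul d (mstar f) f) - mmul d (mstar (S k f)) (S k f)) i j)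
        \<longlonglongrightarrow> (P (mmul d (mstar f) f) - mmul d (mstar (P f)) (P f)) i j" for i j
    proof (cases "i < d \<and> j < d")
      case True
      then show ?thesis
        unfolding mmul_def mstar_def minus_apply by simp (intro tendsto_intros lim[unfolded mmul_def mstar_def])
    next
      case False
      then have "(mmul d (mstar (S k f)) (S k f)) i j = 0" "(mmul d (mstar (P f)) (P f)) i j = 0" for k
        by (auto simp: mmul_def)
      then show ?thesis using lim by simp
    qed
  qed
qed

section \<open>The Choi--Effros algebra of the peripheral projection\<close>

lemma diff_add_diff_cancel: "(a - b) + (b - c) = a - (c :: 'a::ab_group_add)"
  by (simp add: algebra_simps)

lemma tr_sum: "tr d (sum f I) = (\<Sum>x\<in>I. tr d (f x))"
  unfolding tr_def sum_fun_apply by (rule sum.swap)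

lemma tr_mone: "tr d (mone d) = of_nat d"
  by (simp add: tr_def mone_def)

text \<open>The eigenvectors \<open>b\<close> are indexed because the eigenvalues
  \<open>\<nu>\<close> may repeat; \<open>n k \<ge> 1\<close> keeps clear of the zeroth power, which
  is no \<open>unital_schwarz\<close> map.\<close>

locale peripheral_projection = unital_schwarz d S for d S +
  fixes P :: "matf \<Rightarrow> matf" and n :: "nat \<Rightarrow> nat"
    and I :: "'i set" and b :: "'i \<Rightarrow> matf" and \<nu> :: "'i \<Rightarrow> complex"
  assumes P_lim: "(\<lambda>k. (S ^^ n k) f i j) \<longlonglongrightarrow> P f i j"
    and n_pos: "n k \<ge> 1"
    and finite_I: "finite I"
    and unimodular: "x \<in> I \<Longrightarrow> cmod (\<nu> x) = 1"
    and eigen: "x \<in> I \<Longrightarrow> S (b x) = msc (\<nu> x) (b x)"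
    and P_b: "x \<in> I \<Longrightarrow> P (b x) = b x"
    and P_span: "\<exists>c. P f = (\<Sum>x\<in>I. msc (c x) (b x))"
    and P_S: "P (S f) = S (P f)"
begin

lemma power': "unital_schwarz d (S ^^ n k)"
  using power[of "n k - 1"] n_pos[of k] by simp

sublocale P: unital_schwarz d P
  by (rule unital_schwarz_limit[OF power' P_lim])

lemma P_P: "P (P f) = P f"
proof -
  obtain c where c: "P f = (\<Sum>x\<in>I. msc (c x) (b x))" using P_span by blast
  have "P (\<Sum>x\<in>I. msc (c x) (b x)) = (\<Sum>x\<in>I. msc (c x) (b x))"
    unfolding P.S_sum by (intro sum.cong refl) (simp add: P.S_msc P_b)
  then show ?thesis by (simp only: c)
qed

lemma eqd_imp_eq:
  assumes "eqd d f g" "\<And>i j. i \<ge> d \<or> j \<ge> d \<Longrightarrow> f i j = g i j"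
  shows "f = g"
  using assms unfolding eqd_def by (intro ext) (meson not_le)

text \<open>P applied to the defect R(x* y) - R(x)* R(y) is a positive operator-valued form. It
  vanishes at (a, a) by assumption, so Cauchy-Schwarz kills it at every (y*, a). Taken with R = P
  for the product on X and with R = S for multiplicativity.\<close>

lemma multiplicative_domain:
  assumes R: "unital_schwarz d R"
    and a: "P (R (mmul d (mstar a) a)) = P (mmul d (mstar (R a)) (R a))"
  shows "P (R (mmul d y a)) = P (mmul d (R y) (R a))"
proof -
  interpret R: unital_schwarz d R by fact
  define D where "D x y = P (R (mmul d (mstar x) y) - mmul d (mstar (R x)) (R y))" for x y
  have D_pos: "pos d (D x x)" for x unfolding D_def by (intro P.S_pos R.S_schwarz)
  note lin = D_def R.S_add R.S_msc P.S_add P.S_msc P.S_diff qf_add qf_msc qf_diff mstar_add mstar_msc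
    mmul_add_left mmul_add_right mmul_msc_left mmul_msc_right
  have form: "psd_form (\<lambda>x y. qf d (D x y) v v) msc" for v
  proof
    show "Im (qf d (D x x) v v) = 0" "0 \<le> Re (qf d (D x x) v v)" for x
      using D_pos[of x] by (auto simp: pos_def)
  qed (simp_all add: lin algebra_simps)
  have "D a a = P (R (mmul d (mstar a) a)) - P (mmul d (mstar (R a)) (R a))" by (simp only: lin)
  then have Daa: "D a a = 0" using a by simp
  have "qf d (D a a) v v = 0" for v unfolding Daa by (simp add: qf_def)
  then have q: "qf d (D (mstar y) a) v v = 0" for v
    using psd_form.null_left[OF form[of v]] by blast
  have "eqd d (D (mstar y) a) 0"
    by (rule pos_antisym_eqd) (simp_all add: pos_def q qf_minus)
  then have "D (mstar y) a = 0"
    by (rule eqd_imp_eq) (simp add: D_def P.S_supp)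
  then show ?thesis by (simp add: D_def P.S_diff R.S_star)
qed

lemma choi_effros_right: "P a = a \<Longrightarrow> P (mmul d (P y) a) = P (mmul d y a)"
  using multiplicative_domain[OF P.unital_schwarz_axioms, of a y] by (simp add: P_P)

lemma choi_effros_left: assumes "P a = a" shows "P (mmul d a (P y)) = P (mmul d a y)"
proof -
  have "mstar (P (mmul d a (P y))) = mstar (P (mmul d a y))"
    using choi_effros_right[of "mstar a" "mstar y"] assms
    by (simp add: P.S_star[symmetric] mstar_mmul) (simp add: P.S_star)
  then show ?thesis by (metis mstar_mstar)
qed

text \<open>For h = P(a* a), |l| = 1 gives S(a)* S(a) = a* a and hence S h >= h. Then S^m h >= h for
  all m, so S^(n k) h >= S h, and in the limit h >= S h. The equality S h = h is the assumption of
  \<open>multiplicative_domain\<close>.\<close>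

lemma eigen_multiplicative:
  assumes a: "P a = a" "S a = msc l a" "cmod l = 1"
  shows "S (P (mmul d y a)) = P (mmul d (S y) (S a))"
proof -
  let ?h = "P (mmul d (mstar a) a)"
  have ll: "l * cnj l = 1" using a(3) by (simp add: mult_cnj_norm)
  have Sa: "mmul d (mstar (S a)) (S a) = mmul d (mstar a) a"
    using ll by (simp add: a(2) mstar_msc mmul_msc_left mmul_msc_right)
  have "pos d (P (S (mmul d (mstar a) a) - mmul d (mstar (S a)) (S a)))"
    by (intro P.S_pos S_schwarz)
  then have 1: "pos d (S ?h - ?h)" by (simp add: P.S_diff P_S Sa)
  have 2: "pos d ((S ^^ m) ?h - ?h)" for m
  proof (induction m)
    case 0
    then show ?case by (simp add: pos_def qf_def)
  next
    case (Suc m)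
    then have "pos d (S ((S ^^ m) ?h - ?h) + (S ?h - ?h))" using 1 by (intro pos_add S_pos)
    moreover have "S ((S ^^ m) ?h - ?h) + (S ?h - ?h) = (S ^^ Suc m) ?h - ?h"
      unfolding S_diff funpow.simps comp_apply by (rule diff_add_diff_cancel)
    ultimately show ?case by metis
  qed
  have 3: "pos d ((S ^^ n k) ?h - S ?h)" for k
  proof -
    obtain m where m: "n k = Suc m" using n_pos[of k] by (cases "n k") auto
    have "pos d (S ((S ^^ m) ?h - ?h))" using 2 by (rule S_pos)
    then show ?thesis by (simp add: m S_diff)
  qed
  have "pos d (P ?h - S ?h)"
  proof (rule pos_limit[OF _ 3])
    show "(\<lambda>k. ((S ^^ n k) ?h - S ?h) i j) \<longlonglongrightarrow> (P ?h - S ?h) i j" for i j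
      unfolding minus_apply by (intro tendsto_intros P_lim)
  qed
  then have "pos d (?h - S ?h)" by (simp add: P_P)
  then have "eqd d (S ?h) ?h" using 1 by (rule pos_antisym_eqd[rotated])
  then have "S ?h = ?h" by (rule eqd_imp_eq) (simp add: S_supp P.S_supp)
  then have "P (S (mmul d (mstar a) a)) = P (mmul d (mstar (S a)) (S a))" by (simp add: P_S Sa)
  from multiplicative_domain[OF unital_schwarz_axioms this] show ?thesis by (simp add: P_S)
qed

lemma S_multiplicative:
  assumes a: "P a = a"
  shows "S (P (mmul d y a)) = P (mmul d (S y) (S a))"
proof -
  obtain c where "P a = (\<Sum>x\<in>I. msc (c x) (b x))" using P_span by blast
  then have c: "a = (\<Sum>x\<in>I. msc (c x) (b x))" using a by simp
  have right: "mmul d z (sum f J) = (\<Sum>x\<in>J. mmul d z (f x))" for z and f :: "'i \<Rightarrow> matf" and J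
    by (induction J rule: infinite_finite_induct)
      (simp_all only: sum.infinite sum.empty sum.insert mmul_add_right not_False_eq_True,
       auto simp: mmul_def fun_eq_iff)
  have "S (P (mmul d y (b x))) = P (mmul d (S y) (S (b x)))" if "x \<in> I" for x
    using eigen_multiplicative[OF P_b eigen unimodular] that by blast
  then have "(\<Sum>x\<in>I. msc (c x) (S (P (mmul d y (b x))))) = (\<Sum>x\<in>I. msc (c x) (P (mmul d (S y) (S (b x)))))"
    by (intro sum.cong) auto
  then show ?thesis
    unfolding c right S_sum P.S_sum S_msc P.S_msc mmul_msc_right .
qed

definition X :: "matf set" where "X = {x. P x = x}"

text \<open>The Choi--Effros product. Projecting both factors first makes it associative on all functions,
  not only on \<open>X\<close>.\<close>

definition mul :: "matf \<Rightarrow> matf \<Rightarrow> matf" where "mul x y = P (mmul d (P x) (P y))"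

lemma projection_tr_ge_1:
  assumes p: "P p = p" "mul p p = p" "mstar p = p" "p \<noteq> 0"
  shows "pos d p" "Re (tr d p) \<ge> 1"
proof -
  have pp: "P (mmul d p p) = p" using p by (simp add: mul_def)
  then have "p = P (mmul d (mstar p) p)" using p(3) by simp
  then show pos: "pos d p" using P.S_pos[OF pos_star_mul] by metis
  show "Re (tr d p) \<ge> 1"
  proof (rule ccontr)
    assume lt: "\<not> Re (tr d p) \<ge> 1"
    have "pos d (P (msc (tr d p) p - mmul d p p))" by (intro P.S_pos pos_square_bound pos)
    then have 1: "pos d (msc (tr d p) p - p)" by (simp add: P.S_diff P.S_msc pp p(1))
    have "pos d (- p)"
      unfolding pos_def
    proof (intro allI)
      fix v
      have q: "Im (qf d p v v) = 0" "Re (qf d p v v) \<ge> 0" using pos by (auto simp: pos_def)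
      have "0 \<le> Re (qf d (msc (tr d p) p - p) v v)" using 1 by (simp add: pos_def)
      then have "0 \<le> (Re (tr d p) - 1) * Re (qf d p v v)"
        using q by (simp add: qf_diff qf_msc algebra_simps)
      then have "Re (qf d p v v) \<le> 0" using lt by (simp add: zero_le_mult_iff)
      then show "Im (qf d (- p) v v) = 0 \<and> 0 \<le> Re (qf d (- p) v v)" using q by (simp add: qf_minus)
    qed
    then have "eqd d p 0" using pos_antisym[OF pos] by (auto simp: eqd_def)
    then have "p = 0" by (rule eqd_imp_eq) (metis P.S_supp p(1) zero_fun_apply)
    then show False using p(4) by simp
  qed
qed

lemma card_projections_le_dim:
  assumes Q: "finite Q" "Q \<subseteq> X" "\<And>p. p \<in> Q \<Longrightarrow> p \<noteq> 0 \<and> mul p p = p \<and> mstar p = p"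
    and sum: "\<Sum>Q = mone d"
  shows "card Q \<le> d"
proof -
  have "real (card Q) = (\<Sum>p\<in>Q. 1)" by simp
  also have "\<dots> \<le> (\<Sum>p\<in>Q. Re (tr d p))"
    using Q projection_tr_ge_1(2) by (intro sum_mono) (auto simp: X_def)
  also have "\<dots> = Re (tr d (\<Sum>Q))" by (simp add: tr_sum)
  also have "\<dots> = real d" by (simp only: sum tr_mone) simp
  finally show ?thesis by simp
qed

lemma X_supp: "x \<in> X \<Longrightarrow> i \<ge> d \<or> j \<ge> d \<Longrightarrow> x i j = 0"
  using P.S_supp[of i j x] by (auto simp: X_def)

sublocale star_automorphism msc X mul mstar "mone d" d S
proof unfold_locales
  show "mvs.subspace X" by (auto simp: X_def mvs.subspace_def P.S_add P.S_msc P.S_zero)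
  show "\<exists>B. finite B \<and> X \<subseteq> mvs.span B"
  proof (intro exI[of _ "b ` I"] conjI subsetI)
    show "finite (b ` I)" using finite_I by simp
    fix x assume "x \<in> X"
    moreover obtain c where "P x = (\<Sum>x\<in>I. msc (c x) (b x))" using P_span by blast
    ultimately have "x = (\<Sum>x\<in>I. msc (c x) (b x))" by (simp add: X_def)
    then show "x \<in> mvs.span (b ` I)"
      by (metis (no_types, lifting) imageI mvs.span_base mvs.span_scale mvs.span_sum)
  qed
  show "mul x y \<in> X" for x y by (simp add: X_def mul_def P_P)
  show "mul (x + y) z = mul x z + mul y z" for x y z by (simp add: mul_def P.S_add mmul_add_left)
  show "mul x (y + z) = mul x y + mul x z" for x y z by (simp add: mul_def P.S_add mmul_add_right)
  show "mul (msc c x) y = msc c (mul x y)" for c x y by (simp add: mul_def P.S_msc mmul_msc_left)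
  show "mul x (msc c y) = msc c (mul x y)" for c x y by (simp add: mul_def P.S_msc mmul_msc_right)
  \<comment> \<open>Both bracketings equal P of the triple matrix product, the inner P being
    absorbed by the Choi-Effros identities.\<close>
  show "mul (mul x y) z = mul x (mul y z)" for x y z
  proof -
    have "mul (mul x y) z = P (mmul d (mmul d (P x) (P y)) (P z))"
      unfolding mul_def P_P by (rule choi_effros_right[OF P_P])
    also have "\<dots> = P (mmul d (P x) (mmul d (P y) (P z)))" by (simp only: mmul_assoc)
    also have "\<dots> = mul x (mul y z)"
      unfolding mul_def P_P by (rule choi_effros_left[OF P_P, symmetric])
    finally show ?thesis .
  qed
  show "x \<in> X \<Longrightarrow> mstar x \<in> X" for x by (simp add: X_def P.S_star)
  show "mstar (x + y) = mstar x + mstar y" for x y by (rule mstar_add)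
  show "mstar (msc c x) = msc (cnj c) (mstar x)" for c x by (rule mstar_msc)
  show "mstar (mstar x) = x" for x by (rule mstar_mstar)
  show "mstar (mul x y) = mul (mstar y) (mstar x)" for x y
    by (simp add: mul_def P.S_star[symmetric] mstar_mmul)
  show "mone d \<in> X" by (simp add: X_def P.S_one)
  show "mul (mone d) x = x" if "x \<in> X" for x
    using mmul_mone_left[of d x] X_supp[OF that] that by (simp add: mul_def P.S_one X_def)
  show "mul x (mone d) = x" if "x \<in> X" for x
    using mmul_mone_right[of d x] X_supp[OF that] that by (simp add: mul_def P.S_one X_def)
  show "x = 0" if x: "x \<in> X" "mul (mstar x) x = 0" for x
  proof -
    have Px: "P x = x" using x by (simp add: X_def)
    have "P (mmul d (mstar x) x) = 0" using x Px by (simp add: mul_def P.S_star)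
    \<comment> \<open>As P x = x and P(x* x) = 0, the Schwarz inequality for P says that - x* x is
      positive.\<close>
    then have "pos d (- mmul d (mstar x) x)"
      using P.S_schwarz[of x] by (simp add: Px)
    then have "mmul d (mstar x) x j j = 0" if "j < d" for j
      using pos_antisym[OF pos_star_mul _ that that] by blast
    then have "(\<Sum>k<d. (cmod (x k j))\<^sup>2) = 0" if "j < d" for j
      using that by (simp add: mmul_def mstar_def mult_cnj_norm flip: of_real_power of_real_sum)
    then have "eqd d x 0" by (auto simp: eqd_def sum_nonneg_eq_0_iff)
    then show ?thesis by (rule eqd_imp_eq) (simp add: X_supp[OF x(1)])
  qed
  show "card Q \<le> d" if "finite Q" "Q \<subseteq> X"
    "\<And>p. p \<in> Q \<Longrightarrow> p \<noteq> 0 \<and> mul p p = p \<and> mstar p = p" "\<Sum>Q = mone d" for Q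
    using that by (rule card_projections_le_dim)
  show "S (x + y) = S x + S y" for x y by (rule S_add)
  show "S (msc c x) = msc c (S x)" for c x by (rule S_msc)
  show "S (mul x y) = mul (S x) (S y)" if "x \<in> X" "y \<in> X" for x y
    using that S_multiplicative[of y x] by (simp add: mul_def X_def P_S)
  show "S (mstar x) = mstar (S x)" for x by (rule S_star)
  show "S (mone d) = mone d" by (rule S_one)
qed

text \<open>X is spanned by the independent eigenvectors b, so the eigenvalue equation for z forces
  all coefficients with \<open>\<nu> s \<noteq> z\<close> to vanish.\<close>

lemma dim_E_eq:
  assumes ind: "\<And>u s. (\<Sum>s\<in>I. msc (u s) (b s)) = 0 \<Longrightarrow> s \<in> I \<Longrightarrow> u s = 0"
  shows "mvs.dim (E z) = card {s \<in> I. \<nu> s = z}"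
proof -
  define J where "J = {s \<in> I. \<nu> s = z}"
  have J: "J \<subseteq> I" "finite J" using finite_I by (auto simp: J_def)
  have "u s = 0" if u: "(\<Sum>s\<in>J. msc (u s) (b s)) = 0" "s \<in> J" for u s
  proof -
    have "(\<Sum>s\<in>I. msc (if s \<in> J then u s else 0) (b s)) = (\<Sum>s\<in>J. msc (u s) (b s))"
      by (rule sum.mono_neutral_cong_right) (use J finite_I in auto)
    then show ?thesis using ind[of "\<lambda>s. if s \<in> J then u s else 0" s] u J by auto
  qed
  then have fam: "inj_on b J" "mvs.independent (b ` J)"
    using mvs.independent_family[OF J(2), of b] by blast+
  have E_iff: "x \<in> E w \<longleftrightarrow> P x = x \<and> S x = msc w x" for x w
    unfolding E_def by (simp add: X_def)
  have bJ: "b ` J \<subseteq> E z" using P_b eigen by (auto simp: J_def E_iff)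
  have "E z \<subseteq> mvs.span (b ` J)"
  proof
    fix x assume x: "x \<in> E z"
    obtain c where "P x = (\<Sum>s\<in>I. msc (c s) (b s))" using P_span by blast
    then have c: "x = (\<Sum>s\<in>I. msc (c s) (b s))" using x by (simp add: E_iff)
    have Sx: "S x = (\<Sum>s\<in>I. msc (c s) (msc (\<nu> s) (b s)))"
      unfolding c S_sum S_msc by (intro sum.cong refl) (simp add: eigen)
    have zx: "msc z x = (\<Sum>s\<in>I. msc (c s) (msc z (b s)))"
      unfolding c mvs.scale_sum_right by (intro sum.cong refl) (simp add: mult.commute)
    have "(\<Sum>s\<in>I. msc (c s * (\<nu> s - z)) (b s)) = S x - msc z x"
      unfolding Sx zx sum_subtractf[symmetric]
      by (intro sum.cong refl) (simp add: mvs.scale_left_diff_distrib right_diff_distrib)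
    also have "\<dots> = 0" using x by (simp add: E_iff)
    finally have 0: "(\<Sum>s\<in>I. msc (c s * (\<nu> s - z)) (b s)) = 0" .
    have "c s * (\<nu> s - z) = 0" if "s \<in> I" for s
      by (rule ind[OF 0 that])
    then have "c s = 0" if "s \<in> I - J" for s using that by (auto simp: J_def)
    then have "x = (\<Sum>s\<in>J. msc (c s) (b s))"
      unfolding c by (intro sum.mono_neutral_right) (use J finite_I in auto)
    moreover have "(\<Sum>s\<in>J. msc (c s) (b s)) \<in> mvs.span (b ` J)"
      by (intro mvs.span_sum mvs.span_scale mvs.span_base imageI)
    ultimately show "x \<in> mvs.span (b ` J)" by simp
  qed
  then have "card (b ` J) = mvs.dim (E z)" using fam(2) bJ by (intro mvs.basis_card_eq_dim)
  then show ?thesis using fam(1) by (simp add: card_image J_def)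
qed

end

section \<open>Existence of the peripheral projection\<close>

text \<open>Monotone subsequences: first for the real parts, then within it for the imaginary
  parts.\<close>

lemma bounded_complex_convergent_subsequence:
  fixes z :: "nat \<Rightarrow> complex"
  assumes "\<And>n. cmod (z n) \<le> C"
  shows "\<exists>r. strict_mono r \<and> convergent (\<lambda>k. z (r k))"
proof -
  have real_case: "\<exists>r :: nat \<Rightarrow> nat. strict_mono r \<and> convergent (\<lambda>k. x (r k))"
    if x: "\<And>n. \<bar>x n\<bar> \<le> C" for x :: "nat \<Rightarrow> real"
  proof -
    obtain r :: "nat \<Rightarrow> nat" where r: "strict_mono r" "monoseq (\<lambda>n. x (r n))"
      using seq_monosub[of x] by blast
    moreover have "Bseq (\<lambda>n. x (r n))" using x by (intro BseqI'[of _ C]) simp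
    ultimately show ?thesis using Bseq_monoseq_convergent by blast
  qed
  obtain r where r: "strict_mono r" "convergent (\<lambda>k. Re (z (r k)))"
    using real_case[of "\<lambda>n. Re (z n)"] assms abs_Re_le_cmod order_trans by metis
  obtain s where s: "strict_mono s" "convergent (\<lambda>k. Im (z (r (s k))))"
    using real_case[of "\<lambda>n. Im (z (r n))"] assms abs_Im_le_cmod order_trans by metis
  have "convergent (\<lambda>k. Re (z (r (s k))))"
    using convergent_subseq_convergent[OF r(2) s(1)] by (simp add: o_def)
  then have "convergent (\<lambda>k. z (r (s k)))"
    using s(2) unfolding convergent_def tendsto_complex_iff
    by (metis complex.sel)
  then show ?thesis using strict_mono_o[OF r(1) s(1)] by (auto simp: o_def)
qed

text \<open>Along a common subsequence r each l^(r k) tends to a unimodular limit c; along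
  differences of these exponents the powers tend to c / c = 1.\<close>

lemma simultaneous_recurrence:
  fixes L :: "complex set"
  assumes "finite L" "\<And>l. l \<in> L \<Longrightarrow> cmod l = 1"
  shows "\<exists>n :: nat \<Rightarrow> nat. (\<forall>k. n k \<ge> Suc k) \<and> (\<forall>l\<in>L. (\<lambda>k. l ^ n k) \<longlonglongrightarrow> 1)"
proof -
  have "\<exists>r :: nat \<Rightarrow> nat. strict_mono r \<and> (\<forall>l\<in>L. convergent (\<lambda>k. l ^ r k))"
    using assms
  proof (induction L rule: finite_induct)
    case empty
    then show ?case by (intro exI[of _ id]) (auto simp: strict_mono_def)
  next
    case (insert l L)
    then obtain r :: "nat \<Rightarrow> nat" where r: "strict_mono r" "\<forall>l\<in>L. convergent (\<lambda>k. l ^ r k)" by auto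
    obtain s where s: "strict_mono s" "convergent (\<lambda>k. l ^ r (s k))"
      using bounded_complex_convergent_subsequence[of "\<lambda>k. l ^ r k" 1] insert.prems
      by (auto simp: norm_power)
    have "convergent (\<lambda>k. m ^ r (s k))" if "m \<in> L" for m
      using convergent_subseq_convergent[OF _ s(1), of "\<lambda>k. m ^ r k"] r(2) that by (simp add: o_def)
    then show ?case
      using s strict_mono_o[OF r(1) s(1)] by (intro exI[of _ "\<lambda>k. r (s k)"]) (auto simp: o_def)
  qed
  then obtain r :: "nat \<Rightarrow> nat" where r: "strict_mono r" "\<And>l. l \<in> L \<Longrightarrow> convergent (\<lambda>k. l ^ r k)"
    by blast
  have gap: "r i + k \<le> r (i + k)" for i k
  proof (induction k)
    case (Suc k)
    have "r (i + k) < r (i + Suc k)" using r(1) by (simp add: strict_mono_def)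
    then show ?case using Suc by simp
  qed simp
  \<comment> \<open>The partner index k + Suc k increases strictly, so its powers have the same
    limit, and it lies far enough ahead to make \<open>n k\<close> at least k + 1.\<close>
  define n where "n k = r (k + Suc k) - r k" for k
  show ?thesis
  proof (intro exI[of _ n] conjI allI ballI)
    show "n k \<ge> Suc k" for k using gap[of k "Suc k"] by (simp add: n_def)
    fix l assume l: "l \<in> L"
    have l0: "l \<noteq> 0" using assms(2)[OF l] by auto
    obtain c where c: "(\<lambda>k. l ^ r k) \<longlonglongrightarrow> c" using r(2)[OF l] by (auto simp: convergent_def)
    have "(\<lambda>k. cmod (l ^ r k)) \<longlonglongrightarrow> cmod c" using c by (rule tendsto_norm)
    then have "cmod c = 1" using assms(2)[OF l] by (simp add: norm_power LIMSEQ_const_iff)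
    then have c0: "c \<noteq> 0" by auto
    have "strict_mono (\<lambda>k :: nat. k + Suc k)" by (simp add: strict_mono_def)
    then have "(\<lambda>k. l ^ r (k + Suc k)) \<longlonglongrightarrow> c" using LIMSEQ_subseq_LIMSEQ[OF c] by (simp add: o_def)
    then have "(\<lambda>k. l ^ r (k + Suc k) / l ^ r k) \<longlonglongrightarrow> c / c" using c c0 by (rule tendsto_divide)
    moreover have "l ^ n k = l ^ r (k + Suc k) / l ^ r k" for k
      using gap[of k "Suc k"] l0 by (simp add: n_def power_diff)
    ultimately show "(\<lambda>k. l ^ n k) \<longlonglongrightarrow> 1" using c0 by simp
  qed
qed

lemma perturbed_contraction_tendsto_0:
  fixes x y :: "nat \<Rightarrow> complex"
  assumes rec: "\<And>n. x (Suc n) = l * x n + y n" and l: "cmod l < 1" and y: "y \<longlonglongrightarrow> 0"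
  shows "x \<longlonglongrightarrow> 0"
proof (rule LIMSEQ_I)
  fix e :: real assume e: "e > 0"
  define a where "a = cmod l"
  have a: "0 \<le> a" "a < 1" using l by (auto simp: a_def)
  \<comment> \<open>Once the perturbation is below e (1 - a) / 2, the constant e / 2 reproduces
    itself: a e / 2 + e (1 - a) / 2 = e / 2.\<close>
  have "e * (1 - a) / 2 > 0" using e a by simp
  then obtain N where "\<forall>n\<ge>N. cmod (y n - 0) < e * (1 - a) / 2" using LIMSEQ_D[OF y] by blast
  then have N: "cmod (y n) < e * (1 - a) / 2" if "n \<ge> N" for n using that by simp
  have bound: "cmod (x (N + k)) \<le> a ^ k * cmod (x N) + e / 2" for k
  proof (induction k)
    case (Suc k)
    have "cmod (x (N + Suc k)) \<le> a * cmod (x (N + k)) + cmod (y (N + k))"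
      using norm_triangle_ineq[of "l * x (N + k)" "y (N + k)"] by (simp add: rec norm_mult a_def)
    also have "\<dots> \<le> a * (a ^ k * cmod (x N) + e / 2) + e * (1 - a) / 2"
      using Suc a N[of "N + k"] by (intro add_mono mult_left_mono) auto
    also have "\<dots> = a ^ Suc k * cmod (x N) + e / 2" by (simp add: field_simps)
    finally show ?case .
  qed (use e in simp)
  have "(\<lambda>k. a ^ k * cmod (x N)) \<longlonglongrightarrow> 0 * cmod (x N)"
    using a by (intro tendsto_mult tendsto_const LIMSEQ_power_zero) auto
  then obtain K where K: "\<And>k. k \<ge> K \<Longrightarrow> \<bar>a ^ k * cmod (x N)\<bar> < e / 2"
    using LIMSEQ_D[of "\<lambda>k. a ^ k * cmod (x N)" 0 "e / 2"] e by auto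
  have "cmod (x n) < e" if "n \<ge> N + K" for n
  proof -
    define k where "k = n - N"
    have k: "n = N + k" "k \<ge> K" using that by (auto simp: k_def)
    then show ?thesis using bound[of k] K[of k] by simp
  qed
  then show "\<exists>no. \<forall>n\<ge>no. norm (x n - 0) < e" by auto
qed

text \<open>A Jordan basis with the blocks forgotten: \<open>eps j\<close> says that j continues the
  chain of j - 1, and then 0 < j keeps the truncated subtraction meaningful.\<close>

locale jordan_chains = unital_schwarz d S for d S +
  fixes m :: nat and b :: "nat \<Rightarrow> matf" and l :: "nat \<Rightarrow> complex" and eps :: "nat \<Rightarrow> bool"
  assumes chain: "j < m \<Longrightarrow> S (b j) = msc (l j) (b j) + (if eps j then b (j - 1) else 0)"
    and eps_eigen: "j < m \<Longrightarrow> eps j \<Longrightarrow> 0 < j \<and> l (j - 1) = l j"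
    and b_nonzero: "j < m \<Longrightarrow> \<exists>p<d. \<exists>q<d. b j p q \<noteq> 0"
    and b_span: "\<exists>c. eqd d f (\<Sum>j<m. msc (c j) (b j))"
begin

lemma power_msc_add: "(S ^^ n) (msc c f + g) = msc c ((S ^^ n) f) + (S ^^ n) g"
proof (induction n)
  case (Suc n)
  show ?case unfolding funpow.simps comp_apply Suc S_add S_msc ..
qed simp

lemma power_bounded:
  assumes "p < d" "q < d"
  obtains C where "\<And>n. cmod ((S ^^ n) f p q) \<le> C"
proof -
  \<comment> \<open>The maximum with the entry of f itself covers n = 0, to which
    \<open>S_bounded\<close> does not apply.\<close>
  define C where "C = max (cmod (f p q)) (sqrt (\<Sum>k<d. \<Sum>l<d. (cmod (f k l))\<^sup>2))"
  have "cmod ((S ^^ n) f p q) \<le> C" for n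
  proof (cases n)
    case 0
    then show ?thesis by (simp add: C_def)
  next
    case (Suc k)
    have "(cmod ((S ^^ Suc k) f p q))\<^sup>2 \<le> (\<Sum>k<d. \<Sum>l<d. (cmod (f k l))\<^sup>2)"
      using assms by (rule unital_schwarz.S_bounded[OF power])
    then have "cmod ((S ^^ n) f p q) \<le> sqrt (\<Sum>k<d. \<Sum>l<d. (cmod (f k l))\<^sup>2)"
      unfolding Suc by (rule real_le_rsqrt)
    then show ?thesis by (simp add: C_def)
  qed
  then show ?thesis using that by blast
qed

lemma eigen_power: "j < m \<Longrightarrow> \<not> eps j \<Longrightarrow> (S ^^ n) (b j) = msc (l j ^ n) (b j)"
  by (induction n) (simp_all add: S_msc chain mult.commute)

lemma chain_power: "j < m \<Longrightarrow> eps j \<Longrightarrow> (S ^^ Suc n) (b j) = msc (l j) ((S ^^ n) (b j)) + (S ^^ n) (b (j - 1))"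
  unfolding funpow_Suc_right comp_apply by (simp add: chain power_msc_add)

text \<open>Powers of S are bounded, so an eigenvector has |l| <= 1. If b j with |l j| = 1 continued
  a chain, its predecessor would by induction be an eigenvector, and S^n (b j) would contain n
  l^(n-1) times it, which is unbounded.\<close>

lemma eigenvalue_bounds: "j < m \<Longrightarrow> cmod (l j) \<le> 1 \<and> (eps j \<longrightarrow> cmod (l j) < 1)"
proof (induction j rule: less_induct)
  case (less j)
  show ?case
  proof (cases "eps j")
    case False
    obtain p q where pq: "p < d" "q < d" "b j p q \<noteq> 0" using b_nonzero[OF less.prems] by blast
    obtain C where C: "\<And>n. cmod ((S ^^ n) (b j) p q) \<le> C" using power_bounded[OF pq(1,2)] by blast
    have "cmod (l j) \<le> 1"
    proof (rule ccontr)
      assume "\<not> cmod (l j) \<le> 1"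
      then obtain n where "C / cmod (b j p q) < cmod (l j) ^ n" using real_arch_pow[of "cmod (l j)"] by auto
      moreover have "cmod (l j) ^ n * cmod (b j p q) \<le> C"
        using C[of n] False less.prems by (simp add: eigen_power msc_def norm_mult norm_power)
      ultimately show False using pq(3) by (simp add: field_simps)
    qed
    then show ?thesis using False by simp
  next
    case True
    define i where "i = j - 1"
    have i: "i < j" "i < m" "l i = l j" using eps_eigen[OF less.prems True] less.prems by (auto simp: i_def)
    have IH: "cmod (l j) \<le> 1" "eps i \<Longrightarrow> cmod (l j) < 1" using less.IH[OF i(1,2)] i(3) by auto
    have "cmod (l j) \<noteq> 1"
    proof
      assume 1: "cmod (l j) = 1"
      then have ni: "\<not> eps i" using IH(2) by auto
      \<comment> \<open>At n = 0 the exponent n - 1 is truncated to 0, but the factor n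
        vanishes.\<close>
      have pw: "(S ^^ n) (b j) = msc (l j ^ n) (b j) + msc (of_nat n * l j ^ (n - 1)) (b i)" for n
      proof (induction n)
        case (Suc n)
        show ?case unfolding chain_power[OF less.prems True] Suc i_def[symmetric] eigen_power[OF i(2) ni] i(3)
          by (cases n) (auto simp: msc_def fun_eq_iff algebra_simps)
      qed (auto simp: msc_def fun_eq_iff)
      obtain p q where pq: "p < d" "q < d" "b i p q \<noteq> 0" using b_nonzero[OF i(2)] by blast
      obtain C where C: "\<And>n. cmod ((S ^^ n) (b j) p q) \<le> C" using power_bounded[OF pq(1,2)] by blast
      obtain n :: nat where n: "(C + cmod (b j p q)) / cmod (b i p q) < real n"
        using reals_Archimedean2 by blast
      have "cmod (of_nat n * l j ^ (n - 1) * b i p q) \<le>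
          cmod ((S ^^ n) (b j) p q) + cmod (l j ^ n * b j p q)"
        using norm_triangle_ineq4[of "(S ^^ n) (b j) p q" "l j ^ n * b j p q"] by (simp add: pw msc_def)
      then have "real n * cmod (b i p q) \<le> C + cmod (b j p q)"
        using C[of n] 1 by (simp add: norm_mult norm_power)
      then show False using n pq(3) by (simp add: field_simps)
    qed
    then show ?thesis using IH(1) by simp
  qed
qed

lemma decay: "j < m \<Longrightarrow> cmod (l j) < 1 \<Longrightarrow> (\<lambda>n. (S ^^ n) (b j) p q) \<longlonglongrightarrow> 0"
proof (induction j rule: less_induct)
  case (less j)
  show ?case
  proof (cases "eps j")
    case False
    have "(\<lambda>n. l j ^ n * b j p q) \<longlonglongrightarrow> 0 * b j p q"
      using less.prems by (intro tendsto_mult tendsto_const LIMSEQ_power_zero)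
    then show ?thesis using less.prems False by (simp add: eigen_power msc_def)
  next
    case True
    then have "(\<lambda>n. (S ^^ n) (b (j - 1)) p q) \<longlonglongrightarrow> 0"
      using less eps_eigen[OF less.prems(1) True] by auto
    then show ?thesis
      by (rule perturbed_contraction_tendsto_0[rotated 2, where l = "l j"])
         (use chain_power[OF less.prems(1) True] less.prems in \<open>auto simp: msc_def simp del: funpow.simps\<close>)
  qed
qed

definition peripheral_indices :: "nat set" where
  "peripheral_indices = {j. j < m \<and> cmod (l j) = 1}"

lemma power_sum: "(S ^^ n) (\<Sum>j\<in>J. msc (c j) (f j)) = (\<Sum>j\<in>J. msc (c j) ((S ^^ n) (f j)))"
proof (induction n)
  case (Suc n)
  show ?case unfolding funpow.simps comp_apply Suc S_sum S_msc ..
qed simp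

lemma peripheral_projection_exists:
  "\<exists>P n. peripheral_projection d S P n peripheral_indices b l"
proof -
  let ?I = peripheral_indices
  have I: "?I \<subseteq> {..<m}" "finite ?I" by (auto simp: peripheral_indices_def)
  have eigen: "S (b j) = msc (l j) (b j)" "\<not> eps j" if "j \<in> ?I" for j
    using that chain[of j] eigenvalue_bounds[of j] by (auto simp: peripheral_indices_def)
  have "finite (l ` ?I)" "\<And>z. z \<in> l ` ?I \<Longrightarrow> cmod z = 1"
    using I(2) by (auto simp: peripheral_indices_def)
  then obtain n :: "nat \<Rightarrow> nat"
    where n: "\<And>k. n k \<ge> Suc k" "\<And>z. z \<in> l ` ?I \<Longrightarrow> (\<lambda>k. z ^ n k) \<longlonglongrightarrow> 1"
    using simultaneous_recurrence[of "l ` ?I"] by blast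
  \<comment> \<open>Coordinates are picked for each f separately; linearity of P is inherited from
    the limit \<open>P_lim\<close>.\<close>
  have "\<forall>f. \<exists>c. eqd d f (\<Sum>j<m. msc (c j) (b j))" using b_span by blast
  from choice[OF this] obtain co where co: "\<And>f. eqd d f (\<Sum>j<m. msc (co f j) (b j))" by blast
  define P where "P f = (\<Sum>j\<in>?I. msc (co f j) (b j))" for f
  have n_inf: "filterlim n at_top sequentially"
    using n(1) by (intro filterlim_at_top_mono[OF filterlim_Suc] always_eventually) auto
  \<comment> \<open>s = 0 identifies P as the limit; s = 1 serves \<open>P_S\<close>, because S^(n
    k) (S f) is S^(n k + 1) f.\<close>
  have shifted: "(\<lambda>k. (S ^^ (n k + s)) (b j) p q) \<longlonglongrightarrow> (if j \<in> ?I then l j ^ s * b j p q else 0)"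
    if "j < m" for j p q s
  proof (cases "j \<in> ?I")
    case True
    have "(\<lambda>k. l j ^ n k * (l j ^ s * b j p q)) \<longlonglongrightarrow> 1 * (l j ^ s * b j p q)"
      using n(2) True by (intro tendsto_mult tendsto_const) auto
    then show ?thesis using True eigen_power[OF that eigen(2)[OF True]] by (simp add: msc_def power_add mult.assoc)
  next
    case False
    then have "cmod (l j) < 1" using eigenvalue_bounds[OF that] that by (auto simp: peripheral_indices_def)
    then have "(\<lambda>n. (S ^^ n) (b j) p q) \<longlonglongrightarrow> 0" using decay that by blast
    moreover have "filterlim (\<lambda>k. n k + s) at_top sequentially"
      by (rule filterlim_at_top_mono[OF n_inf]) auto
    ultimately show ?thesis using False filterlim_compose by fastforce
  qed
  \<comment> \<open>At least one application of S is required: f agrees with its expansion on the d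
    x d block only.\<close>
  have expand: "(S ^^ Suc k) f = (\<Sum>j<m. msc (co f j) ((S ^^ Suc k) (b j)))" for k f
  proof -
    have "(S ^^ Suc k) f = (S ^^ Suc k) (\<Sum>j<m. msc (co f j) (b j))"
      unfolding funpow_Suc_right comp_apply S_cong[OF co[of f]] ..
    then show ?thesis by (simp only: power_sum)
  qed
  have lim: "(\<lambda>k. (S ^^ (n k + s)) f p q) \<longlonglongrightarrow> (\<Sum>j\<in>?I. co f j * (l j ^ s * b j p q))" for f p q s
  proof -
    have "(\<lambda>k. \<Sum>j<m. co f j * (S ^^ (n k + s)) (b j) p q) \<longlonglongrightarrow>
        (\<Sum>j<m. co f j * (if j \<in> ?I then l j ^ s * b j p q else 0))"
      by (intro tendsto_sum tendsto_mult tendsto_const shifted) auto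
    also have "(\<Sum>j<m. co f j * (if j \<in> ?I then l j ^ s * b j p q else 0)) = (\<Sum>j\<in>?I. co f j * (l j ^ s * b j p q))"
      by (rule sum.mono_neutral_cong_right) (use I in auto)
    finally have *: "(\<lambda>k. \<Sum>j<m. co f j * (S ^^ (n k + s)) (b j) p q) \<longlonglongrightarrow> (\<Sum>j\<in>?I. co f j * (l j ^ s * b j p q))" .
    have "(S ^^ (n k + s)) f p q = (\<Sum>j<m. co f j * (S ^^ (n k + s)) (b j) p q)" for k
    proof -
      obtain r where r: "n k + s = Suc r" using n(1)[of k] by (cases "n k + s") auto
      show ?thesis unfolding r expand[of r f] by (simp add: msc_def)
    qed
    then show ?thesis using * by simp
  qed
  have P_lim: "(\<lambda>k. (S ^^ n k) f p q) \<longlonglongrightarrow> P f p q" for f p q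
    using lim[of 0] by (simp add: P_def msc_def)
  have P_b: "P (b j) = b j" if "j \<in> ?I" for j
  proof (intro ext)
    fix p q
    have "(\<lambda>k. (S ^^ n k) (b j) p q) \<longlonglongrightarrow> b j p q"
      using shifted[of j 0 p q] that I(1) by auto
    then show "P (b j) p q = b j p q" using P_lim LIMSEQ_unique by blast
  qed
  have P_S: "P (S f) = S (P f)" for f
  proof (intro ext)
    fix p q
    have "S (P f) = (\<Sum>j\<in>?I. msc (co f j) (msc (l j) (b j)))"
      unfolding P_def S_sum S_msc by (intro sum.cong refl) (simp add: eigen)
    then have "S (P f) p q = (\<Sum>j\<in>?I. co f j * (l j ^ 1 * b j p q))" by (simp add: msc_def)
    moreover have "(\<lambda>k. (S ^^ n k) (S f) p q) \<longlonglongrightarrow> (\<Sum>j\<in>?I. co f j * (l j ^ 1 * b j p q))"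
      using lim[of 1 f p q] by (simp add: funpow_swap1)
    ultimately show "P (S f) p q = S (P f) p q" using LIMSEQ_unique[OF P_lim[of "S f" p q]] by simp
  qed
  have "peripheral_projection d S P n ?I b l"
  proof unfold_locales
    show "(\<lambda>k. (S ^^ n k) f i j) \<longlonglongrightarrow> P f i j" for f i j by (rule P_lim)
    show "1 \<le> n k" for k using n(1)[of k] by simp
    show "finite ?I" by (rule I)
    show "\<exists>c. P f = (\<Sum>x\<in>?I. msc (c x) (b x))" for f by (auto simp: P_def)
  qed (use eigen P_b P_S in \<open>auto simp: peripheral_indices_def\<close>)
  then show ?thesis by blast
qed

end

section \<open>The adjoint of a Schwarz map in Jordan form\<close>

text \<open>Dropping the block list lets later inductions run along column indices instead of pairs
  of block and offset.\<close>

lemma jordan_matrix_entries: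
  fixes nas :: "(nat \<times> 'a::{zero,one}) list"
  shows "\<exists>l eps. (\<forall>i<sum_list (map fst nas). \<forall>j<sum_list (map fst nas).
      jordan_matrix nas $$ (i, j) = (if i = j then l j else if Suc i = j \<and> eps j then 1 else 0)) \<and>
    (\<forall>j<sum_list (map fst nas). eps j \<longrightarrow> 0 < j \<and> l (j - 1) = l j)"
proof (induction nas)
  case Nil
  then show ?case by simp
next
  case (Cons na nas)
  obtain n a where na: "na = (n, a)" by (cases na)
  obtain l eps where IH: "\<And>i j. i < sum_list (map fst nas) \<Longrightarrow> j < sum_list (map fst nas) \<Longrightarrow>
      jordan_matrix nas $$ (i, j) = (if i = j then l j else if Suc i = j \<and> eps j then 1 else 0)"
    "\<And>j. j < sum_list (map fst nas) \<Longrightarrow> eps j \<Longrightarrow> 0 < j \<and> l (j - 1) = l j"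
    using Cons by blast
  define l' where "l' j = (if j < n then a else l (j - n))" for j
  define eps' where "eps' j = (if j < n then 0 < j else eps (j - n))" for j
  show ?case
  proof (intro exI[of _ l'] exI[of _ eps'] conjI allI impI)
    fix i j assume ij: "i < sum_list (map fst (na # nas))" "j < sum_list (map fst (na # nas))"
    show "jordan_matrix (na # nas) $$ (i, j) = (if i = j then l' j else if Suc i = j \<and> eps' j then 1 else 0)"
    proof (cases "j < n")
      case True
      then show ?thesis using ij by (auto simp: na jordan_matrix_Cons l'_def eps'_def)
    next
      case False
      \<comment> \<open>Nothing links the first block to the next one, since the tail carries no
        flag at its column 0.\<close>
      have "\<not> eps (j - n)" if "Suc i = j" "i < n" using IH(2)[of "j - n"] that False ij by (auto simp: na)
      then show ?thesis
        using ij IH(1)[of "i - n" "j - n"] False by (auto simp: na jordan_matrix_Cons l'_def eps'_def Suc_diff_le)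
    qed
  next
    fix j assume j: "j < sum_list (map fst (na # nas))" "eps' j"
    show "0 < j"
    proof (cases "j < n")
      case False
      then have "0 < j - n" using j IH(2)[of "j - n"] by (auto simp: eps'_def na)
      then show ?thesis by simp
    qed (use j in \<open>auto simp: eps'_def\<close>)
    show "l' (j - 1) = l' j"
    proof (cases "j < n")
      case False
      then have "0 < j - n \<and> l (j - n - 1) = l (j - n)" using j IH(2)[of "j - n"] by (auto simp: eps'_def na)
      then show ?thesis using False by (auto simp: l'_def)
    qed (auto simp: l'_def)
  qed
qed

lemma proots_linear_factors: "proots (\<Prod>a\<leftarrow>as. [:- a, 1:]) = mset (as :: complex list)"
proof (induction as)
  case (Cons a as)
  have "(\<Prod>a\<leftarrow>as. [:- a, 1:]) \<noteq> (0 :: complex poly)" by (auto simp: prod_list_zero_iff)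
  then have "proots ([:- a, 1:] * (\<Prod>a\<leftarrow>as. [:- a, 1:])) = proots [:- a, 1:] + proots (\<Prod>a\<leftarrow>as. [:- a, 1:])"
    by (intro proots_mult) auto
  then show ?case using Cons by (simp del: mult_pCons_left)
qed simp

text \<open>The columns of A are the Jordan chains: M = A J B gives M A = A J, read column by
  column, and the roots are the diagonal of the upper triangular J.\<close>

lemma jordan_basis:
  fixes M :: "complex mat"
  assumes M: "M \<in> carrier_mat m m"
  obtains A B l eps where "A \<in> carrier_mat m m" "B \<in> carrier_mat m m" "A * B = 1\<^sub>m m" "B * A = 1\<^sub>m m"
    "proots (char_poly M) = mset (map l [0..<m])"
    "\<And>x j. x < m \<Longrightarrow> j < m \<Longrightarrow> (M * A) $$ (x, j) = l j * A $$ (x, j) + (if eps j then A $$ (x, j - 1) else 0)"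
    "\<And>j. j < m \<Longrightarrow> eps j \<Longrightarrow> 0 < j \<and> l (j - 1) = l j"
proof -
  obtain as where "char_poly M = (\<Prod>a\<leftarrow>as. [:- a, 1:])" using char_poly_factorized[OF M] by blast
  then obtain nas where "jordan_nf M nas" using jordan_nf_exists[OF M] by blast
  then have sim: "similar_mat M (jordan_matrix nas)" by (simp add: jordan_nf_def)
  define J where "J = jordan_matrix nas"
  obtain n A B where AB: "{M, J, A, B} \<subseteq> carrier_mat n n" "A * B = 1\<^sub>m n" "B * A = 1\<^sub>m n" "M = A * J * B"
    using similar_matD[OF sim] unfolding J_def by blast
  have n: "n = m" using AB(1) M by auto
  have c: "A \<in> carrier_mat m m" "B \<in> carrier_mat m m" "J \<in> carrier_mat m m" using AB(1) n by auto
  have m: "sum_list (map fst nas) = m" using c(3) by (auto simp: J_def)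
  obtain l eps where J: "\<And>i j. i < m \<Longrightarrow> j < m \<Longrightarrow>
      J $$ (i, j) = (if i = j then l j else if Suc i = j \<and> eps j then 1 else 0)"
    "\<And>j. j < m \<Longrightarrow> eps j \<Longrightarrow> 0 < j \<and> l (j - 1) = l j"
    using jordan_matrix_entries[of nas] unfolding m J_def by blast
  have "char_poly M = char_poly J" using sim unfolding J_def by (rule char_poly_similar)
  also have "\<dots> = (\<Prod>a\<leftarrow>diag_mat J. [:- a, 1:])"
    using c(3) J(1) by (intro char_poly_upper_triangular[of _ m] upper_triangularI) auto
  finally have "proots (char_poly M) = mset (diag_mat J)" by (simp add: proots_linear_factors)
  moreover have "diag_mat J = map l [0..<m]" using c(3) J(1) by (auto simp: diag_mat_def)
  ultimately have pr: "proots (char_poly M) = mset (map l [0..<m])" by simp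
  have "M * A = A * J * (B * A)" unfolding AB(4) using c by (simp add: assoc_mult_mat[of _ m m _ m _ m])
  then have MA: "M * A = A * J" using AB(3) c by (simp add: n)
  have "(M * A) $$ (x, j) = l j * A $$ (x, j) + (if eps j then A $$ (x, j - 1) else 0)"
    if xj: "x < m" "j < m" for x j
  proof -
    have "(M * A) $$ (x, j) = (\<Sum>i<m. A $$ (x, i) * J $$ (i, j))"
      using c xj by (simp add: MA scalar_prod_def atLeast0LessThan)
    also have "\<dots> = (\<Sum>i<m. (if i = j then l j * A $$ (x, j) else 0) +
        (if i = j - 1 then (if eps j then A $$ (x, j - 1) else 0) else 0))"
      using J(2)[OF xj(2)] by (intro sum.cong refl) (auto simp: J(1) xj)
    also have "\<dots> = l j * A $$ (x, j) + (if eps j then A $$ (x, j - 1) else 0)"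
    proof -
      have "j - 1 < m" using xj by simp
      then show ?thesis using xj by (simp add: sum.distrib)
    qed
    finally show ?thesis .
  qed
  then show ?thesis using that[of A B l eps] c AB(2,3) n pr J(2) by blast
qed

lemma pair_index:
  assumes "p < d" "q < (d::nat)"
  shows "p * d + q < d * d" "(p * d + q) div d = p" "(p * d + q) mod d = q"
proof -
  have "p * d + q < p * d + d" using assms by simp
  also have "\<dots> = Suc p * d" by simp
  also have "\<dots> \<le> d * d" using assms by (intro mult_le_mono1) simp
  finally show "p * d + q < d * d" .
qed (use assms in auto)

lemma sum_div_mod:
  fixes g :: "nat \<Rightarrow> nat \<Rightarrow> 'a::comm_monoid_add"
  shows "(\<Sum>b<d * d. g (b div d) (b mod d)) = (\<Sum>p<d. \<Sum>q<d. g p q)"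
proof -
  have "(\<Sum>b<d * d. g (b div d) (b mod d)) = (\<Sum>(p, q)\<in>{..<d} \<times> {..<d}. g p q)"
    by (rule sum.reindex_bij_witness[of _ "\<lambda>(p, q). p * d + q" "\<lambda>b. (b div d, b mod d)"])
      (auto simp: pair_index less_mult_imp_div_less intro!: mod_less_divisor intro: gr0I)
  then show ?thesis by (simp add: sum.cartesian_product)
qed

section \<open>Matrices and their entry functions\<close>

definition entries :: "complex mat \<Rightarrow> matf" where
  "entries A = (\<lambda>i j. A $$ (i, j))"

definition of_entries :: "nat \<Rightarrow> matf \<Rightarrow> complex mat" where
  "of_entries d f = mat d d (\<lambda>(i, j). f i j)"

lemma of_entries_carrier [simp]: "of_entries d f \<in> carrier_mat d d"
  by (simp add: of_entries_def)

lemma entries_of_entries: "eqd d (entries (of_entries d f)) f"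
  by (simp add: eqd_def entries_def of_entries_def)

lemma qf_entries:
  assumes "A \<in> carrier_mat d d" "v \<in> carrier_vec d"
  shows "(\<Sum>i<d. cnj (v $ i) * (A *\<^sub>v v) $ i) = qf d (entries A) (($) v) (($) v)"
  unfolding qf_def entries_def using assms
  by (intro sum.cong refl) (auto simp: scalar_prod_def sum_distrib_left mult.assoc atLeast0LessThan)

lemma psd_iff_pos:
  assumes A: "A \<in> carrier_mat d d"
  shows "psd d A \<longleftrightarrow> pos d (entries A)"
proof
  assume psd: "psd d A"
  have herm: "cnj (A $$ (i, j)) = A $$ (j, i)" if "i < d" "j < d" for i j
  proof -
    have "A $$ (j, i) = cadj A $$ (j, i)" using psd by (simp add: psd_def)
    then show ?thesis using that A by (simp add: cadj_def)
  qed
  show "pos d (entries A)"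
    unfolding pos_def
  proof (intro allI conjI)
    fix w
    have q: "qf d (entries A) w w = qf d (entries A) (($) (vec d w)) (($) (vec d w))"
      by (simp add: qf_def)
    show "0 \<le> Re (qf d (entries A) w w)"
      unfolding q qf_entries[OF A vec_carrier, symmetric]
      using psd vec_carrier[of d w] unfolding psd_def by blast
    have "cnj (qf d (entries A) w w) = (\<Sum>i<d. \<Sum>j<d. cnj (w j) * entries A j i * w i)"
      by (auto simp: qf_def entries_def herm mult_ac intro!: sum.cong)
    also have "\<dots> = qf d (entries A) w w" unfolding qf_def by (rule sum.swap)
    finally show "Im (qf d (entries A) w w) = 0" by (simp add: complex_eq_iff)
  qed
next
  assume pos: "pos d (entries A)"
  have "cadj A = A"
  proof (rule eq_matI)
    fix i j assume "i < dim_row A" "j < dim_col A"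
    then show "cadj A $$ (i, j) = A $$ (i, j)"
      using A pos_hermitian[OF pos, of j i] by (simp add: cadj_def entries_def)
  qed (use A in \<open>auto simp: cadj_def\<close>)
  moreover have "0 \<le> Re (\<Sum>i<d. cnj (v $ i) * (A *\<^sub>v v) $ i)" if "v \<in> carrier_vec d" for v
    unfolding qf_entries[OF A that] using pos by (simp add: pos_def)
  ultimately show "psd d A" using A by (simp add: psd_def)
qed

lemma mtrace_mult:
  assumes "A \<in> carrier_mat d d" "B \<in> carrier_mat d d"
  shows "mtrace (A * B) = (\<Sum>p<d. \<Sum>q<d. A $$ (p, q) * B $$ (q, p))"
  using assms by (simp add: mtrace_def scalar_prod_def atLeast0LessThan)

lemma unit_mat_carrier [simp]: "unit_mat d k l \<in> carrier_mat d d"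
  by (simp add: unit_mat_def)

text \<open>Rank one matrices v v* have positive, hence hermitian, images. For v = e_i + z e_j with
  z = 1 and z = \<i>, removing the diagonal terms leaves two linear relations between the images of
  E_ij and E_ji; added up they give twice the claim.\<close>

lemma hermitian_preserving:
  assumes lin: "lin_map d T" and posT: "positive_map d T"
    and ij: "i < d" "j < d" and pq: "p < d" "q < d"
  shows "T (unit_mat d j i) $$ (q, p) = cnj (T (unit_mat d i j) $$ (p, q))"
proof -
  have T_add: "T (A + B) = T A + T B" and T_smult: "T (c \<cdot>\<^sub>m A) = c \<cdot>\<^sub>m T A"
    and T_carrier: "T A \<in> carrier_mat d d"
    if "A \<in> carrier_mat d d" "B \<in> carrier_mat d d" for A B c
    using lin that by (auto simp: lin_map_def)
  let ?E = "unit_mat d"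
  define h where "h A \<longleftrightarrow> (T A $$ (q, p) = cnj (T A $$ (p, q)))" for A
  have rank_one: "h (of_entries d (\<lambda>p q. v p * cnj (v q)))" for v
  proof -
    let ?V = "of_entries d (\<lambda>p q. v p * cnj (v q))"
    have "eqd d (entries ?V) (mmul d (mstar (\<lambda>k j. if k = i then cnj (v j) else 0)) (\<lambda>k j. if k = i then cnj (v j) else 0))"
    proof -
      have "(\<Sum>k<d. cnj (if k = i then cnj (v a) else 0) * (if k = i then cnj (v b) else 0)) = v a * cnj (v b)" for a b
      proof -
        have "(\<Sum>k<d. cnj (if k = i then cnj (v a) else 0) * (if k = i then cnj (v b) else 0))
            = (\<Sum>k<d. if k = i then v a * cnj (v b) else 0)" by (intro sum.cong) auto
        then show ?thesis using ij by simp
      qed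
      then show ?thesis by (simp add: eqd_def entries_def of_entries_def mmul_def mstar_def)
    qed
    then have "pos d (entries ?V)" using pos_cong pos_star_mul by metis
    then have "psd d (T ?V)" using posT psd_iff_pos[OF of_entries_carrier] by (simp add: positive_map_def)
    then have "pos d (entries (T ?V))" 
      using psd_iff_pos[OF T_carrier[OF of_entries_carrier of_entries_carrier]] by blast
    from pos_hermitian[OF this pq] show ?thesis by (simp add: h_def entries_def)
  qed
  have T_entries_add: "T (A + B) $$ (a, b) = T A $$ (a, b) + T B $$ (a, b)"
    if "A \<in> carrier_mat d d" "B \<in> carrier_mat d d" "a < d" "b < d" for A B a b
    using that T_carrier[OF that(1,1)] T_carrier[OF that(2,2)] by (simp add: T_add)
  have T_entries_smult: "T (c \<cdot>\<^sub>m A) $$ (a, b) = c * T A $$ (a, b)"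
    if "A \<in> carrier_mat d d" "a < d" "b < d" for A a b c
    using that T_carrier[OF that(1,1)] by (simp add: T_smult[OF that(1,1)])
  note T_entries = T_entries_add T_entries_smult
  have diag: "h (?E a a)" if "a < d" for a
  proof -
    have "?E a a = of_entries d (\<lambda>p q. (if p = a then 1 else 0) * cnj (if q = a then 1 else 0))"
      by (auto simp: unit_mat_def of_entries_def intro!: cong_mat)
    then show ?thesis using rank_one by metis
  qed
  have cross: "h (cnj z \<cdot>\<^sub>m ?E i j + z \<cdot>\<^sub>m ?E j i)" for z
  proof -
    let ?v = "\<lambda>p. (if p = i then 1 else 0) + (if p = j then z else 0)"
    let ?r = "complex_of_real ((cmod z)\<^sup>2)"
    have e: "of_entries d (\<lambda>p q. ?v p * cnj (?v q)) =
        (?E i i + ?r \<cdot>\<^sub>m ?E j j) + (cnj z \<cdot>\<^sub>m ?E i j + z \<cdot>\<^sub>m ?E j i)"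
      by (rule eq_matI) (auto simp: unit_mat_def of_entries_def mult_cnj_norm algebra_simps)
    have "h (of_entries d (\<lambda>p q. ?v p * cnj (?v q)))" by (rule rank_one)
    then show ?thesis
      using diag[OF ij(1)] diag[OF ij(2)] pq unfolding e h_def
      by (simp add: T_entries del: of_real_power)
  qed
  have "h (1 \<cdot>\<^sub>m ?E i j + 1 \<cdot>\<^sub>m ?E j i)" using cross[of 1] by simp
  then have 1: "T (?E i j) $$ (q, p) + T (?E j i) $$ (q, p) = cnj (T (?E i j) $$ (p, q)) + cnj (T (?E j i) $$ (p, q))"
    using pq by (simp add: h_def T_entries)
  have "h (- \<i> \<cdot>\<^sub>m ?E i j + \<i> \<cdot>\<^sub>m ?E j i)" using cross[of \<i>] by simp
  then have "- \<i> * T (?E i j) $$ (q, p) + \<i> * T (?E j i) $$ (q, p) =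
      \<i> * cnj (T (?E i j) $$ (p, q)) - \<i> * cnj (T (?E j i) $$ (p, q))"
    using pq by (simp add: h_def T_entries)
  then have "\<i> * (T (?E j i) $$ (q, p) - T (?E i j) $$ (q, p)) =
      \<i> * (cnj (T (?E i j) $$ (p, q)) - cnj (T (?E j i) $$ (p, q)))" by (simp add: algebra_simps)
  then have 2: "T (?E j i) $$ (q, p) - T (?E i j) $$ (q, p) =
      cnj (T (?E i j) $$ (p, q)) - cnj (T (?E j i) $$ (p, q))" by simp
  have "2 * T (?E j i) $$ (q, p) = (T (?E i j) $$ (q, p) + T (?E j i) $$ (q, p)) +
      (T (?E j i) $$ (q, p) - T (?E i j) $$ (q, p))" by simp
  also have "\<dots> = 2 * cnj (T (?E i j) $$ (p, q))" unfolding 1 2 by simp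
  finally have "2 * T (?E j i) $$ (q, p) = 2 * cnj (T (?E i j) $$ (p, q))" .
  then show ?thesis by simp
qed

text \<open>The adjoint \<open>T\<^sup>*\<close> written out through its matrix elements, which makes it linear on all functions.\<close>

definition adj_fun :: "nat \<Rightarrow> (complex mat \<Rightarrow> complex mat) \<Rightarrow> matf \<Rightarrow> matf" where
  "adj_fun d T f = (\<lambda>i j. if i < d \<and> j < d then
     \<Sum>p<d. \<Sum>q<d. T (unit_mat d j i) $$ (p, q) * f q p else 0)"

text \<open>Pairing with the matrix unit E_ji reads the (i, j) entry of S B as a trace, and the
  adjoint relation moves S over to T.\<close>

lemma adj_fun_eq:
  assumes adj: "is_adjoint_map d T S" and T: "lin_map d T" and B: "B \<in> carrier_mat d d" and ij: "i < d" "j < d"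
  shows "S B $$ (i, j) = adj_fun d T (entries B) i j"
proof -
  have SB: "S B \<in> carrier_mat d d" using adj B by (simp add: is_adjoint_map_def)
  have TE: "T (unit_mat d j i) \<in> carrier_mat d d" using T by (simp add: lin_map_def)
  have "mtrace (unit_mat d j i * S B) = (\<Sum>p<d. \<Sum>q<d. (if p = j then if q = i then S B $$ (i, j) else 0 else 0))"
    unfolding mtrace_mult[OF unit_mat_carrier SB]
    by (intro sum.cong refl) (auto simp: unit_mat_def)
  also have "\<dots> = (\<Sum>p<d. if p = j then S B $$ (i, j) else 0)"
    using ij by (intro sum.cong refl) auto
  also have "\<dots> = S B $$ (i, j)" using ij by simp
  finally have "S B $$ (i, j) = mtrace (T (unit_mat d j i) * B)"
    using adj B by (simp add: is_adjoint_map_def)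
  then show ?thesis using ij by (simp add: mtrace_mult[OF TE B] adj_fun_def entries_def)
qed

text \<open>Unitality is trace preservation of T, compatibility with the star is
  \<open>hermitian_preserving\<close>, and the Schwarz inequality is that of the given adjoint,
  which agrees with \<open>adj_fun\<close> entrywise.\<close>

lemma unital_schwarz_adj_fun:
  assumes "schwarz_map d T"
  shows "unital_schwarz d (adj_fun d T)"
proof -
  have T: "lin_map d T" "positive_map d T" "trace_preserving d T" using assms by (auto simp: schwarz_map_def)
  obtain S where adj: "is_adjoint_map d T S"
    and sch: "\<And>A. A \<in> carrier_mat d d \<Longrightarrow> psd d (S (cadj A * A) - S (cadj A) * S A)"
    using assms by (auto simp: schwarz_map_def)
  have S_carrier: "S B \<in> carrier_mat d d" if "B \<in> carrier_mat d d" for B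
    using adj that by (simp add: is_adjoint_map_def)
  have cong: "adj_fun d T f = adj_fun d T g" if "eqd d f g" for f g
    using that unfolding adj_fun_def eqd_def by (intro ext) simp
  have S_eq: "S (of_entries d f) $$ (i, j) = adj_fun d T f i j" if "i < d" "j < d" for f i j
    unfolding adj_fun_eq[OF adj T(1) of_entries_carrier that] cong[OF entries_of_entries] ..
  have star: "adj_fun d T (mstar f) = mstar (adj_fun d T f)" for f
  proof (intro ext)
    fix i j
    show "adj_fun d T (mstar f) i j = mstar (adj_fun d T f) i j"
    proof (cases "i < d \<and> j < d")
      case True
      then have "adj_fun d T (mstar f) i j = (\<Sum>p<d. \<Sum>q<d. cnj (T (unit_mat d i j) $$ (q, p) * f p q))"
        unfolding adj_fun_def mstar_def by (simp add: hermitian_preserving[OF T(1,2), of i j])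
      also have "\<dots> = (\<Sum>q<d. \<Sum>p<d. cnj (T (unit_mat d i j) $$ (q, p) * f p q))" by (rule sum.swap)
      also have "\<dots> = mstar (adj_fun d T f) i j" using True by (simp add: adj_fun_def mstar_def)
      finally show ?thesis .
    qed (auto simp: adj_fun_def mstar_def)
  qed
  show ?thesis
  proof
    fix f g c
    show "adj_fun d T (f + g) = adj_fun d T f + adj_fun d T g"
      by (simp add: adj_fun_def fun_eq_iff sum.distrib distrib_left)
    show "adj_fun d T (msc c f) = msc c (adj_fun d T f)"
      by (simp add: adj_fun_def msc_def fun_eq_iff sum_distrib_left mult_ac)
    show "adj_fun d T f i j = 0" if "i \<ge> d \<or> j \<ge> d" for i j using that by (auto simp: adj_fun_def)
    show "adj_fun d T f = adj_fun d T g" if "eqd d f g" using that by (rule cong)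
    show "adj_fun d T (mstar f) = mstar (adj_fun d T f)" by (rule star)
    show "adj_fun d T (mone d) = mone d"
    proof (intro ext)
      fix i j
      show "adj_fun d T (mone d) i j = mone d i j"
      proof (cases "i < d \<and> j < d")
        case True
        have TE: "T (unit_mat d j i) \<in> carrier_mat d d" using T(1) by (simp add: lin_map_def)
        have "adj_fun d T (mone d) i j = (\<Sum>p<d. \<Sum>q<d. if q = p then T (unit_mat d j i) $$ (p, p) else 0)"
          using True unfolding adj_fun_def mone_def by (auto intro!: sum.cong)
        also have "\<dots> = mtrace (T (unit_mat d j i))" using TE by (simp add: mtrace_def)
        also have "\<dots> = mtrace (unit_mat d j i)" using T(3) by (simp add: trace_preserving_def)
        also have "\<dots> = (\<Sum>p<d. if p = j then mone d i j else 0)"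
          using True by (auto simp: mtrace_def unit_mat_def mone_def intro!: sum.cong)
        also have "\<dots> = mone d i j" using True by simp
        finally show ?thesis .
      qed (auto simp: adj_fun_def mone_def)
    qed
    let ?A = "of_entries d f"
    let ?D = "S (cadj ?A * ?A) - S (cadj ?A) * S ?A"
    have A1: "cadj ?A = of_entries d (mstar f)"
      by (rule eq_matI) (auto simp: cadj_def of_entries_def mstar_def)
    have A2: "of_entries d (mstar f) * ?A = of_entries d (mmul d (mstar f) f)"
      by (rule eq_matI) (auto simp: of_entries_def mmul_def scalar_prod_def atLeast0LessThan)
    have D: "?D \<in> carrier_mat d d" unfolding A1 A2 by (auto intro!: minus_carrier_mat mult_carrier_mat S_carrier)
    have "eqd d (entries ?D) (adj_fun d T (mmul d (mstar f) f) - mmul d (mstar (adj_fun d T f)) (adj_fun d T f))"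
      unfolding eqd_def
    proof (intro allI impI)
      fix i j assume ij: "i < d" "j < d"
      have c: "S (of_entries d g) \<in> carrier_mat d d" for g by (intro S_carrier of_entries_carrier)
      have "(S (of_entries d (mstar f)) * S ?A) $$ (i, j) =
          (\<Sum>k<d. S (of_entries d (mstar f)) $$ (i, k) * S ?A $$ (k, j))"
        using c[of f] c[of "mstar f"] ij by (simp add: scalar_prod_def atLeast0LessThan)
      also have "\<dots> = mmul d (mstar (adj_fun d T f)) (adj_fun d T f) i j"
        using ij by (simp add: mmul_def S_eq star)
      finally show "entries ?D i j = (adj_fun d T (mmul d (mstar f) f) - mmul d (mstar (adj_fun d T f)) (adj_fun d T f)) i j"
        using ij c[of f] c[of "mstar f"] c[of "mmul d (mstar f) f"] unfolding A1 A2
        by (simp add: entries_def S_eq minus_apply)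
    qed
    moreover have "pos d (entries ?D)" using sch[OF of_entries_carrier] psd_iff_pos[OF D] by blast
    ultimately show "pos d (adj_fun d T (mmul d (mstar f) f) - mmul d (mstar (adj_fun d T f)) (adj_fun d T f))"
      using pos_cong by blast
  qed
qed

theorem schwarz_map_peripheral_spectrum:
  assumes "schwarz_map d T"
  shows "\<exists>cs. valid_data cs \<and> data_dim cs \<le> d \<and> peripheral_spectrum d T = data_spectrum cs"
proof -
  define m where "m = d * d"
  (* The transpose represents the adjoint map in the basis of matrix units with their indices swapped. *)
  define M where "M = transpose_mat (map_matrix d T)"
  have mm: "map_matrix d T \<in> carrier_mat m m" by (simp add: map_matrix_def m_def)
  then have M: "M \<in> carrier_mat m m" by (simp add: M_def)
  obtain A B l eps where A: "A \<in> carrier_mat m m" and B: "B \<in> carrier_mat m m"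
    and AB: "A * B = 1\<^sub>m m" and BA: "B * A = 1\<^sub>m m"
    and roots: "proots (char_poly M) = mset (map l [0..<m])"
    and MA: "\<And>x j. x < m \<Longrightarrow> j < m \<Longrightarrow> (M * A) $$ (x, j) = l j * A $$ (x, j) + (if eps j then A $$ (x, j - 1) else 0)"
    and eps: "\<And>j. j < m \<Longrightarrow> eps j \<Longrightarrow> 0 < j \<and> l (j - 1) = l j"
    using jordan_basis[OF M] by metis
  \<comment> \<open>Column j of A as a matrix, with entry (i, k) stored at the index of (k, i), the
    swap that goes with the transpose.\<close>
  define b where "b j = (\<lambda>i k. if i < d \<and> k < d then A $$ (k * d + i, j) else 0)" for j
  interpret S: unital_schwarz d "adj_fun d T" by (rule unital_schwarz_adj_fun[OF assms])
  have idx: "x div d < d" "x mod d < d" if "x < m" for x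
    using that by (auto simp: m_def less_mult_imp_div_less intro!: mod_less_divisor intro: gr0I)
  \<comment> \<open>Applying B to a relation among the columns of A returns its coefficients, as B A
    = 1.\<close>
  have ind: "c j = 0" if c: "(\<Sum>j<m. msc (c j) (b j)) = 0" "j < m" for c j
  proof -
    have z: "(\<Sum>i<m. A $$ (x, i) * c i) = 0" if "x < m" for x
    proof -
      have "0 = (\<Sum>i<m. msc (c i) (b i)) (x mod d) (x div d)" by (simp only: c(1) zero_fun_apply)
      also have "\<dots> = (\<Sum>i<m. A $$ (x, i) * c i)"
        using idx[OF that] by (simp add: msc_def b_def mult.commute)
      finally show ?thesis by simp
    qed
    have "c j = (\<Sum>i<m. (if i = j then c i else 0))" using c(2) by simp
    also have "\<dots> = (\<Sum>i<m. (B * A) $$ (j, i) * c i)"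
      using c(2) unfolding BA by (intro sum.cong) auto
    also have "\<dots> = (\<Sum>i<m. \<Sum>x<m. B $$ (j, x) * (A $$ (x, i) * c i))"
      using A B c(2) by (intro sum.cong) (auto simp: scalar_prod_def atLeast0LessThan sum_distrib_right mult.assoc)
    also have "\<dots> = (\<Sum>x<m. B $$ (j, x) * (\<Sum>i<m. A $$ (x, i) * c i))"
      unfolding sum_distrib_left by (rule sum.swap)
    also have "\<dots> = 0" by (intro sum.neutral) (simp add: z)
    finally show ?thesis .
  qed
  interpret jordan_chains d "adj_fun d T" m b l eps
  proof
    fix j assume j: "j < m"
    show "adj_fun d T (b j) = msc (l j) (b j) + (if eps j then b (j - 1) else 0)"
    proof (intro ext)
      fix i k
      show "adj_fun d T (b j) i k = (msc (l j) (b j) + (if eps j then b (j - 1) else 0)) i k"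
      proof (cases "i < d \<and> k < d")
        case True
        then have x: "k * d + i < m" "(k * d + i) div d = k" "(k * d + i) mod d = i"
          using pair_index[of k d i] by (auto simp: m_def)
        have "adj_fun d T (b j) i k = (\<Sum>p<d. \<Sum>q<d. T (unit_mat d k i) $$ (p, q) * A $$ (p * d + q, j))"
          using True by (simp add: adj_fun_def b_def)
        also have "\<dots> = (\<Sum>y<m. T (unit_mat d k i) $$ (y div d, y mod d) * A $$ (y div d * d + y mod d, j))"
          unfolding m_def by (rule sum_div_mod[symmetric])
        also have "\<dots> = (\<Sum>y<m. M $$ (k * d + i, y) * A $$ (y, j))"
          using x by (intro sum.cong) (auto simp: M_def map_matrix_def m_def)
        also have "\<dots> = (M * A) $$ (k * d + i, j)"
          using M A x(1) j by (simp add: scalar_prod_def atLeast0LessThan)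
        also have "\<dots> = (msc (l j) (b j) + (if eps j then b (j - 1) else 0)) i k"
          using True by (simp add: MA[OF x(1) j] msc_def b_def)
        finally show ?thesis .
      qed (auto simp: adj_fun_def msc_def b_def)
    qed
    show "0 < j \<and> l (j - 1) = l j" if "eps j" using eps[OF j that] .
    show "\<exists>p<d. \<exists>q<d. b j p q \<noteq> 0"
    proof (rule ccontr)
      assume "\<not> ?thesis"
      then have "b j = 0" by (auto simp: b_def fun_eq_iff)
      then have "(\<Sum>i<m. msc (if i = j then 1 else 0) (b i)) = 0"
        by (intro sum.neutral) (auto simp: msc_def fun_eq_iff)
      from ind[OF this j] show False by simp
    qed
  next
    fix f
    define c where "c j = (\<Sum>x<m. B $$ (j, x) * f (x mod d) (x div d))" for j
    have "f i k = (\<Sum>j<m. msc (c j) (b j)) i k" if ik: "i < d" "k < d" for i k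
    proof -
      have x: "k * d + i < m" "(k * d + i) div d = k" "(k * d + i) mod d = i"
        using pair_index[OF ik(2,1)] by (auto simp: m_def)
      have "(\<Sum>j<m. msc (c j) (b j)) i k = (\<Sum>j<m. A $$ (k * d + i, j) * c j)"
        using ik by (simp add: msc_def b_def mult.commute)
      also have "\<dots> = (\<Sum>j<m. \<Sum>y<m. A $$ (k * d + i, j) * B $$ (j, y) * f (y mod d) (y div d))"
        by (simp add: c_def sum_distrib_left mult.assoc)
      also have "\<dots> = (\<Sum>y<m. \<Sum>j<m. A $$ (k * d + i, j) * B $$ (j, y) * f (y mod d) (y div d))"
        by (rule sum.swap)
      also have "\<dots> = (\<Sum>y<m. (A * B) $$ (k * d + i, y) * f (y mod d) (y div d))"
        using A B x by (intro sum.cong) (auto simp: scalar_prod_def atLeast0LessThan sum_distrib_right)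
      also have "\<dots> = (\<Sum>y<m. if y = k * d + i then f i k else 0)"
        unfolding AB using x by (intro sum.cong) auto
      also have "\<dots> = f i k" using x by simp
      finally show ?thesis by simp
    qed
    then show "\<exists>c. eqd d f (\<Sum>j<m. msc (c j) (b j))" unfolding eqd_def by blast
  qed
  obtain P n where "peripheral_projection d (adj_fun d T) P n peripheral_indices b l"
    using peripheral_projection_exists by blast
  then interpret P: peripheral_projection d "adj_fun d T" P n peripheral_indices b l .
  have dim: "mvs.dim (P.E z) = card {j \<in> peripheral_indices. l j = z}" for z
  proof (rule P.dim_E_eq)
    fix u s assume u: "(\<Sum>s\<in>peripheral_indices. msc (u s) (b s)) = 0" "s \<in> peripheral_indices"
    have "(\<Sum>j<m. msc (if j \<in> peripheral_indices then u j else 0) (b j)) = (\<Sum>s\<in>peripheral_indices. msc (u s) (b s))"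
      by (rule sum.mono_neutral_cong_right) (auto simp: peripheral_indices_def)
    then have "(\<Sum>j<m. msc (if j \<in> peripheral_indices then u j else 0) (b j)) = 0" using u(1) by simp
    from ind[OF this, of s] show "u s = 0" using u(2) by (auto simp: peripheral_indices_def)
  qed
  obtain cs where cs: "valid_data cs" "data_dim cs \<le> d"
    "\<And>z. count (data_spectrum cs) z = (if cmod z = 1 then mvs.dim (P.E z) else 0)"
    using P.data_of_automorphism by blast
  have "peripheral_spectrum d T = data_spectrum cs"
  proof (rule multiset_eqI)
    fix z
    have "eigenvalues_map d T = mset (map l [0..<m])"
      using roots char_poly_transpose_mat[OF mm] by (simp add: eigenvalues_map_def M_def)
    then have "count (peripheral_spectrum d T) z = (if cmod z = 1 then count (mset (map l [0..<m])) z else 0)"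
      by (simp add: peripheral_spectrum_def)
    also have "count (mset (map l [0..<m])) z = card {j. j < m \<and> l j = z}"
    proof -
      show ?thesis
        unfolding count_mset count_list_eq_length_filter length_filter_conv_card
        by (rule arg_cong[where f = card]) auto
    qed
    also have "(if cmod z = 1 then card {j. j < m \<and> l j = z} else 0) = count (data_spectrum cs) z"
      unfolding cs(3) dim peripheral_indices_def by (auto intro!: arg_cong[where f = card])
    finally show "count (peripheral_spectrum d T) z = count (data_spectrum cs) z" .
  qed
  then show ?thesis using cs(1,2) by blast
qed

section \<open>Channels with prescribed spectrum\<close>

text \<open>Kraus decomposition: the form at v is the sum over the blocks of the form of f at
  \<open>w \<beta>\<close>, the part of v in block \<open>\<beta>\<close> reweighted and moved along
  \<open>\<pi>\<close>.\<close>

lemma pos_pinching: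
  assumes f: "pos N f" and \<pi>: "bij_betw \<pi> {..<N} {..<N}"
  shows "pos N (\<lambda>i j. if blk i = blk j then \<nu> i * cnj (\<nu> j) * f (\<pi> i) (\<pi> j) else 0)" (is "pos N ?F")
  unfolding pos_def
proof (intro allI)
  fix v
  define g where "g = inv_into {..<N} \<pi>"
  have g: "g (\<pi> i) = i" if "i < N" for i
    using that \<pi> by (auto simp: g_def bij_betw_def intro: inv_into_f_f)
  define w where "w \<beta> x = (if blk (g x) = \<beta> then cnj (\<nu> (g x)) * v (g x) else 0)" for \<beta> x
  let ?B = "blk ` {..<N}"
  have re: "sum F {..<N} = (\<Sum>i<N. F (\<pi> i))" for F :: "nat \<Rightarrow> complex"
    using sum.reindex_bij_betw[OF \<pi>, of F] by simp
  have re2: "(\<Sum>i<N. \<Sum>j<N. F i j) = (\<Sum>i<N. \<Sum>j<N. F (\<pi> i) (\<pi> j))" for F :: "nat \<Rightarrow> nat \<Rightarrow> complex"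
  proof -
    have "(\<Sum>j<N. F i j) = (\<Sum>j<N. F i (\<pi> j))" for i by (rule re)
    then show ?thesis using re[of "\<lambda>i. \<Sum>j<N. F i (\<pi> j)"] by simp
  qed
  have "(\<Sum>\<beta>\<in>?B. qf N f (w \<beta>) (w \<beta>)) =
      (\<Sum>\<beta>\<in>?B. \<Sum>i<N. \<Sum>j<N. cnj (w \<beta> (\<pi> i)) * f (\<pi> i) (\<pi> j) * w \<beta> (\<pi> j))"
    unfolding qf_def by (rule sum.cong[OF refl], rule re2)
  also have "\<dots> = (\<Sum>i<N. \<Sum>j<N. \<Sum>\<beta>\<in>?B. cnj (w \<beta> (\<pi> i)) * f (\<pi> i) (\<pi> j) * w \<beta> (\<pi> j))"
    by (subst sum.swap, intro sum.cong refl, rule sum.swap)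
  also have "\<dots> = (\<Sum>i<N. \<Sum>j<N. cnj (v i) * ?F i j * v j)"
  proof (intro sum.cong refl)
    fix i j assume ij: "i \<in> {..<N}" "j \<in> {..<N}"
    have "(\<Sum>\<beta>\<in>?B. cnj (w \<beta> (\<pi> i)) * f (\<pi> i) (\<pi> j) * w \<beta> (\<pi> j)) =
        (\<Sum>\<beta>\<in>?B. if \<beta> = blk i then cnj (v i) * ?F i j * v j else 0)"
      using ij by (intro sum.cong refl) (auto simp: w_def g)
    also have "\<dots> = cnj (v i) * ?F i j * v j" using ij by simp
    finally show "(\<Sum>\<beta>\<in>?B. cnj (w \<beta> (\<pi> i)) * f (\<pi> i) (\<pi> j) * w \<beta> (\<pi> j)) = cnj (v i) * ?F i j * v j" .
  qed
  finally have "qf N ?F v v = (\<Sum>\<beta>\<in>?B. qf N f (w \<beta>) (w \<beta>))" by (simp add: qf_def)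
  then show "Im (qf N ?F v v) = 0 \<and> 0 \<le> Re (qf N ?F v v)"
    using f by (auto simp: pos_def intro!: sum_nonneg)
qed

text \<open>Conjugation by the weighted permutation matrix with entry \<open>\<nu> a\<close> at
  position (a, \<open>\<pi> a\<close>), then the pinching that deletes entries between different
  blocks.\<close>

definition pinch_map :: "nat \<Rightarrow> (nat \<Rightarrow> 'b) \<Rightarrow> (nat \<Rightarrow> nat) \<Rightarrow> (nat \<Rightarrow> complex) \<Rightarrow> complex mat \<Rightarrow> complex mat" where
  "pinch_map D blk \<pi> \<nu> A = mat D D (\<lambda>(a, b).
     if blk a = blk b then \<nu> a * cnj (\<nu> b) * A $$ (\<pi> a, \<pi> b) else 0)"

lemma lin_map_pinch_map:
  assumes "bij_betw \<pi> {..<D} {..<D}"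
  shows "lin_map D (pinch_map D blk \<pi> \<nu>)"
proof -
  have "\<pi> a < D" if "a < D" for a using bij_betwE[OF assms] that by blast
  then show ?thesis
    by (auto simp: lin_map_def pinch_map_def algebra_simps intro!: eq_matI)
qed

lemma trace_preserving_pinch_map:
  assumes "bij_betw \<pi> {..<D} {..<D}" "\<And>a. a < D \<Longrightarrow> cmod (\<nu> a) = 1"
  shows "trace_preserving D (pinch_map D blk \<pi> \<nu>)"
  unfolding trace_preserving_def
proof
  fix A :: "complex mat" assume A: "A \<in> carrier_mat D D"
  have "mtrace (pinch_map D blk \<pi> \<nu> A) = (\<Sum>a<D. A $$ (\<pi> a, \<pi> a))"
    using assms(2) by (simp add: mtrace_def pinch_map_def mult_cnj_norm)
  also have "\<dots> = mtrace A"
    using sum.reindex_bij_betw[OF assms(1), of "\<lambda>a. A $$ (a, a)"] A by (simp add: mtrace_def)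
  finally show "mtrace (pinch_map D blk \<pi> \<nu> A) = mtrace A" .
qed

lemma unital_pinch_map:
  assumes "bij_betw \<pi> {..<D} {..<D}" "\<And>a. a < D \<Longrightarrow> cmod (\<nu> a) = 1"
  shows "unital D (pinch_map D blk \<pi> \<nu>)"
proof -
  have "\<pi> a < D" if "a < D" for a using bij_betwE[OF assms(1)] that by blast
  moreover have "\<pi> a = \<pi> b \<longleftrightarrow> a = b" if "a < D" "b < D" for a b
    using assms(1) that by (auto simp: bij_betw_def inj_on_def)
  ultimately show ?thesis
    unfolding unital_def pinch_map_def
    by (intro eq_matI) (auto simp: mult_cnj_norm assms(2))
qed

text \<open>An ampliation has the same shape, with permutation, blocks and weights acting through
  the index mod D, so \<open>pos_pinching\<close> covers it.\<close>

lemma completely_positive_pinch_map: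
  assumes \<pi>: "bij_betw \<pi> {..<D} {..<D}"
  shows "completely_positive D (pinch_map D blk \<pi> \<nu>)"
  unfolding completely_positive_def
proof (intro allI impI)
  fix n X assume X: "psd (n * D) X"
  define N where "N = n * D"
  have Xc: "X \<in> carrier_mat N N" using X by (simp add: psd_def N_def)
  define \<pi>' where "\<pi>' i = (i div D) * D + \<pi> (i mod D)" for i
  have md: "i mod D < D" if "i < N" for i
  proof -
    have "D > 0" using that by (auto simp: N_def intro: gr0I)
    then show ?thesis by simp
  qed
  have \<pi>D: "\<pi> a < D" if "a < D" for a using bij_betwE[OF \<pi>] that by blast
  have dm: "\<pi>' i div D = i div D" "\<pi>' i mod D = \<pi> (i mod D)" "\<pi>' i < N" if "i < N" for i
  proof -
    have p: "\<pi> (i mod D) < D" using \<pi>D md that by blast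
    then show "\<pi>' i div D = i div D" "\<pi>' i mod D = \<pi> (i mod D)" by (auto simp: \<pi>'_def)
    have "i div D < n" using that by (simp add: N_def less_mult_imp_div_less)
    then have "Suc (i div D) * D \<le> n * D" by (intro mult_le_mono1) simp
    then show "\<pi>' i < N" using p by (simp add: \<pi>'_def N_def)
  qed
  have inj: "inj_on \<pi>' {..<N}"
  proof (rule inj_onI)
    fix i j assume ij: "i \<in> {..<N}" "j \<in> {..<N}" "\<pi>' i = \<pi>' j"
    then have "i div D = j div D" "\<pi> (i mod D) = \<pi> (j mod D)" using dm[of i] dm[of j] by auto
    moreover from this have "i mod D = j mod D"
      using \<pi> md ij by (auto simp: bij_betw_def inj_on_def)
    ultimately show "i = j" by (metis div_mult_mod_eq)
  qed
  then have bij: "bij_betw \<pi>' {..<N} {..<N}"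
    using dm(3) by (intro bij_betw_imageI endo_inj_surj) auto
  let ?Y = "ampliate n D (pinch_map D blk \<pi> \<nu>) X"
  have Y: "?Y \<in> carrier_mat N N" by (simp add: ampliate_def N_def)
  have "eqd N (entries ?Y) (\<lambda>i j. if blk (i mod D) = blk (j mod D)
      then \<nu> (i mod D) * cnj (\<nu> (j mod D)) * entries X (\<pi>' i) (\<pi>' j) else 0)"
    using md \<pi>D by (auto simp: eqd_def entries_def ampliate_def pinch_map_def \<pi>'_def N_def)
  moreover have "pos N (entries X)" using X psd_iff_pos[OF Xc] by (simp add: N_def)
  then have "pos N (\<lambda>i j. if blk (i mod D) = blk (j mod D)
      then \<nu> (i mod D) * cnj (\<nu> (j mod D)) * entries X (\<pi>' i) (\<pi>' j) else 0)"
    using pos_pinching[OF _ bij, of _ "\<lambda>i. blk (i mod D)" "\<lambda>i. \<nu> (i mod D)"] by blast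
  ultimately have "pos N (entries ?Y)" using pos_cong by blast
  then show "psd (n * D) ?Y" using psd_iff_pos[OF Y] by (simp add: N_def)
qed

lemma map_matrix_pinch_map:
  assumes \<pi>: "bij_betw \<pi> {..<D} {..<D}" and ab: "a < D" "b < D"
  shows "(\<Sum>y<D * D. map_matrix D (pinch_map D blk \<pi> \<nu>) $$ (a * D + b, y) * x (y div D) (y mod D)) =
    (if blk a = blk b then \<nu> a * cnj (\<nu> b) * x (\<pi> a) (\<pi> b) else 0)"
proof -
  let ?T = "pinch_map D blk \<pi> \<nu>"
  have \<pi>D: "\<pi> a < D" "\<pi> b < D" using bij_betwE[OF \<pi>] ab by auto
  have "(\<Sum>y<D * D. map_matrix D ?T $$ (a * D + b, y) * x (y div D) (y mod D)) =
      (\<Sum>y<D * D. ?T (unit_mat D (y div D) (y mod D)) $$ (a, b) * x (y div D) (y mod D))"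
    using pair_index[OF ab] by (intro sum.cong) (auto simp: map_matrix_def)
  also have "\<dots> = (\<Sum>k<D. \<Sum>l<D. ?T (unit_mat D k l) $$ (a, b) * x k l)"
    by (rule sum_div_mod[of "\<lambda>k l. ?T (unit_mat D k l) $$ (a, b) * x k l"])
  also have "\<dots> = (\<Sum>k<D. \<Sum>l<D. if l = \<pi> b then if k = \<pi> a then
      (if blk a = blk b then \<nu> a * cnj (\<nu> b) * x (\<pi> a) (\<pi> b) else 0) else 0 else 0)"
    using ab \<pi>D by (intro sum.cong refl) (auto simp: pinch_map_def unit_mat_def)
  also have "\<dots> = (\<Sum>k<D. if k = \<pi> a then
      (if blk a = blk b then \<nu> a * cnj (\<nu> b) * x (\<pi> a) (\<pi> b) else 0) else 0)"
    using \<pi>D by (intro sum.cong refl) simp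
  also have "\<dots> = (if blk a = blk b then \<nu> a * cnj (\<nu> b) * x (\<pi> a) (\<pi> b) else 0)" using \<pi>D by simp
  finally show ?thesis .
qed

lemma diagonalizable_proots:
  fixes M :: "complex mat"
  assumes M: "M \<in> carrier_mat m m" and A: "A \<in> carrier_mat m m" and B: "B \<in> carrier_mat m m"
    and BA: "B * A = 1\<^sub>m m"
    and MA: "\<And>x j. x < m \<Longrightarrow> j < m \<Longrightarrow> (M * A) $$ (x, j) = l j * A $$ (x, j)"
  shows "proots (char_poly M) = mset (map l [0..<m])"
proof -
  define L where "L = mat m m (\<lambda>(i, j). if i = j then l j else 0)"
  have L: "L \<in> carrier_mat m m" by (simp add: L_def)
  have AB: "A * B = 1\<^sub>m m" by (rule mat_mult_left_right_inverse[OF B A BA])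
  have "M * A = A * L"
  proof (rule eq_matI)
    fix x j assume xj: "x < dim_row (A * L)" "j < dim_col (A * L)"
    have "(A * L) $$ (x, j) = (\<Sum>i<m. A $$ (x, i) * (if i = j then l j else 0))"
      using xj A by (simp add: scalar_prod_def L_def atLeast0LessThan)
    also have "\<dots> = (\<Sum>i<m. if i = j then l j * A $$ (x, j) else 0)"
      by (intro sum.cong) auto
    finally show "(M * A) $$ (x, j) = (A * L) $$ (x, j)" using xj A L MA by simp
  qed (use M A L in auto)
  then have "M = A * L * B"
    using M A B AB assoc_mult_mat[OF M A B] by simp
  then have "similar_mat M L"
    unfolding similar_mat_def similar_mat_wit_def using M A B L AB BA
    by (intro exI[of _ A] exI[of _ B]) (auto simp: Let_def)
  then have "char_poly M = char_poly L" by (rule char_poly_similar)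
  also have "\<dots> = (\<Prod>a\<leftarrow>diag_mat L. [:- a, 1:])"
    using L by (intro char_poly_upper_triangular[of _ m] upper_triangularI) (auto simp: L_def)
  finally have "proots (char_poly M) = mset (diag_mat L)" by (simp add: proots_linear_factors)
  moreover have "diag_mat L = map l [0..<m]" by (auto simp: diag_mat_def L_def)
  ultimately show ?thesis by simp
qed

text \<open>The indices below \<open>D\<close> are labelled by triples: the summand \<open>C a\<close>, the position \<open>P a\<close> of the
  block in the cycle, and the row \<open>K a\<close> inside the block.\<close>

locale cyclic_labelling =
  fixes D L :: nat and nn dd :: "nat \<Rightarrow> nat" and mu :: "nat \<Rightarrow> nat \<Rightarrow> complex"
    and C P K :: "nat \<Rightarrow> nat" and g :: "nat \<Rightarrow> nat \<Rightarrow> nat \<Rightarrow> nat"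
  assumes label: "a < D \<Longrightarrow> C a < L \<and> P a < nn (C a) \<and> K a < dd (C a)"
    and g: "c < L \<Longrightarrow> m < nn c \<Longrightarrow> k < dd c \<Longrightarrow> g c m k < D \<and> C (g c m k) = c \<and> P (g c m k) = m \<and> K (g c m k) = k"
    and g_label: "a < D \<Longrightarrow> g (C a) (P a) (K a) = a"
    and mu_unimodular: "c < L \<Longrightarrow> k < dd c \<Longrightarrow> cmod (mu c k) = 1"
begin

lemma sum_label:
  fixes f :: "nat \<Rightarrow> nat \<Rightarrow> nat \<Rightarrow> 'a::comm_monoid_add"
  shows "(\<Sum>a<D. f (C a) (P a) (K a)) = (\<Sum>c<L. \<Sum>m<nn c. \<Sum>k<dd c. f c m k)"
proof -
  have "(\<Sum>a<D. f (C a) (P a) (K a)) =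
      (\<Sum>(c, m, k)\<in>(SIGMA c:{..<L}. SIGMA m:{..<nn c}. {..<dd c}). f c m k)"
    by (rule sum.reindex_bij_witness[of _ "\<lambda>(c, m, k). g c m k" "\<lambda>a. (C a, P a, K a)"])
      (use label g g_label in auto)
  also have "\<dots> = (\<Sum>c<L. \<Sum>(m, k)\<in>(SIGMA m:{..<nn c}. {..<dd c}). f c m k)"
    by (subst sum.Sigma) auto
  also have "\<dots> = (\<Sum>c<L. \<Sum>m<nn c. \<Sum>k<dd c. f c m k)"
    by (intro sum.cong refl, subst sum.Sigma) auto
  finally show ?thesis .
qed

lemma label_eq_iff: "a < D \<Longrightarrow> b < D \<Longrightarrow> C a = C b \<Longrightarrow> P a = P b \<Longrightarrow> K a = K b \<Longrightarrow> a = b"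
  using g_label by metis

text \<open>The predecessor of x on the cycle of length n; adding n first avoids truncated
  subtraction.\<close>

definition rot :: "nat \<Rightarrow> nat \<Rightarrow> nat" where "rot n x = (x + n - 1) mod n"

lemma Suc_rot: "x < n \<Longrightarrow> Suc (rot n x) mod n = x"
  by (simp add: rot_def mod_Suc_eq)

lemma rot_less: "x < n \<Longrightarrow> rot n x < n"
  by (simp add: rot_def)

definition \<pi> :: "nat \<Rightarrow> nat" where "\<pi> a = g (C a) (rot (nn (C a)) (P a)) (K a)"

lemma \<pi>_label:
  assumes "a < D"
  shows "\<pi> a < D" "C (\<pi> a) = C a" "P (\<pi> a) = rot (nn (C a)) (P a)" "K (\<pi> a) = K a"
  using g[of "C a" "rot (nn (C a)) (P a)" "K a"] label[OF assms] rot_less unfolding \<pi>_def by auto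

lemma rot_inj: "x < n \<Longrightarrow> y < n \<Longrightarrow> rot n x = rot n y \<Longrightarrow> x = y"
  using Suc_rot by metis

lemma bij_\<pi>: "bij_betw \<pi> {..<D} {..<D}"
proof -
  have "inj_on \<pi> {..<D}"
  proof (rule inj_onI)
    fix a b assume ab: "a \<in> {..<D}" "b \<in> {..<D}" "\<pi> a = \<pi> b"
    then have "C a = C b" "K a = K b" "rot (nn (C a)) (P a) = rot (nn (C b)) (P b)"
      using \<pi>_label[of a] \<pi>_label[of b] by auto
    moreover from this have "P a = P b"
      using label[of a] label[of b] ab(1,2) rot_inj[of "P a" "nn (C a)" "P b"] by simp
    ultimately show "a = b" using label_eq_iff[of a b] ab by simp
  qed
  then show ?thesis using \<pi>_label(1) by (intro bij_betw_imageI endo_inj_surj) auto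
qed

definition blk :: "nat \<Rightarrow> nat \<times> nat" where "blk a = (C a, P a)"

definition \<nu> :: "nat \<Rightarrow> complex" where "\<nu> a = mu (C a) (K a)"

lemma cmod_\<nu>: "a < D \<Longrightarrow> cmod (\<nu> a) = 1"
  using mu_unimodular label by (auto simp: \<nu>_def)

lemma blk_\<pi>: "a < D \<Longrightarrow> b < D \<Longrightarrow> blk (\<pi> a) = blk (\<pi> b) \<longleftrightarrow> blk a = blk b"
  using \<pi>_label[of a] \<pi>_label[of b] label[of a] label[of b] rot_inj[of "P a" "nn (C a)" "P b"]
  by (auto simp: blk_def)

definition \<zeta> :: "nat \<Rightarrow> nat \<Rightarrow> complex" where "\<zeta> n m = cis (2 * pi * real m / real n)"

lemma \<zeta>_power: "n > 0 \<Longrightarrow> \<zeta> n m ^ n = 1"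
  using bij_betw_roots_unity[of n] by (simp add: \<zeta>_def DeMoivre cis_multiple_2pi)

lemma \<zeta>_cnj: "\<zeta> n m * cnj (\<zeta> n m) = 1" "cnj (\<zeta> n m) * \<zeta> n m = 1"
  by (simp_all add: mult_cnj_norm \<zeta>_def)

lemma power_mod_eq: "(z :: complex) ^ n = 1 \<Longrightarrow> z ^ (k mod n) = z ^ k"
  by (metis mult_div_mod_eq mult_1 power_add power_mult power_one)

text \<open>A Fourier mode is an eigenvector of the cyclic shift; the wrap-around is harmless
  because \<open>\<zeta> n m\<close> is an n-th root of unity.\<close>

lemma \<zeta>_rot:
  assumes "x < n"
  shows "cnj (\<zeta> n m) ^ rot n x = \<zeta> n m * cnj (\<zeta> n m) ^ x"
proof -
  have 1: "cnj (\<zeta> n m) ^ n = 1" using \<zeta>_power[of n m] assms by (simp flip: complex_cnj_power)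
  have "cnj (\<zeta> n m) ^ x = cnj (\<zeta> n m) ^ (Suc (rot n x) mod n)" using Suc_rot[OF assms] by simp
  also have "\<dots> = cnj (\<zeta> n m) * cnj (\<zeta> n m) ^ rot n x" using power_mod_eq[OF 1] by simp
  finally have "\<zeta> n m * cnj (\<zeta> n m) ^ x = (\<zeta> n m * cnj (\<zeta> n m)) * cnj (\<zeta> n m) ^ rot n x"
    by (simp only: mult.assoc)
  then show ?thesis by (simp add: \<zeta>_cnj)
qed

lemma \<zeta>_orthogonal:
  assumes "x < n" "y < n"
  shows "(\<Sum>k<n. cnj (cnj (\<zeta> n x) ^ k) * cnj (\<zeta> n y) ^ k) = (if x = y then of_nat n else 0)"
proof -
  define z where "z = \<zeta> n x * cnj (\<zeta> n y)"
  have n: "n > 0" using assms by simp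
  have s: "(\<Sum>k<n. cnj (cnj (\<zeta> n x) ^ k) * cnj (\<zeta> n y) ^ k) = (\<Sum>k<n. z ^ k)"
    by (simp add: z_def power_mult_distrib)
  show ?thesis
  proof (cases "x = y")
    case True
    then show ?thesis unfolding s by (simp add: z_def \<zeta>_cnj)
  next
    case False
    have "z \<noteq> 1"
    proof
      assume "z = 1"
      then have "\<zeta> n x * (cnj (\<zeta> n y) * \<zeta> n y) = \<zeta> n y" by (simp add: z_def mult.assoc[symmetric])
      then have "\<zeta> n x = \<zeta> n y" by (simp add: \<zeta>_cnj)
      then show False
        using bij_betw_imp_inj_on[OF bij_betw_roots_unity[OF n]] assms False
        by (auto simp: \<zeta>_def inj_on_def)
    qed
    moreover have "z ^ n = 1"
      using \<zeta>_power[OF n] by (simp add: z_def power_mult_distrib flip: complex_cnj_power)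
    ultimately show ?thesis unfolding s using False by (simp add: geometric_sum)
  qed
qed

definition chan :: "complex mat \<Rightarrow> complex mat" where
  "chan = pinch_map D blk \<pi> \<nu>"

text \<open>The eigenvector with label \<open>(p, q)\<close> is a Fourier mode along the cycle if \<open>p\<close> and \<open>q\<close> lie in the same
  block, and the matrix unit annihilated by the pinching otherwise.\<close>

definition V :: "nat \<Rightarrow> nat \<Rightarrow> nat \<Rightarrow> nat \<Rightarrow> complex" where
  "V p q a b = (if blk p = blk q then
      if C a = C p \<and> C b = C p \<and> P a = P b \<and> K a = K p \<and> K b = K q
      then cnj (\<zeta> (nn (C p)) (P p)) ^ P a else 0
    else if a = p \<and> b = q then 1 else 0)"

text \<open>Here the position \<open>P p\<close> is reread as a Fourier frequency m: the pairs (p,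
  q) in a common block of summand c then run through all k, l, m, which are n_c d_c^2 in
  number.\<close>

definition ev :: "nat \<Rightarrow> nat \<Rightarrow> complex" where
  "ev p q = (if blk p = blk q then \<nu> p * cnj (\<nu> q) * \<zeta> (nn (C p)) (P p) else 0)"

text \<open>The squared norm of the eigenvector \<open>V p q\<close>.\<close>

definition wt :: "nat \<Rightarrow> nat \<Rightarrow> complex" where
  "wt p q = (if blk p = blk q then of_nat (nn (C p)) else 1)"

lemma V_eigen:
  assumes "a < D" "b < D" "p < D" "q < D"
  shows "(if blk a = blk b then \<nu> a * cnj (\<nu> b) * V p q (\<pi> a) (\<pi> b) else 0) = ev p q * V p q a b"
proof (cases "blk p = blk q")
  case True
  show ?thesis
  proof (cases "C a = C p \<and> C b = C p \<and> P a = P b \<and> K a = K p \<and> K b = K q")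
    case t: True
    then have "V p q (\<pi> a) (\<pi> b) = cnj (\<zeta> (nn (C p)) (P p)) ^ rot (nn (C p)) (P a)"
      using True assms by (simp add: V_def \<pi>_label)
    also have "\<dots> = \<zeta> (nn (C p)) (P p) * cnj (\<zeta> (nn (C p)) (P p)) ^ P a"
      using label[OF assms(1)] t by (intro \<zeta>_rot) auto
    finally show ?thesis
      using t True by (auto simp: V_def ev_def \<nu>_def blk_def)
  next
    case f: False
    have "V p q (\<pi> a) (\<pi> b) = 0" if "blk a = blk b"
      using f that True assms by (auto simp: V_def \<pi>_label blk_def)
    then show ?thesis using f True by (auto simp: V_def)
  qed
next
  case False
  have "V p q (\<pi> a) (\<pi> b) = 0" if "blk a = blk b"
    using False that assms blk_\<pi> by (auto simp: V_def)
  then show ?thesis using False by (auto simp: ev_def)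
qed

text \<open>Two Fourier modes have disjoint supports or are orthogonal by
  \<open>\<zeta>_orthogonal\<close>; a matrix unit between different blocks misses the support of
  every mode.\<close>

lemma V_orthogonal:
  assumes "p < D" "q < D" "p' < D" "q' < D"
  shows "(\<Sum>a<D. \<Sum>b<D. cnj (V p q a b) * V p' q' a b) = (if p = p' \<and> q = q' then wt p q else 0)"
proof -
  consider (same) "blk p = blk q" "blk p' = blk q'" "C p = C p'" "K p = K p'" "K q = K q'"
    | (diff) "blk p = blk q" "blk p' = blk q'" "\<not> (C p = C p' \<and> K p = K p' \<and> K q = K q')"
    | (off) "blk p \<noteq> blk q" | (off') "blk p = blk q" "blk p' \<noteq> blk q'" by blast
  then show ?thesis
  proof cases
    case same
    define c where "c = C p"
    define F where "F m = cnj (cnj (\<zeta> (nn c) (P p)) ^ m) * cnj (\<zeta> (nn c) (P p')) ^ m" for m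
    have lp: "c < L" "P p < nn c" "K p < dd c" "P p' < nn c" "K q < dd c"
      using label[OF assms(1)] label[OF assms(3)] label[OF assms(2)] same by (auto simp: c_def blk_def)
    have "(\<Sum>b<D. cnj (V p q a b) * V p' q' a b) = (if C a = c \<and> K a = K p then F (P a) else 0)"
      if a: "a < D" for a
    proof (cases "C a = c \<and> K a = K p")
      case True
      have Pa: "P a < nn c" using label[OF a] True by auto
      have "cnj (V p q a b) * V p' q' a b = (if b = g c (P a) (K q) then F (P a) else 0)" if "b < D" for b
      proof -
        have "C b = c \<and> P a = P b \<and> K b = K q \<longleftrightarrow> b = g c (P a) (K q)"
          using g[OF lp(1) Pa lp(5)] g_label[OF that] by auto
        then show ?thesis using same True by (auto simp: V_def F_def c_def)
      qed
      then show ?thesis using True g[OF lp(1) Pa lp(5)] by simp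
    next
      case False
      then show ?thesis using same by (auto simp: V_def c_def)
    qed
    then have "(\<Sum>a<D. \<Sum>b<D. cnj (V p q a b) * V p' q' a b) =
        (\<Sum>a<D. if C a = c \<and> K a = K p then F (P a) else 0)" by simp
    also have "\<dots> = (\<Sum>c'<L. \<Sum>m<nn c'. \<Sum>k<dd c'. if c' = c \<and> k = K p then F m else 0)"
      by (rule sum_label[of "\<lambda>c' m k. if c' = c \<and> k = K p then F m else 0"])
    also have "\<dots> = (\<Sum>c'<L. if c' = c then (\<Sum>m<nn c. F m) else 0)"
    proof (intro sum.cong refl)
      fix c' assume "c' \<in> {..<L}"
      show "(\<Sum>m<nn c'. \<Sum>k<dd c'. if c' = c \<and> k = K p then F m else 0) = (if c' = c then \<Sum>m<nn c. F m else 0)"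
        using lp by (cases "c' = c") auto
    qed
    also have "\<dots> = (\<Sum>m<nn c. F m)" using lp by simp
    also have "\<dots> = (if P p = P p' then of_nat (nn c) else 0)"
      unfolding F_def using lp by (intro \<zeta>_orthogonal)
    also have "\<dots> = (if p = p' \<and> q = q' then wt p q else 0)"
    proof -
      have "p = p' \<and> q = q' \<longleftrightarrow> P p = P p'"
        using same label_eq_iff assms by (auto simp: blk_def)
      then show ?thesis using same by (simp add: wt_def c_def)
    qed
    finally show ?thesis .
  next
    case diff
    then have "cnj (V p q a b) * V p' q' a b = 0" for a b by (auto simp: V_def)
    moreover have "\<not> (p = p' \<and> q = q')" using diff by auto
    ultimately show ?thesis by (simp only: if_False sum.neutral_const)
  next
    case off
    have "cnj (V p q a b) * V p' q' a b = (if a = p then if b = q then V p' q' p q else 0 else 0)" for a b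
      using off by (simp add: V_def[of p q])
    then have "(\<Sum>a<D. \<Sum>b<D. cnj (V p q a b) * V p' q' a b) =
        (\<Sum>a<D. if a = p then V p' q' p q else 0)" using assms by (intro sum.cong) auto
    also have "\<dots> = V p' q' p q" using assms by simp
    also have "\<dots> = (if p = p' \<and> q = q' then wt p q else 0)"
      using off by (auto simp: V_def wt_def blk_def)
    finally show ?thesis .
  next
    case off'
    have "cnj (V p q a b) * V p' q' a b = (if a = p' then if b = q' then cnj (V p q p' q') else 0 else 0)" for a b
      using off' by (simp add: V_def[of p' q'])
    then have "(\<Sum>a<D. \<Sum>b<D. cnj (V p q a b) * V p' q' a b) =
        (\<Sum>a<D. if a = p' then cnj (V p q p' q') else 0)" using assms by (intro sum.cong) auto
    also have "\<dots> = cnj (V p q p' q')" using assms by simp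
    also have "\<dots> = (if p = p' \<and> q = q' then wt p q else 0)"
    proof -
      have "\<not> (C p' = C p \<and> C q' = C p \<and> P p' = P q' \<and> K p' = K p \<and> K q' = K q)"
        using off'(2) unfolding blk_def by metis
      then have "V p q p' q' = 0" using off'(1) unfolding V_def by (simp only: if_True if_False refl)
      moreover have "\<not> (p = p' \<and> q = q')" using off' by blast
      ultimately show ?thesis by (simp only: if_False complex_cnj_zero)
    qed
    finally show ?thesis .
  qed
qed

lemma eigenvalues_chan: "eigenvalues_map D chan = (\<Sum>p<D. \<Sum>q<D. {#ev p q#})"
proof -
  define m where "m = D * D"
  define A where "A = mat m m (\<lambda>(y, z). V (z div D) (z mod D) (y div D) (y mod D))"
  \<comment> \<open>By orthogonality the inverse of A is its conjugate transpose with rows divided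
    by the squared norms.\<close>
  define B where "B = mat m m (\<lambda>(z, y). cnj (V (z div D) (z mod D) (y div D) (y mod D)) / wt (z div D) (z mod D))"
  have idx: "x div D < D" "x mod D < D" if "x < m" for x
    using that by (auto simp: m_def less_mult_imp_div_less intro!: mod_less_divisor intro: gr0I)
  have M: "map_matrix D chan \<in> carrier_mat m m" by (simp add: map_matrix_def m_def)
  have "B * A = 1\<^sub>m m"
  proof (rule eq_matI)
    fix z z' assume zz: "z < dim_row (1\<^sub>m m)" "z' < dim_col (1\<^sub>m m)"
    then have z: "z < m" "z' < m" by auto
    have "(B * A) $$ (z, z') = (\<Sum>y<m. cnj (V (z div D) (z mod D) (y div D) (y mod D)) *
        V (z' div D) (z' mod D) (y div D) (y mod D)) / wt (z div D) (z mod D)"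
      using z by (simp add: A_def B_def scalar_prod_def atLeast0LessThan sum_divide_distrib)
    also have "\<dots> = (\<Sum>a<D. \<Sum>b<D. cnj (V (z div D) (z mod D) a b) * V (z' div D) (z' mod D) a b) / wt (z div D) (z mod D)"
      unfolding m_def sum_div_mod[of "\<lambda>a b. cnj (V (z div D) (z mod D) a b) * V (z' div D) (z' mod D) a b"] ..
    also have "\<dots> = (if z div D = z' div D \<and> z mod D = z' mod D then wt (z div D) (z mod D) else 0) / wt (z div D) (z mod D)"
      using idx z by (subst V_orthogonal) auto
    also have "\<dots> = (if z = z' then 1 else 0)"
    proof -
      have "wt (z div D) (z mod D) \<noteq> 0"
        using label[OF idx(1)[OF z(1)]] by (auto simp: wt_def)
      moreover have "z div D = z' div D \<and> z mod D = z' mod D \<longleftrightarrow> z = z'" by (metis div_mult_mod_eq)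
      ultimately show ?thesis by (cases "z = z'") auto
    qed
    finally show "(B * A) $$ (z, z') = 1\<^sub>m m $$ (z, z')" using z by simp
  qed (simp_all add: A_def B_def)
  moreover have "(map_matrix D chan * A) $$ (x, z) = ev (z div D) (z mod D) * A $$ (x, z)"
    if xz: "x < m" "z < m" for x z
  proof -
    have x: "x div D * D + x mod D = x" by simp
    have "(map_matrix D chan * A) $$ (x, z) = (\<Sum>y<D * D. map_matrix D chan $$ (x div D * D + x mod D, y) *
        V (z div D) (z mod D) (y div D) (y mod D))"
      using xz M unfolding x by (simp add: A_def scalar_prod_def atLeast0LessThan m_def)
    also have "\<dots> = ev (z div D) (z mod D) * V (z div D) (z mod D) (x div D) (x mod D)"
      unfolding chan_def map_matrix_pinch_map[OF bij_\<pi> idx[OF xz(1)]]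
      by (rule V_eigen[OF idx[OF xz(1)] idx[OF xz(2)]])
    finally show ?thesis using xz by (simp add: A_def)
  qed
  ultimately have "eigenvalues_map D chan = mset (map (\<lambda>z. ev (z div D) (z mod D)) [0..<m])"
    unfolding eigenvalues_map_def using M
    by (intro diagonalizable_proots[of _ m A B]) (auto simp: A_def B_def)
  also have "\<dots> = (\<Sum>z<m. {#ev (z div D) (z mod D)#})"
    by (induction m) (auto simp: lessThan_Suc)
  also have "\<dots> = (\<Sum>p<D. \<Sum>q<D. {#ev p q#})"
    unfolding m_def by (rule sum_div_mod[of "\<lambda>p q. {#ev p q#}"])
  finally show ?thesis .
qed

text \<open>\<open>ev\<close> is zero or unimodular, so the filter keeps exactly the pairs within
  one block; writing p and q as triples leaves a sum over c, k, l, m.\<close>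

lemma filter_eigenvalues:
  "filter_mset (\<lambda>z. cmod z = 1) (\<Sum>p<D. \<Sum>q<D. {#ev p q#}) =
    (\<Sum>c<L. \<Sum>k<dd c. \<Sum>l<dd c. \<Sum>m<nn c. {#mu c k * cnj (mu c l) * \<zeta> (nn c) m#})"
proof -
  have filter_sum: "filter_mset Q (sum f J) = (\<Sum>x\<in>J. filter_mset Q (f x))"
    for Q :: "complex \<Rightarrow> bool" and f :: "nat \<Rightarrow> complex multiset" and J
    by (induction J rule: infinite_finite_induct) auto
  let ?h = "\<lambda>c m k c' m' l. if c' = c \<and> m' = m then {#mu c k * cnj (mu c l) * \<zeta> (nn c) m#} else {#}"
  have "filter_mset (\<lambda>z. cmod z = 1) {#ev p q#} = ?h (C p) (P p) (K p) (C q) (P q) (K q)"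
    if "p < D" "q < D" for p q
    using cmod_\<nu>[OF that(1)] cmod_\<nu>[OF that(2)]
    by (auto simp: ev_def norm_mult \<zeta>_def blk_def \<nu>_def)
  then have "filter_mset (\<lambda>z. cmod z = 1) (\<Sum>p<D. \<Sum>q<D. {#ev p q#}) =
      (\<Sum>p<D. \<Sum>q<D. ?h (C p) (P p) (K p) (C q) (P q) (K q))"
    unfolding filter_sum by simp
  also have "\<dots> = (\<Sum>p<D. \<Sum>c'<L. \<Sum>m'<nn c'. \<Sum>l<dd c'. ?h (C p) (P p) (K p) c' m' l)"
    by (intro sum.cong refl sum_label)
  also have "\<dots> = (\<Sum>p<D. \<Sum>l<dd (C p). {#mu (C p) (K p) * cnj (mu (C p) l) * \<zeta> (nn (C p)) (P p)#})"
  proof (rule sum.cong[OF refl])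
    fix p assume "p \<in> {..<D}"
    then have lp: "C p < L" "P p < nn (C p)" using label by auto
    let ?x = "\<lambda>l. {#mu (C p) (K p) * cnj (mu (C p) l) * \<zeta> (nn (C p)) (P p)#}"
    have "(\<Sum>c'<L. \<Sum>m'<nn c'. \<Sum>l<dd c'. ?h (C p) (P p) (K p) c' m' l) =
        (\<Sum>c'<L. if c' = C p then (\<Sum>m'<nn c'. if m' = P p then (\<Sum>l<dd c'. ?x l) else 0) else 0)"
    proof (rule sum.cong[OF refl])
      fix c'
      have "(\<Sum>l<dd c'. ?h (C p) (P p) (K p) c' m' l) =
          (if c' = C p then if m' = P p then \<Sum>l<dd c'. ?x l else 0 else 0)" for m' by simp
      then show "(\<Sum>m'<nn c'. \<Sum>l<dd c'. ?h (C p) (P p) (K p) c' m' l) =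
          (if c' = C p then \<Sum>m'<nn c'. if m' = P p then \<Sum>l<dd c'. ?x l else 0 else 0)" by simp
    qed
    also have "\<dots> = (\<Sum>l<dd (C p). ?x l)" using lp by simp
    finally show "(\<Sum>c'<L. \<Sum>m'<nn c'. \<Sum>l<dd c'. ?h (C p) (P p) (K p) c' m' l) = (\<Sum>l<dd (C p). ?x l)" .
  qed
  also have "\<dots> = (\<Sum>c<L. \<Sum>m<nn c. \<Sum>k<dd c. \<Sum>l<dd c. {#mu c k * cnj (mu c l) * \<zeta> (nn c) m#})"
    by (rule sum_label[of "\<lambda>c m k. \<Sum>l<dd c. {#mu c k * cnj (mu c l) * \<zeta> (nn c) m#}"])
  also have "\<dots> = (\<Sum>c<L. \<Sum>k<dd c. \<Sum>l<dd c. \<Sum>m<nn c. {#mu c k * cnj (mu c l) * \<zeta> (nn c) m#})"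
  proof (rule sum.cong[OF refl])
    fix c
    have "(\<Sum>m<nn c. \<Sum>k<dd c. \<Sum>l<dd c. {#mu c k * cnj (mu c l) * \<zeta> (nn c) m#}) =
        (\<Sum>k<dd c. \<Sum>m<nn c. \<Sum>l<dd c. {#mu c k * cnj (mu c l) * \<zeta> (nn c) m#})" by (rule sum.swap)
    also have "\<dots> = (\<Sum>k<dd c. \<Sum>l<dd c. \<Sum>m<nn c. {#mu c k * cnj (mu c l) * \<zeta> (nn c) m#})"
      by (intro sum.cong refl sum.swap)
    finally show "(\<Sum>m<nn c. \<Sum>k<dd c. \<Sum>l<dd c. {#mu c k * cnj (mu c l) * \<zeta> (nn c) m#}) =
        (\<Sum>k<dd c. \<Sum>l<dd c. \<Sum>m<nn c. {#mu c k * cnj (mu c l) * \<zeta> (nn c) m#})" .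
  qed
  finally show ?thesis .
qed

end

theorem channel_with_data_spectrum:
  assumes "valid_data cs"
  shows "\<exists>T. lin_map (data_dim cs) T \<and> completely_positive (data_dim cs) T \<and>
    trace_preserving (data_dim cs) T \<and> unital (data_dim cs) T \<and>
    peripheral_spectrum (data_dim cs) T = data_spectrum cs \<and>
    (\<forall>z \<in># eigenvalues_map (data_dim cs) T. z \<noteq> 0 \<longrightarrow> cmod z = 1)"
proof -
  define D where "D = data_dim cs"
  define L where "L = length cs"
  define nn where "nn c = fst (cs ! c)" for c
  define dd where "dd c = length (snd (cs ! c))" for c
  define mu where "mu c k = snd (cs ! c) ! k" for c k
  define Idx where "Idx = (SIGMA c:{..<L}. {..<nn c} \<times> {..<dd c})"
  have "card Idx = (\<Sum>c<L. nn c * dd c)" by (simp add: Idx_def)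
  also have "\<dots> = D"
    by (simp add: D_def data_dim_def sum_list_sum_nth L_def nn_def dd_def atLeast0LessThan case_prod_unfold)
  finally have card: "card Idx = D" .
  have "finite Idx" by (simp add: Idx_def)
  \<comment> \<open>Any enumeration of the triples serves, because the channel is described through
    the labels alone.\<close>
  then obtain h where h: "bij_betw h {..<D} Idx"
    using ex_bij_betw_nat_finite[of Idx] card by (auto simp: atLeast0LessThan)
  define g where "g c m k = inv_into {..<D} h (c, m, k)" for c m k
  interpret cyclic_labelling D L nn dd mu "\<lambda>a. fst (h a)" "\<lambda>a. fst (snd (h a))" "\<lambda>a. snd (snd (h a))" g
  proof
    fix a assume a: "a < D"
    then have "h a \<in> Idx" using h by (auto simp: bij_betw_def)
    then show "fst (h a) < L \<and> fst (snd (h a)) < nn (fst (h a)) \<and> snd (snd (h a)) < dd (fst (h a))"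
      by (auto simp: Idx_def)
    show "g (fst (h a)) (fst (snd (h a))) (snd (snd (h a))) = a"
      using h a by (auto simp: g_def bij_betw_def intro: inv_into_f_f)
  next
    fix c m k assume "c < L" "m < nn c" "k < dd c"
    then have "(c, m, k) \<in> h ` {..<D}" using h by (auto simp: bij_betw_def Idx_def)
    then have "inv_into {..<D} h (c, m, k) \<in> {..<D}" "h (inv_into {..<D} h (c, m, k)) = (c, m, k)"
      by (rule inv_into_into, rule f_inv_into_f)
    then show "g c m k < D \<and> fst (h (g c m k)) = c \<and> fst (snd (h (g c m k))) = m \<and> snd (snd (h (g c m k))) = k"
      by (simp add: g_def)
  next
    fix c k assume ck: "c < L" "k < dd c"
    then have "cs ! c \<in> set cs" "snd (cs ! c) ! k \<in> set (snd (cs ! c))" by (auto simp: L_def dd_def)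
    moreover have "\<forall>x\<in>set cs. \<forall>z\<in>set (snd x). cmod z = 1"
      using assms by (simp add: valid_data_def case_prod_unfold)
    ultimately show "cmod (mu c k) = 1" unfolding mu_def by blast
  qed
  have "peripheral_spectrum D chan = (\<Sum>c<L. \<Sum>k<dd c. \<Sum>l<dd c. \<Sum>m<nn c. {#mu c k * cnj (mu c l) * \<zeta> (nn c) m#})"
    unfolding peripheral_spectrum_def eigenvalues_chan by (rule filter_eigenvalues)
  also have "\<dots> = (\<Sum>c<L. block_spectrum (nn c) (snd (cs ! c)))"
  proof -
    have im: "(\<Sum>m<n. {#f m#}) = image_mset f (mset_set {..<n})" for f :: "nat \<Rightarrow> complex" and n
      by (induction n) (auto simp: lessThan_Suc)
    show ?thesis unfolding block_spectrum_def im mu_def dd_def \<zeta>_def ..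
  qed
  also have "\<dots> = data_spectrum cs"
    by (simp add: data_spectrum_eq sum_list_sum_nth L_def nn_def atLeast0LessThan case_prod_unfold)
  finally have spec: "peripheral_spectrum D chan = data_spectrum cs" .
  have "cmod z = 1" if z: "z \<in># eigenvalues_map D chan" "z \<noteq> 0" for z
  proof -
    obtain p q where pq: "p < D" "q < D" "z = ev p q"
      using z(1) unfolding eigenvalues_chan by (auto simp: set_mset_sum)
    then show ?thesis using z(2) cmod_\<nu>[OF pq(1)] cmod_\<nu>[OF pq(2)]
      by (auto simp: ev_def norm_mult \<zeta>_def split: if_splits)
  qed
  then show ?thesis
    unfolding D_def[symmetric] using spec lin_map_pinch_map[OF bij_\<pi>] completely_positive_pinch_map[OF bij_\<pi>]
      trace_preserving_pinch_map[OF bij_\<pi> cmod_\<nu>] unital_pinch_map[OF bij_\<pi> cmod_\<nu>]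
    by (intro exI[of _ chan]) (auto simp: chan_def)
qed

theorem theorem9:
  shows "(\<forall>(d::nat) T. schwarz_map d T \<longrightarrow>
            (\<exists>cs. valid_data cs \<and> data_dim cs \<le> d \<and>
                  peripheral_spectrum d T = data_spectrum cs))
       \<and> (\<forall>cs. valid_data cs \<longrightarrow>
            (\<exists>T. lin_map (data_dim cs) T \<and> completely_positive (data_dim cs) T \<and>
                 trace_preserving (data_dim cs) T \<and> unital (data_dim cs) T \<and>
                 peripheral_spectrum (data_dim cs) T = data_spectrum cs \<and>
                 (\<forall>z \<in># eigenvalues_map (data_dim cs) T. z \<noteq> 0 \<longrightarrow> cmod z = 1)))"
  using schwarz_map_peripheral_spectrum channel_with_data_spectrum by blast

end
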